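(* Let $m,n\ge 0$ be integers and let $\Pi$ be a polygonal embedding of size $(m,n)$ with signature $\sigma(\Pi)$. Then $\Pi$ is a p-minor of $\mathbb{U}_{\sigma(\Pi),m+2n}$.
   Context: A polygonal embedding $\Pi$ is a simple connected plane graph whose outer face boundary is a cycle $O$, together with a sequence of distinct vertices $c_0,\dots,c_{s-1}$ ($s\ge 2$) on $O$, called corners, appearing in clockwise order along $O$, each of degree exactly two in $\Pi$ (the sequence is the border), and a signature $\sigma(\Pi)$: a word of $s$ symbols, each of the form $a$ or $\bar a$ for a letter $a$, in which every letter occurs exactly twice. The $i$-th side of $\Pi$ is the subpath of $O$ going clockwise from $c_i$ to $c_{i+1 \bmod s}$, and it is associated with the $i$-th symbol of $\sigma(\Pi)$. Two sides whose symbols share the same letter are twin sides, and they must contain the same number of vertices. Each side is oriented: clockwise (from $c_i$ to $c_{i+1}$) if its symbol is positive ($a$), anticlockwise if its symbol is negative ($\bar a$). The sewing $\mathrm{sewing}(\Pi)$ is the graph obtained from $\Pi$ by identifying every pair of twin sides vertex by vertex so that their orientations agree (identified vertices/edges become single vertices/edges). Vertices of $\Pi$ not on $O$ are internal. $\Pi$ has size $(m,n)$ if every side has at most $m$ vertices other than its two corners and $\Pi$ has at most $n$ internal vertices. A polygonal embedding $\Pi$ is a p-minor of a polygonal embedding $\Pi'$ if $\sigma(\Pi)=\sigma(\Pi')$ and $\mathrm{sewing}(\Pi)$ is a minor of $\mathrm{sewing}(\Pi')$. For a signature $\sigma$ with $|\sigma|$ symbols and an integer $m\ge 1$, the polygonal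 embedding $\mathbb{U}_{\sigma,m}$ is defined as follows. Let $N=|\sigma|m$. Start from the half-grid with vertices $(i,j)$, $0\le j\le i<N$, where $(i,j)$ and $(i',j')$ are adjacent iff $|i-i'|+|j-j'|=1$. Add edges joining $(i,i)$ to $(i-1,i-1)$ for all $i$ (indices modulo $N$), so that the diagonal vertices form a cycle, which is the outer face cycle. Then for each $i\in\{0,\dots,|\sigma|-1\}$, subdivide the edge between $(im,im)$ and $(im-1,im-1)$ (modulo $N$) by a new vertex $c_i$. The border is $(c_0,\dots,c_{|\sigma|-1})$, the $i$-th side is the path from $c_i$ to $c_{i+1 \bmod |\sigma|}$ along the outer cycle, and the signature is $\sigma$. *)

theory Defs
  imports "HOL-Complex_Analysis.Complex_Analysis" "HOL-Library.Sublist"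
begin

section \<open>Multigraphs and minors\<close>

text \<open>Undirected multigraphs; an edge with a single end is a loop.\<close>

record ('v, 'e) multigraph =
  mverts :: "'v set"
  medges :: "'e set"
  mends :: "'e \<Rightarrow> 'v set"

definition connected_subgraph :: "('v, 'e) multigraph \<Rightarrow> 'v set \<Rightarrow> 'e set \<Rightarrow> bool" where
  "connected_subgraph G W T \<longleftrightarrow>
     W \<noteq> {} \<and> W \<subseteq> mverts G \<and> T \<subseteq> medges G \<and> (\<forall>f\<in>T. mends G f \<subseteq> W) \<and>
     (\<forall>x\<in>W. \<forall>y\<in>W. (x, y) \<in> {(a, b). \<exists>f\<in>T. mends G f = {a, b}}\<^sup>*)"

text \<open>
  The branch sets of a minor model are the connected subgraphs \<open>(B v, T v)\<close>. They are contracted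
  to the vertices of \<open>H\<close>, the edges \<open>\<psi> e\<close> are kept as the edges of \<open>H\<close>, everything else is
  deleted. The edges \<open>\<psi> e\<close> are distinct and not among the contracted ones, so parallel edges and
  loops of \<open>H\<close> have to be realised with their multiplicity.
\<close>

definition minor_of :: "('v, 'e) multigraph \<Rightarrow> ('w, 'f) multigraph \<Rightarrow> bool" where
  "minor_of H G \<longleftrightarrow>
     (\<exists>B T \<psi>.
        (\<forall>v\<in>mverts H. connected_subgraph G (B v) (T v)) \<and>
        (\<forall>v\<in>mverts H. \<forall>w\<in>mverts H. v \<noteq> w \<longrightarrow> B v \<inter> B w = {}) \<and>
        inj_on \<psi> (medges H) \<and>
        (\<forall>e\<in>medges H.
           \<psi> e \<in> medges G - (\<Union>v\<in>mverts H. T v) \<and>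
           mends G (\<psi> e) \<subseteq> (\<Union>v\<in>mverts H. B v) \<and>
           mends H e = {v \<in> mverts H. B v \<inter> mends G (\<psi> e) \<noteq> {}}))"

section \<open>Plane graphs\<close>

text \<open>
  The vertices are points of the plane and the edges are arcs, as point sets. The ends of an
  edge \<open>e\<close> are the two elements of \<open>e \<inter> V\<close>.
\<close>

definition simple_plane_graph :: "complex set \<Rightarrow> complex set set \<Rightarrow> bool" where
  "simple_plane_graph V E \<longleftrightarrow>
     finite V \<and> finite E \<and>
     (\<forall>e\<in>E. \<exists>g. arc g \<and> path_image g = e \<and> e \<inter> V = {pathstart g, pathfinish g}) \<and>
     (\<forall>e\<in>E. \<forall>f\<in>E. e \<noteq> f \<longrightarrow> e \<inter> f \<subseteq> V) \<and>
     (\<forall>e\<in>E. \<forall>f\<in>E. e \<inter> V = f \<inter> V \<longrightarrow> e = f)"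

definition connected_plane_graph :: "complex set \<Rightarrow> complex set set \<Rightarrow> bool" where
  "connected_plane_graph V E \<longleftrightarrow>
     (\<forall>x\<in>V. \<forall>y\<in>V. (x, y) \<in> {(a, b). \<exists>e\<in>E. e \<inter> V = {a, b}}\<^sup>*)"

text \<open>
  The boundary of the outer (unbounded) face is a cycle of the graph, and \<open>vs\<close> lists the vertices
  of this cycle clockwise: some simple closed curve with winding number \<open>-1\<close> about its inside runs
  through that boundary, visiting the vertices in the order \<open>vs\<close> and following an edge between any
  two consecutive ones.
\<close>

definition clockwise_outer_cycle :: "complex set \<Rightarrow> complex set set \<Rightarrow> complex list \<Rightarrow> bool" where
  "clockwise_outer_cycle V E vs \<longleftrightarrow>
     distinct vs \<and> set vs \<subseteq> V \<and> 3 \<le> length vs \<and>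
     (\<exists>\<gamma> t.
        simple_path \<gamma> \<and> pathfinish \<gamma> = pathstart \<gamma> \<and>
        path_image \<gamma> = frontier (outside (V \<union> \<Union>E)) \<and>
        (\<forall>z\<in>inside (path_image \<gamma>). winding_number \<gamma> z = -1) \<and>
        t 0 = 0 \<and> t (length vs) = 1 \<and>
        (\<forall>i<length vs. t i < t (Suc i) \<and> \<gamma> (t i) = vs ! i \<and> \<gamma> ` {t i..t (Suc i)} \<in> E))"

section \<open>Polygonal embeddings\<close>

datatype 'a symbol = Pos (letter: 'a) | Neg (letter: 'a)

text \<open>
  The list \<open>outer\<close> enumerates the outer cycle clockwise, starting at the first corner; for a
  polygonal embedding it is determined by the other components.
\<close>

record 'a polygonal =
  verts :: "complex set"
  edges :: "complex set set"
  outer :: "complex list"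
  border :: "complex list"
  signature :: "'a symbol list"

text \<open>Vertices of the \<open>i\<close>-th side in clockwise order, both corners included.\<close>

definition side :: "'a polygonal \<Rightarrow> nat \<Rightarrow> complex list" where
  "side P i =
     (let c = border P ! i; c' = border P ! (Suc i mod length (border P))
      in takeWhile (\<lambda>v. v \<noteq> c') (dropWhile (\<lambda>v. v \<noteq> c) (outer P)) @ [c'])"

definition twin :: "'a polygonal \<Rightarrow> nat \<Rightarrow> nat \<Rightarrow> bool" where
  "twin P i j \<longleftrightarrow>
     i < length (signature P) \<and> j < length (signature P) \<and> i \<noteq> j \<and>
     letter (signature P ! i) = letter (signature P ! j)"

definition is_signature :: "'a symbol list \<Rightarrow> bool" where
  "is_signature w \<longleftrightarrow> (\<forall>a\<in>letter ` set w. count_list (map letter w) a = 2)"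

definition polygonal_embedding :: "'a polygonal \<Rightarrow> bool" where
  "polygonal_embedding P \<longleftrightarrow>
     simple_plane_graph (verts P) (edges P) \<and>
     connected_plane_graph (verts P) (edges P) \<and>
     clockwise_outer_cycle (verts P) (edges P) (outer P) \<and>
     2 \<le> length (border P) \<and>
     subseq (border P) (outer P) \<and> hd (border P) = hd (outer P) \<and>
     (\<forall>c\<in>set (border P). card {e \<in> edges P. c \<in> e} = 2) \<and>
     length (signature P) = length (border P) \<and> is_signature (signature P) \<and>
     (\<forall>i j. twin P i j \<longrightarrow> length (side P i) = length (side P j))"

definition has_size :: "'a polygonal \<Rightarrow> nat \<Rightarrow> nat \<Rightarrow> bool" where
  "has_size P m n \<longleftrightarrow>
     (\<forall>i<length (border P). length (side P i) \<le> m + 2) \<and>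
     card (verts P - set (outer P)) \<le> n"

section \<open>Sewing\<close>

definition oriented_side :: "'a polygonal \<Rightarrow> nat \<Rightarrow> complex list" where
  "oriented_side P i = (case signature P ! i of Pos _ \<Rightarrow> side P i | Neg _ \<Rightarrow> rev (side P i))"

text \<open>The next two relations are symmetric because \<open>twin\<close> is.\<close>

definition vertex_ident :: "'a polygonal \<Rightarrow> complex rel" where
  "vertex_ident P =
     {(oriented_side P i ! k, oriented_side P j ! k) | i j k. twin P i j \<and> k < length (side P i)}"

definition edge_ident :: "'a polygonal \<Rightarrow> complex set rel" where
  "edge_ident P =
     {(e, f). e \<in> edges P \<and> f \<in> edges P \<and>
        (\<exists>i j k. twin P i j \<and> Suc k < length (side P i) \<and>
           e \<inter> verts P = {oriented_side P i ! k, oriented_side P i ! Suc k} \<and>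
           f \<inter> verts P = {oriented_side P j ! k, oriented_side P j ! Suc k})}"

definition sewing :: "'a polygonal \<Rightarrow> (complex set, complex set set) multigraph" where
  "sewing P =
     \<lparr> mverts = verts P // (vertex_ident P)\<^sup>*,
       medges = edges P // (edge_ident P)\<^sup>*,
       mends = (\<lambda>F. {A \<in> verts P // (vertex_ident P)\<^sup>*. \<exists>e\<in>F. A \<inter> e \<noteq> {}}) \<rparr>"

definition p_minor :: "'a polygonal \<Rightarrow> 'a polygonal \<Rightarrow> bool" where
  "p_minor P Q \<longleftrightarrow> signature P = signature Q \<and> minor_of (sewing P) (sewing Q)"

section \<open>The polygonal embedding \<open>\<bbbU>\<close>\<close>

definition grid_point :: "nat \<Rightarrow> nat \<Rightarrow> complex" where
  "grid_point i j = Complex (real i) (real j)"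

text \<open>
  A straight-line drawing, with \<open>s\<close> sides and \<open>N = s * m\<close>. For \<open>0 < i < s\<close> the corner \<open>c\<^sub>i\<close> lies
  on the diagonal strictly between \<open>(im-1,im-1)\<close> and \<open>(im,im)\<close>. The edge joining \<open>(N-1,N-1)\<close> to
  \<open>(0,0)\<close> has to go around the half-grid, and its subdivision vertex \<open>c\<^sub>0\<close> is put at \<open>(N,-1)\<close>, so
  that increasing indices run clockwise. For \<open>m = 0\<close> there are no grid vertices and only the
  polygon of the corners remains.
\<close>

definition U_corner :: "nat \<Rightarrow> nat \<Rightarrow> nat \<Rightarrow> complex" where
  "U_corner s m i =
     (if i = 0 then Complex (real (s * m)) (-1)
      else let t = real (i * m) - 1 + real i / real s in Complex t t)"

definition U_outer :: "nat \<Rightarrow> nat \<Rightarrow> complex list" where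
  "U_outer s m =
     concat (map (\<lambda>i. U_corner s m i # map (\<lambda>k. grid_point k k) [i * m..<Suc i * m]) [0..<s])"

definition U_grid_edges :: "nat \<Rightarrow> complex set set" where
  "U_grid_edges N =
     {closed_segment (grid_point i j) (grid_point i' j') | i j i' j'.
        j \<le> i \<and> i < N \<and> j' \<le> i' \<and> i' < N \<and>
        \<bar>int i - int i'\<bar> + \<bar>int j - int j'\<bar> = 1}"

definition U_outer_edges :: "nat \<Rightarrow> nat \<Rightarrow> complex set set" where
  "U_outer_edges s m =
     (let vs = U_outer s m
      in {closed_segment (vs ! k) (vs ! (Suc k mod length vs)) | k. k < length vs})"

definition U_embedding :: "'a symbol list \<Rightarrow> nat \<Rightarrow> 'a polygonal" where
  "U_embedding \<sigma> m =
     (let s = length \<sigma>; N = s * m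
      in \<lparr> verts = {grid_point i j | i j. j \<le> i \<and> i < N} \<union> U_corner s m ` {..<s},
           edges = U_grid_edges N \<union> U_outer_edges s m,
           outer = U_outer s m,
           border = map (U_corner s m) [0..<s],
           signature = \<sigma> \<rparr>)"

end

theory Submission
  imports Defs
begin

text \<open>
  Cut the disc of the polygon open along a forest that joins every internal vertex to the outer cycle.
  The outer cycle becomes a word in which each outer vertex \<open>v\<close> is replaced by the walk around the tree
  attached to it, and all edges become non-crossing chords between positions of this word. The word is
  found by induction on the number of edges: a path through a side of a cycle splits this side in two
  by Janiszewski's theorem, and a part that hangs at a single vertex is cut open along a cycle
  through this vertex, whose two sides are treated separately.

  The walk of a tree with \<open>k\<close> internal vertices adds \<open>2 * k\<close> positions to its side. The same positions are
  added to the twin side, whose polygon has room there for chords joining the several occurrences of a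
  vertex, and this makes the occurrences connected after sewing. Every side has then
  at most \<open>m + 2 * n\<close> positions besides its corners, and all vertices lie on the outer cycle.

  Finally, a family of non-crossing chords between the diagonal vertices of the half-grid is realised by
  hooks. The vertex \<open>j\<close> uses the points \<open>(i, j)\<close> of its column up to its longest chord to the right and the
  points of its row up to its longest chord to the left. As no two chords cross, the hooks conflict at
  most where they meet to form a chord.
\<close>

section \<open>Words with non-crossing chords\<close>

text \<open>Why the twin has to help: between two occurrences of a cut vertex lies the walk around a
  subtree, and edges of the graph may leave this stretch, so a chord joining the two occurrences can
  be blocked. No edge of the graph ends in the mirrored stretch, so there the link is always free.
  For sewing to carry it back, twin sides must hold the same symbols at the same places, where an
  outer vertex is written only as its number along the side. Hence each twin carries the walks of
  both. Walks of different vertices have no internal vertex in common, so both sides together cost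
  \<open>2 * n\<close> positions and not twice as many. Two kinds of objects escape this treatment.
  A corner belongs to two sides and so to two symbol words; having degree two it meets no inner edge
  and stays without a tree. An edge of the outer cycle may be identified with another edge by
  sewing, so its model must be an edge of a side, and consecutive vertices of a side must remain
  neighbours somewhere in the enlarged word.\<close>

definition noncrossing :: "(nat \<times> nat) set \<Rightarrow> bool" where
  "noncrossing C \<longleftrightarrow> (\<forall>p q p' q'. (p, q) \<in> C \<longrightarrow> (p', q') \<in> C \<longrightarrow> \<not> (p < p' \<and> p' < q \<and> q < q'))"

definition same_letter_chords :: "'b list \<Rightarrow> (nat \<times> nat) set \<Rightarrow> 'b \<Rightarrow> nat rel" where
  "same_letter_chords w C z = {(a, b). w ! a = z \<and> w ! b = z \<and> ((a, b) \<in> C \<or> (b, a) \<in> C)}"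

text \<open>Chords between neighbouring positions cross nothing, so they are demanded from the
  outset: they link equal letters at a seam and realise an edge between two adjacent letters for
  free.\<close>

definition chords_of :: "'b list \<Rightarrow> (nat \<times> nat) set \<Rightarrow> bool" where
  "chords_of w C \<longleftrightarrow> noncrossing C \<and> (\<forall>p q. (p, q) \<in> C \<longrightarrow> p < q \<and> q < length w) \<and>
     (\<forall>p. Suc p < length w \<longrightarrow> (p, Suc p) \<in> C)"

text \<open>\<open>X\<close> holds the edges, as pairs of letters, that must be realised between
  some occurrences of their ends. \<open>K\<close> holds the letters whose occurrences must be
  linked by chords between equal letters. Words of drawings come with \<open>K\<close> empty,
  mirrored trees with \<open>X\<close> empty.\<close>

definition chord_word :: "'b list \<Rightarrow> 'b set set \<Rightarrow> 'b set \<Rightarrow> bool" where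
  "chord_word w X K \<longleftrightarrow>
     (\<exists>C. chords_of w C \<and> (\<forall>e\<in>X. \<exists>p q. (p, q) \<in> C \<and> e = {w ! p, w ! q}) \<and>
       (\<forall>z\<in>K. \<forall>p q. p < length w \<longrightarrow> q < length w \<longrightarrow> w ! p = z \<longrightarrow> w ! q = z \<longrightarrow>
          (p, q) \<in> (same_letter_chords w C z)\<^sup>*))"

lemma chord_wordE:
  assumes "chord_word w X K"
  obtains C where "chords_of w C" "\<forall>e\<in>X. \<exists>p q. (p, q) \<in> C \<and> e = {w ! p, w ! q}"
     "\<forall>z\<in>K. \<forall>p q. p < length w \<longrightarrow> q < length w \<longrightarrow> w ! p = z \<longrightarrow> w ! q = z \<longrightarrow>
          (p, q) \<in> (same_letter_chords w C z)\<^sup>*"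
  using assms unfolding chord_word_def by (elim exE conjE) (rule that)

lemma chord_wordI:
  assumes "chords_of w C" "\<And>e. e \<in> X \<Longrightarrow> \<exists>p q. (p, q) \<in> C \<and> e = {w ! p, w ! q}"
    "\<And>z p q. z \<in> K \<Longrightarrow> p < length w \<Longrightarrow> q < length w \<Longrightarrow> w ! p = z \<Longrightarrow> w ! q = z \<Longrightarrow>
       (p, q) \<in> (same_letter_chords w C z)\<^sup>*"
  shows "chord_word w X K"
  unfolding chord_word_def by (intro exI[of _ C] conjI ballI allI impI assms)

lemma rtrancl_image:
  assumes "(p, q) \<in> r\<^sup>*" and "\<And>a b. (a, b) \<in> r \<Longrightarrow> (h a, h b) \<in> s"
  shows "(h p, h q) \<in> s\<^sup>*"
  using assms(1) by induction (auto intro: assms(2) rtrancl_into_rtrancl)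

text \<open>All chords of \<open>W\<close> stay in one gap of \<open>P @ Q\<close>, so chords of
  different origin cannot cross. A letter keeps its links if it lives in only one of the two words.
  The last alternative is for two words glued at a common letter, where the neighbouring chord at
  the seam connects the two groups of occurrences.\<close>

lemma chord_word_insert:
  assumes 1: "chord_word (P @ Q) X K" and 2: "chord_word W X' K'"
    and 3: "\<And>z. z \<in> K'' \<Longrightarrow> z \<in> K \<and> z \<notin> set W \<or> z \<in> K' \<and> z \<notin> set (P @ Q) \<or>
         z \<in> K \<and> z \<in> K' \<and> Q = [] \<and> P \<noteq> [] \<and> W \<noteq> [] \<and> last P = z \<and> hd W = z"
  shows "chord_word (P @ W @ Q) (X \<union> X') K''"
proof -
  from 1 obtain C where C: "chords_of (P @ Q) C"
      "\<forall>e\<in>X. \<exists>p q. (p, q) \<in> C \<and> e = {(P @ Q) ! p, (P @ Q) ! q}"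
      "\<forall>z\<in>K. \<forall>p q. p < length (P @ Q) \<longrightarrow> q < length (P @ Q) \<longrightarrow> (P @ Q) ! p = z \<longrightarrow> (P @ Q) ! q = z \<longrightarrow>
          (p, q) \<in> (same_letter_chords (P @ Q) C z)\<^sup>*"
    by (elim chord_wordE) (rule that)
  note C = C(1) bspec[OF C(2)] C(3)[rule_format]
  from 2 obtain C' where C': "chords_of W C'"
      "\<forall>e\<in>X'. \<exists>p q. (p, q) \<in> C' \<and> e = {W ! p, W ! q}"
      "\<forall>z\<in>K'. \<forall>p q. p < length W \<longrightarrow> q < length W \<longrightarrow> W ! p = z \<longrightarrow> W ! q = z \<longrightarrow>
          (p, q) \<in> (same_letter_chords W C' z)\<^sup>*"
    by (elim chord_wordE) (rule that)
  note C' = C'(1) bspec[OF C'(2)] C'(3)[rule_format]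
  let ?w = "P @ W @ Q"
  \<comment> \<open>\<open>f\<close> and \<open>g\<close> renumber the positions of
    \<open>P @ Q\<close> and of \<open>W\<close>; \<open>A\<close> supplies the neighbouring chords
    that are missing at the seams.\<close>
  define f where "f p = (if p < length P then p else p + length W)" for p
  define g where "g p = p + length P" for p :: nat
  define A where "A = {(p, Suc p) | p. Suc p < length ?w}"
  define CC where "CC = (\<lambda>(p, q). (f p, f q)) ` C \<union> (\<lambda>(p, q). (g p, g q)) ` C' \<union> A"
  have nf: "?w ! f p = (P @ Q) ! p" if "p < length (P @ Q)" for p
    using that by (auto simp: f_def nth_append)
  have ng: "?w ! g p = W ! p" if "p < length W" for p
    using that by (auto simp: g_def nth_append)
  have CC_cases: "(\<exists>a b. p = f a \<and> q = f b \<and> (a, b) \<in> C) \<or> (\<exists>a b. p = g a \<and> q = g b \<and> (a, b) \<in> C')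
       \<or> q = Suc p \<and> Suc p < length ?w" if "(p, q) \<in> CC" for p q
    using that by (auto simp: CC_def A_def)
  have bC: "a < b \<and> b < length P + length Q" if "(a, b) \<in> C" for a b
    using that C(1) by (auto simp: chords_of_def)
  have bC': "a < b \<and> b < length W" if "(a, b) \<in> C'" for a b
    using that C'(1) by (auto simp: chords_of_def)
  have ncC: "\<not> (p < p' \<and> p' < q \<and> q < q')" if "(p, q) \<in> C" "(p', q') \<in> C" for p q p' q'
    using that C(1) by (auto simp: chords_of_def noncrossing_def)
  have ncC': "\<not> (p < p' \<and> p' < q \<and> q < q')" if "(p, q) \<in> C'" "(p', q') \<in> C'" for p q p' q'
    using that C'(1) by (auto simp: chords_of_def noncrossing_def)
  have fm: "f a < f b \<longleftrightarrow> a < b" for a b by (auto simp: f_def)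
  have gm: "g a < g b \<longleftrightarrow> a < b" for a b by (auto simp: g_def)
  have fg: "f a < length P \<or> length P + length W \<le> f a" for a by (auto simp: f_def)
  have gr: "a < length W \<Longrightarrow> length P \<le> g a \<and> g a < length P + length W" for a by (auto simp: g_def)
  have "noncrossing CC"
    unfolding noncrossing_def
  proof (intro allI impI notI)
    fix p q p' q' assume pq: "(p, q) \<in> CC" and pq': "(p', q') \<in> CC" and x: "p < p' \<and> p' < q \<and> q < q'"
    from x have "q \<noteq> Suc p" "q' \<noteq> Suc p'" by auto
    with CC_cases[OF pq] CC_cases[OF pq']
    consider (ff) a b a' b' where "p = f a" "q = f b" "(a, b) \<in> C" "p' = f a'" "q' = f b'" "(a', b') \<in> C"
      | (fg) a b a' b' where "p = f a" "q = f b" "(a, b) \<in> C" "p' = g a'" "q' = g b'" "(a', b') \<in> C'"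
      | (gf) a b a' b' where "p = g a" "q = g b" "(a, b) \<in> C'" "p' = f a'" "q' = f b'" "(a', b') \<in> C"
      | (gg) a b a' b' where "p = g a" "q = g b" "(a, b) \<in> C'" "p' = g a'" "q' = g b'" "(a', b') \<in> C'"
      by blast
    then show False
    proof cases
      case ff then show False using x ncC[of a b a' b'] by (simp add: fm)
    next
      case fg
      then show False using x bC'[of a' b'] gr[of a'] gr[of b'] \<open>\<And>a. f a < length P \<or> length P + length W \<le> f a\<close>[of b] by linarith
    next
      case gf
      then show False using x bC'[of a b] gr[of a] gr[of b] \<open>\<And>a. f a < length P \<or> length P + length W \<le> f a\<close>[of a'] by linarith
    next
      case gg then show False using x ncC'[of a b a' b'] by (simp add: gm)
    qed
  qed
  moreover have "p < q \<and> q < length ?w" if "(p, q) \<in> CC" for p q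
    using CC_cases[OF that]
  proof (elim disjE exE conjE)
    fix a b assume "p = f a" "q = f b" "(a, b) \<in> C"
    then show ?thesis using bC[of a b] by (auto simp: f_def)
  next
    fix a b assume "p = g a" "q = g b" "(a, b) \<in> C'"
    then show ?thesis using bC'[of a b] by (auto simp: g_def)
  qed auto
  moreover have "(p, Suc p) \<in> CC" if "Suc p < length ?w" for p
    using that by (simp add: CC_def A_def)
  ultimately have CC: "chords_of ?w CC"
    unfolding chords_of_def by blast
  have inf: "(f p, f q) \<in> CC" if "(p, q) \<in> C" for p q
    unfolding CC_def using imageI[OF that, of "\<lambda>(p, q). (f p, f q)"] by simp
  have ing: "(g p, g q) \<in> CC" if "(p, q) \<in> C'" for p q
    unfolding CC_def using imageI[OF that, of "\<lambda>(p, q). (g p, g q)"] by simp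
  have X: "\<exists>p q. (p, q) \<in> CC \<and> e = {?w ! p, ?w ! q}" if "e \<in> X" for e
  proof -
    obtain p q where "(p, q) \<in> C" "e = {(P @ Q) ! p, (P @ Q) ! q}" using C(2)[OF \<open>e \<in> X\<close>] by blast
    then show ?thesis using nf[of p] nf[of q] bC[of p q] inf[of p q]
      by (intro exI[of _ "f p"] exI[of _ "f q"]) simp
  qed
  have X': "\<exists>p q. (p, q) \<in> CC \<and> e = {?w ! p, ?w ! q}" if "e \<in> X'" for e
  proof -
    obtain p q where "(p, q) \<in> C'" "e = {W ! p, W ! q}" using C'(2)[OF \<open>e \<in> X'\<close>] by blast
    then show ?thesis using ng[of p] ng[of q] bC'[of p q] ing[of p q]
      by (intro exI[of _ "g p"] exI[of _ "g q"]) simp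
  qed
  have Kf: "(f p, f q) \<in> (same_letter_chords ?w CC z)\<^sup>*"
    if "z \<in> K" "p < length (P @ Q)" "q < length (P @ Q)" "(P @ Q) ! p = z" "(P @ Q) ! q = z" for z p q
  proof (rule rtrancl_image[OF C(3)[OF that]])
    fix a b assume "(a, b) \<in> same_letter_chords (P @ Q) C z"
    then show "(f a, f b) \<in> same_letter_chords ?w CC z"
      using bC[of a b] bC[of b a] nf[of a] nf[of b] inf[of a b] inf[of b a] by (auto simp: same_letter_chords_def)
  qed
  have Kg: "(g p, g q) \<in> (same_letter_chords ?w CC z)\<^sup>*"
    if "z \<in> K'" "p < length W" "q < length W" "W ! p = z" "W ! q = z" for z p q
  proof (rule rtrancl_image[OF C'(3)[OF that]])
    fix a b assume "(a, b) \<in> same_letter_chords W C' z"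
    then show "(g a, g b) \<in> same_letter_chords ?w CC z"
      using bC'[of a b] bC'[of b a] ng[of a] ng[of b] ing[of a b] ing[of b a] by (auto simp: same_letter_chords_def)
  qed
  have pos: "(\<exists>a. a < length (P @ Q) \<and> p = f a \<and> (P @ Q) ! a = ?w ! p) \<or> (\<exists>a<length W. p = g a \<and> W ! a = ?w ! p)"
    if "p < length ?w" for p
  proof -
    consider "p < length P" | "length P \<le> p" "p < length P + length W" | "length P + length W \<le> p" by linarith
    then show ?thesis
    proof cases
      case 1 then show ?thesis by (intro disjI1 exI[of _ p]) (auto simp: f_def nth_append)
    next
      case 2 then show ?thesis by (intro disjI2 exI[of _ "p - length P"]) (auto simp: g_def nth_append)
    next
      case 3 then show ?thesis using that
        by (intro disjI1 exI[of _ "p - length W"]) (auto simp: f_def nth_append add.commute)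
    qed
  qed
  have "(p, q) \<in> (same_letter_chords ?w CC z)\<^sup>*"
    if z: "z \<in> K''" and p: "p < length ?w" "?w ! p = z" and q: "q < length ?w" "?w ! q = z" for z p q
    using 3[OF z]
  proof (elim disjE conjE)
    assume "z \<in> K" "z \<notin> set W"
    then show ?thesis using pos[OF p(1)] pos[OF q(1)] Kf p q by (metis nth_mem)
  next
    assume "z \<in> K'" "z \<notin> set (P @ Q)"
    then show ?thesis using pos[OF p(1)] pos[OF q(1)] Kg p q by (metis nth_mem)
  next
    assume a: "z \<in> K" "z \<in> K'" "Q = []" "P \<noteq> []" "W \<noteq> []" "last P = z" "hd W = z"
    let ?l = "length P - 1" and ?r = "(same_letter_chords ?w CC z)\<^sup>*"
    have l: "?l < length (P @ Q)" "(P @ Q) ! ?l = z" "f ?l = ?l" using a by (auto simp: last_conv_nth f_def)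
    have h: "0 < length W" "W ! 0 = z" "g 0 = length P" using a by (auto simp: hd_conv_nth g_def)
    have wl: "?w ! ?l = z" "?w ! length P = z" using a nf[OF l(1)] l ng[OF h(1)] h by auto
    have "(?l, length P) \<in> CC" using a by (auto simp: CC_def A_def)
    then have lh: "(f ?l, g 0) \<in> ?r" "(g 0, f ?l) \<in> ?r" using wl unfolding l h
      by (auto simp: same_letter_chords_def intro!: r_into_rtrancl)
    have toh: "(p, g 0) \<in> ?r \<and> (g 0, p) \<in> ?r" if p: "p < length ?w" "?w ! p = z" for p
      using pos[OF p(1)]
    proof (elim disjE exE conjE)
      fix b assume b: "b < length (P @ Q)" "p = f b" "(P @ Q) ! b = ?w ! p"
      then have bz: "(P @ Q) ! b = z" using p by simp
      show ?thesis unfolding b(2)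
        using rtrancl_trans[OF Kf[OF a(1) b(1) l(1) bz l(2)] lh(1)] rtrancl_trans[OF lh(2) Kf[OF a(1) l(1) b(1) l(2) bz]]
        by (rule conjI)
    next
      fix b assume b: "b < length W" "p = g b" "W ! b = ?w ! p"
      then have bz: "W ! b = z" using p by simp
      show ?thesis unfolding b(2)
        using Kg[OF a(2) b(1) h(1) bz h(2)] Kg[OF a(2) h(1) b(1) h(2) bz] by (rule conjI)
    qed
    show ?thesis using toh[OF p] toh[OF q] by (meson rtrancl_trans)
  qed
  note conn = this
  show ?thesis
    by (rule chord_wordI[OF CC]) (use X X' in blast, rule conn)
qed

lemma chord_word_append:
  assumes "chord_word P X {}" and "chord_word W X' {}"
  shows "chord_word (P @ W) (X \<union> X') {}"
  using chord_word_insert[of P "[]" X "{}" W X' "{}" "{}"] assms by simp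

lemma chord_word_mono:
  assumes "chord_word w X K" "X' \<subseteq> X" "K' \<subseteq> K"
  shows "chord_word w X' K'"
proof -
  from assms(1) obtain C where C: "chords_of w C" "\<forall>e\<in>X. \<exists>p q. (p, q) \<in> C \<and> e = {w ! p, w ! q}"
     "\<forall>z\<in>K. \<forall>p q. p < length w \<longrightarrow> q < length w \<longrightarrow> w ! p = z \<longrightarrow> w ! q = z \<longrightarrow>
          (p, q) \<in> (same_letter_chords w C z)\<^sup>*"
    by (elim chord_wordE) (rule that)
  show ?thesis
    by (rule chord_wordI[OF C(1)], rule bspec[OF C(2)], rule subsetD[OF assms(2)], assumption,
        rule C(3)[rule_format], rule subsetD[OF assms(3)])
qed

lemma chord_word_adjacent:
  assumes "chord_word (P @ a # b # Q) X K"
  shows "chord_word (P @ a # b # Q) (insert {a, b} X) K"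
proof -
  let ?w = "P @ a # b # Q"
  from assms obtain C where C: "chords_of ?w C"
      "\<forall>e\<in>X. \<exists>p q. (p, q) \<in> C \<and> e = {?w ! p, ?w ! q}"
      "\<forall>z\<in>K. \<forall>p q. p < length ?w \<longrightarrow> q < length ?w \<longrightarrow> ?w ! p = z \<longrightarrow> ?w ! q = z \<longrightarrow>
          (p, q) \<in> (same_letter_chords ?w C z)\<^sup>*"
    by (elim chord_wordE) (rule that)
  note C = C(1) bspec[OF C(2)] C(3)[rule_format]
  have "(length P, Suc (length P)) \<in> C" using C(1) by (auto simp: chords_of_def)
  moreover have "{a, b} = {?w ! length P, ?w ! Suc (length P)}" by (simp add: nth_append)
  ultimately have e: "\<exists>p q. (p, q) \<in> C \<and> {a, b} = {?w ! p, ?w ! q}" by blast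
  show ?thesis
    by (rule chord_wordI[OF C(1) _ C(3)]) (use e C(2) in blast)
qed

lemma chord_word_trivial: "chord_word [a] {} K"
proof -
  have "chords_of [a] {}" by (auto simp: chords_of_def noncrossing_def)
  then show ?thesis unfolding chord_word_def by (intro exI[of _ "{}"]) auto
qed

lemma chord_word_cycle:
  assumes "2 \<le> length vs"
  shows "chord_word vs (insert {last vs, hd vs} {{vs ! i, vs ! Suc i} | i. Suc i < length vs}) {}"
proof -
  \<comment> \<open>The closing edge becomes the chord from the first to the last position, which no
    other chord can cross.\<close>
  define C where "C = insert (0, length vs - 1) {(i, Suc i) | i. Suc i < length vs}"
  have "chords_of vs C"
    using assms by (auto simp: chords_of_def noncrossing_def C_def)
  moreover have "\<exists>p q. (p, q) \<in> C \<and> {last vs, hd vs} = {vs ! p, vs ! q}"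
  proof (intro exI conjI)
    show "(0, length vs - 1) \<in> C" by (simp add: C_def)
    have "vs \<noteq> []" using assms by auto
    then show "{last vs, hd vs} = {vs ! 0, vs ! (length vs - 1)}" by (auto simp: last_conv_nth hd_conv_nth)
  qed
  moreover have "\<exists>p q. (p, q) \<in> C \<and> e = {vs ! p, vs ! q}" if "e \<in> {{vs ! i, vs ! Suc i} | i. Suc i < length vs}" for e
    using that by (auto simp: C_def)
  ultimately show ?thesis unfolding chord_word_def by blast
qed

lemma chord_word_map:
  assumes "chord_word w X {}"
  shows "chord_word (map h w) ((`) h ` X) {}"
proof -
  from assms obtain C where C: "chords_of w C" "\<forall>e\<in>X. \<exists>p q. (p, q) \<in> C \<and> e = {w ! p, w ! q}"
    unfolding chord_word_def by blast
  have "\<exists>p q. (p, q) \<in> C \<and> h ` e = {map h w ! p, map h w ! q}" if e: "e \<in> X" for e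
  proof -
    obtain p q where pq: "(p, q) \<in> C" "e = {w ! p, w ! q}" using C(2) e by blast
    then have "p < q" "q < length w" using C(1) by (auto simp: chords_of_def)
    with pq show ?thesis by (intro exI[of _ p] exI[of _ q]) auto
  qed
  moreover have "chords_of (map h w) C" using C(1) by (auto simp: chords_of_def)
  ultimately show ?thesis unfolding chord_word_def by (intro exI[of _ C]) auto
qed

text \<open>The pieces with \<open>isr\<close> alone already form a chord word. The others are
  inserted one at a time from left to right, \<open>R\<close> being the part that is complete. Their
  letters are private, so an insertion keeps all earlier links and adds its own letters to
  \<open>K\<close>.\<close>

lemma chord_word_interleave:
  assumes "chord_word (R @ concat (map f (filter isr ps))) X K"
    and "\<And>p. p \<in> set ps \<Longrightarrow> \<not> isr p \<Longrightarrow> chord_word (f p) {} (set (f p))"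
    and "\<And>p q. p \<in> set ps \<Longrightarrow> \<not> isr p \<Longrightarrow> q \<in> set ps \<Longrightarrow> isr q \<Longrightarrow> set (f p) \<inter> set (f q) = {}"
    and "\<And>p. p \<in> set ps \<Longrightarrow> \<not> isr p \<Longrightarrow> set (f p) \<inter> (set R \<union> K) = {}"
    and "pairwise (\<lambda>p q. set (f p) \<inter> set (f q) = {}) {p \<in> set ps. \<not> isr p}" and "distinct ps"
    and "\<And>q. q \<in> set ps \<Longrightarrow> set (f q) \<inter> K = {}"
  shows "chord_word (R @ concat (map f ps)) X (K \<union> (\<Union>p\<in>{p \<in> set ps. \<not> isr p}. set (f p)))"
  using assms
proof (induction ps arbitrary: R K)
  case Nil then show ?case by simp
next
  case (Cons p ps)
  have pw: "pairwise (\<lambda>p q. set (f p) \<inter> set (f q) = {}) {p \<in> set ps. \<not> isr p}"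
    by (rule pairwise_subset[OF Cons.prems(5)]) auto
  show ?case
  proof (cases "isr p")
    case True
    have "chord_word ((R @ f p) @ concat (map f ps)) X (K \<union> (\<Union>p\<in>{p \<in> set ps. \<not> isr p}. set (f p)))"
    proof (rule Cons.IH[OF _ _ _ _ pw])
      show "chord_word ((R @ f p) @ concat (map f (filter isr ps))) X K" using Cons.prems(1) True by simp
      show "\<And>q. q \<in> set ps \<Longrightarrow> \<not> isr q \<Longrightarrow> set (f q) \<inter> (set (R @ f p) \<union> K) = {}"
        using Cons.prems(3)[of _ p] Cons.prems(4) True by fastforce
    qed (use Cons.prems in auto)
    then show ?thesis using True by (auto elim: chord_word_mono)
  next
    case False
    have full: "chord_word (f p) {} (set (f p))" using Cons.prems(2) False by simp
    have dis: "set (f p) \<inter> set (f q) = {}" if "q \<in> set ps" for q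
    proof (cases "isr q")
      case True then show ?thesis using Cons.prems(3)[of p q] that False by auto
    next
      case F: False
      have "p \<noteq> q" using Cons.prems(6) that by auto
      then show ?thesis using pairwiseD[OF Cons.prems(5), of p q] that False F by auto
    qed
    have "chord_word (R @ f p @ concat (map f (filter isr ps))) (X \<union> {}) (K \<union> set (f p))"
    proof (rule chord_word_insert[OF _ full])
      show "chord_word (R @ concat (map f (filter isr ps))) X K" using Cons.prems(1) False by simp
      show "z \<in> K \<and> z \<notin> set (f p) \<or> z \<in> set (f p) \<and> z \<notin> set (R @ concat (map f (filter isr ps))) \<or>
         z \<in> K \<and> z \<in> set (f p) \<and> concat (map f (filter isr ps)) = [] \<and> R \<noteq> [] \<and> f p \<noteq> [] \<and> last R = z \<and> hd (f p) = z"
        if "z \<in> K \<union> set (f p)" for z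
        using that dis Cons.prems(4)[of p] False by auto
    qed
    then have "chord_word ((R @ f p) @ concat (map f ps)) X ((K \<union> set (f p)) \<union> (\<Union>p\<in>{p \<in> set ps. \<not> isr p}. set (f p)))"
    proof (intro Cons.IH[OF _ _ _ _ pw])
      show "\<And>q. q \<in> set ps \<Longrightarrow> \<not> isr q \<Longrightarrow> set (f q) \<inter> (set (R @ f p) \<union> (K \<union> set (f p))) = {}"
        using dis Cons.prems(4) by fastforce
      show "\<And>q. q \<in> set ps \<Longrightarrow> set (f q) \<inter> (K \<union> set (f p)) = {}"
        using dis Cons.prems(7) by fastforce
    qed (use Cons.prems in auto)
    then show ?thesis using False by (auto elim!: chord_word_mono)
  qed
qed

section \<open>Tree words\<close>

text \<open>The contour walk of a plane tree with root \<open>a\<close>: \<open>child\<close> hangs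
  a subtree rooted at \<open>b\<close> between two walks around \<open>a\<close>, and
  \<open>join\<close> merges two trees at the root, leaving a doubled letter at the seam.
  Consecutive letters need not be adjacent in any graph; only the pattern of repetitions
  matters.\<close>

inductive tree_word :: "'b \<Rightarrow> 'b list \<Rightarrow> bool" where
  single: "tree_word a [a]"
| child: "tree_word a u \<Longrightarrow> tree_word b v \<Longrightarrow> tree_word a u' \<Longrightarrow> set u \<inter> set v = {} \<Longrightarrow>
    set u' \<inter> set v = {} \<Longrightarrow> set u \<inter> set u' \<subseteq> {a} \<Longrightarrow> tree_word a (u @ v @ u')"
| join: "tree_word a u \<Longrightarrow> tree_word a u' \<Longrightarrow> set u \<inter> set u' \<subseteq> {a} \<Longrightarrow> tree_word a (u @ u')"

lemma tree_word_ends: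
  assumes "tree_word a w"
  shows "w \<noteq> [] \<and> hd w = a \<and> last w = a"
  using assms by induction auto

lemma tree_word_root: "tree_word a w \<Longrightarrow> a \<in> set w"
  using tree_word_ends[of a w] by (metis hd_in_set)

lemma tree_word_rev: "tree_word a w \<Longrightarrow> tree_word a (rev w)"
proof (induction rule: tree_word.induct)
  case (child a u b v u')
  then show ?case using tree_word.child[of a "rev u'" b "rev v" "rev u"] by (auto simp: Int_commute)
next
  case (join a u u')
  then show ?case using tree_word.join[of a "rev u'" "rev u"] by (auto simp: Int_commute)
qed (simp add: tree_word.single)

lemma tree_word_map: "tree_word a w \<Longrightarrow> inj_on h (set w) \<Longrightarrow> tree_word (h a) (map h w)"
proof (induction rule: tree_word.induct)
  case (single a) then show ?case by (simp add: tree_word.single)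
next
  case (child a u b v u')
  have "h ` set u \<inter> h ` set v = h ` (set u \<inter> set v)" "h ` set u' \<inter> h ` set v = h ` (set u' \<inter> set v)"
    "h ` set u \<inter> h ` set u' = h ` (set u \<inter> set u')"
    by (rule inj_on_image_Int[OF child.prems, symmetric]; simp; blast)+
  moreover have "inj_on h (set u)" "inj_on h (set v)" "inj_on h (set u')"
    using child.prems by (simp_all add: inj_on_Un)
  ultimately show ?case
    unfolding map_append using child.hyps by (intro tree_word.child[where b = "h b"] child.IH) (auto simp: image_subset_iff)
next
  case (join a u u')
  have "h ` set u \<inter> h ` set u' = h ` (set u \<inter> set u')"
    by (rule inj_on_image_Int[OF join.prems, symmetric]) auto
  moreover have "inj_on h (set u)" "inj_on h (set u')"
    using join.prems by (simp_all add: inj_on_Un)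
  ultimately show ?case
    unfolding map_append using join.hyps by (intro tree_word.join join.IH) auto
qed

lemma length_remdups_adj_append_le: "length (remdups_adj (xs @ ys)) \<le> length (remdups_adj xs) + length (remdups_adj ys)"
proof (cases ys)
  case (Cons y ys')
  show ?thesis
  proof (cases xs rule: rev_cases)
    case (snoc xs' x)
    have "remdups_adj (xs @ ys) = remdups_adj xs @ tl (remdups_adj (x # ys))"
      unfolding snoc using remdups_adj_append[of xs' x ys] by simp
    moreover have "length (tl (remdups_adj (x # ys))) \<le> length (remdups_adj ys)"
      by (simp add: Cons)
    ultimately show ?thesis by simp
  qed simp
qed simp

lemma remdups_adj_append_same:
  assumes "xs \<noteq> []" "ys \<noteq> []" "last xs = hd ys"
  shows "remdups_adj (xs @ ys) = remdups_adj xs @ tl (remdups_adj ys)"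
proof -
  obtain xs' x where xs: "xs = xs' @ [x]" using assms(1) by (cases xs rule: rev_cases) auto
  obtain ys' where ys: "ys = x # ys'" using assms xs by (cases ys) auto
  show ?thesis using remdups_adj_append[of xs' x ys] by (simp add: xs ys)
qed

text \<open>A contour walk around \<open>k\<close> vertices has at most \<open>2 * k - 1\<close>
  entries once doubled letters are merged. In \<open>child\<close> the two walks around
  \<open>a\<close> share \<open>a\<close> alone, so the three bounds add up exactly; in
  \<open>join\<close> one of the two letters at the seam disappears.\<close>

lemma tree_word_length:
  assumes "tree_word a w"
  shows "length (remdups_adj w) + 1 \<le> 2 * card (set w)"
  using assms
proof induction
  case (child a u b v u')
  have i: "set u \<inter> set u' = {a}" using child.hyps by (auto simp: tree_word_root)
  have "set (u @ v @ u') = (set u \<union> set u') \<union> set v" by auto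
  moreover have "card \<dots> = card (set u \<union> set u') + card (set v)"
    using child.hyps by (intro card_Un_disjoint) auto
  moreover have "card (set u \<union> set u') + 1 = card (set u) + card (set u')"
    using card_Un_Int[of "set u" "set u'"] i by simp
  ultimately have "card (set (u @ v @ u')) + 1 = card (set u) + card (set u') + card (set v)" by presburger
  then show ?case using child.IH length_remdups_adj_append_le[of u "v @ u'"] length_remdups_adj_append_le[of v u']
    by presburger
next
  case (join a u u')
  have i: "set u \<inter> set u' = {a}" using join.hyps by (auto simp: tree_word_root)
  have "card (set (u @ u')) + 1 = card (set u) + card (set u')"
    using card_Un_Int[of "set u" "set u'"] i by simp
  moreover have "length (remdups_adj (u @ u')) = length (remdups_adj u) + length (remdups_adj u') - 1"
    using remdups_adj_append_same[of u u'] tree_word_ends[OF join.hyps(1)] tree_word_ends[OF join.hyps(2)] by simp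
  ultimately show ?case using join.IH by presburger
qed simp

text \<open>Two successive visits of a vertex enclose complete subtrees whose letters occur nowhere
  else, so the links of different letters are nested or disjoint.\<close>

lemma tree_word_full:
  assumes "tree_word a w"
  shows "chord_word w {} (set w)"
  using assms
proof induction
  case (single a) show ?case by (rule chord_word_trivial)
next
  case (join a u u')
  show ?case
    using chord_word_insert[of u "[]" "{}" "set u" u' "{}" "set u'" "set (u @ u')"] join
      tree_word_ends[OF join.hyps(1)] tree_word_ends[OF join.hyps(2)]
    by auto
next
  case (child a u b v u')
  have 1: "chord_word (u @ u') {} (set (u @ u'))"
    using chord_word_insert[of u "[]" "{}" "set u" u' "{}" "set u'" "set (u @ u')"] child
      tree_word_ends[OF child.hyps(1)] tree_word_ends[OF child.hyps(3)]
    by auto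
  have "chord_word (u @ v @ u') ({} \<union> {}) (set (u @ v @ u'))"
    by (rule chord_word_insert[OF 1 child.IH(2)]) (use child.hyps in auto)
  then show ?case by simp
qed

text \<open>The contour of a path hanging at its end \<open>y\<close>: down along one side, with the
  trees \<open>f\<close> found there, and back along the other side with the trees \<open>g\<close>.
  The induction peels off the last vertex of \<open>us\<close>, the child of \<open>y\<close>, whose
  whole contour sits between \<open>f y\<close> and \<open>g y\<close>.\<close>

lemma tree_word_path:
  assumes "distinct us" "y \<notin> set us"
    and "\<And>v. v \<in> insert y (set us) \<Longrightarrow> tree_word v (f v) \<and> tree_word v (g v)"
    and "\<And>v v'. v \<in> insert y (set us) \<Longrightarrow> v' \<in> insert y (set us) \<Longrightarrow> v \<noteq> v' \<Longrightarrow>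
      set (f v) \<inter> set (f v') = {} \<and> set (g v) \<inter> set (g v') = {}"
    and "\<And>v v'. v \<in> insert y (set us) \<Longrightarrow> v' \<in> insert y (set us) \<Longrightarrow> set (f v) \<inter> set (g v') \<subseteq> {v} \<inter> {v'}"
  shows "tree_word y (f y @ concat (map f (rev us)) @ concat (map g us) @ g y)"
  using assms
proof (induction us arbitrary: y rule: rev_induct)
  case Nil then show ?case by (auto intro!: tree_word.join)
next
  case (snoc u us)
  let ?v = "f u @ concat (map f (rev us)) @ concat (map g us) @ g u"
  have v: "tree_word u ?v" by (rule snoc.IH) (use snoc.prems in auto)
  have d: "set (f y) \<inter> set ?v = {}" "set (g y) \<inter> set ?v = {}"
  proof -
    have n: "v \<in> insert y (set (us @ [u]))" "v \<noteq> y" if "v \<in> insert u (set us)" for v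
      using that snoc.prems(2) by auto
    have "set (f y) \<inter> set (f v) = {}" "set (g y) \<inter> set (g v) = {}" "set (f y) \<inter> set (g v) = {}" "set (g y) \<inter> set (f v) = {}"
      if "v \<in> insert u (set us)" for v
      using snoc.prems(4)[OF _ n(1)[OF that], of y] snoc.prems(5)[OF _ n(1)[OF that], of y] snoc.prems(5)[OF n(1)[OF that], of y] n(2)[OF that]
      by auto
    then show "set (f y) \<inter> set ?v = {}" "set (g y) \<inter> set ?v = {}" by (fastforce simp: disjoint_iff)+
  qed
  have "tree_word y (f y @ ?v @ g y)"
    by (rule tree_word.child[OF _ v _ d]) (use snoc.prems(3)[of y] snoc.prems(5)[of y y] in auto)
  then show ?case by simp
qed

section \<open>Jordan curves\<close>

definition jordan :: "complex set \<Rightarrow> bool" where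
  "jordan J \<longleftrightarrow> (\<exists>c. simple_path c \<and> pathfinish c = pathstart c \<and> path_image c = J)"

text \<open>Inside and outside are kept on an equal footing because the outside of a cycle will be
  cut open in the same way as its inside.\<close>

definition sides :: "complex set \<Rightarrow> complex set set" where
  "sides J = {inside J, outside J}"

lemma jordan_side:
  assumes "jordan J" "D \<in> sides J"
  obtains D' where "D' \<in> sides J" "D \<inter> D' = {}" "D \<union> D' = - J" "open D" "connected D" "D \<noteq> {}"
    "open D'" "connected D'" "D' \<noteq> {}" "frontier D = J" "frontier D' = J"
proof -
  obtain c where c: "simple_path c" "pathfinish c = pathstart c" "path_image c = J"
    using assms(1) by (auto simp: jordan_def)
  note * = Jordan_inside_outside[OF c(1,2), unfolded c(3)]
  show ?thesis
  proof (cases "D = inside J")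
    case True
    then show ?thesis using * by (intro that[of "outside J"]) (auto simp: sides_def)
  next
    case False
    then have "D = outside J" using assms(2) by (auto simp: sides_def)
    then show ?thesis using * by (intro that[of "inside J"]) (simp_all add: sides_def Int_commute Un_commute)
  qed
qed

lemma side_props:
  assumes "jordan J" "D \<in> sides J"
  shows "open D" "connected D" "D \<noteq> {}" "frontier D = J"
  by (rule jordan_side[OF assms], assumption)+

lemma connected_subset_side:
  assumes "jordan J" "D \<in> sides J" "connected X" "X \<inter> J = {}" "X \<inter> D \<noteq> {}"
  shows "X \<subseteq> D"
proof -
  obtain D' where D': "D \<inter> D' = {}" "D \<union> D' = - J" "open D" "open D'"
    by (rule jordan_side[OF assms(1,2)])
  then have "X \<inter> D' = {}" using connectedD[OF assms(3) D'(3,4)] assms(4,5) by blast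
  then show ?thesis using D' assms(4) by blast
qed

lemma side_disjoint:
  assumes "jordan J" "D \<in> sides J"
  shows "D \<inter> J = {}"
  by (rule jordan_side[OF assms]) blast

lemma closure_side:
  assumes "jordan J" "D \<in> sides J"
  shows "closure D = D \<union> J"
  using side_props(4)[OF assms] closure_Un_frontier[of D] by simp

lemma jordan_two_arcs:
  assumes "arc g" "arc h" "pathstart g = a" "pathfinish g = b" "pathstart h = a" "pathfinish h = b"
    and "path_image g \<inter> path_image h = {a, b}"
  shows "jordan (path_image g \<union> path_image h)"
proof -
  have "simple_path (g +++ reversepath h)"
    using assms by (intro simple_path_join_loop) (auto simp: arc_reversepath)
  moreover have "path_image (g +++ reversepath h) = path_image g \<union> path_image h"
    using assms by (simp add: path_image_join)
  ultimately show ?thesis using assms unfolding jordan_def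
    by (intro exI[of _ "g +++ reversepath h"]) auto
qed

text \<open>The far side \<open>D'\<close> of \<open>A \<union> B\<close> is connected and misses
  \<open>A \<union> C\<close>, so it lies in one side \<open>A1\<close> of that curve, and
  \<open>B\<close>, being in its closure, follows up to the ends. The opposite side
  \<open>D1\<close> is therefore squeezed into \<open>D\<close>.\<close>

lemma theta_one_side:
  assumes JAB: "jordan (A \<union> B)" and JAC: "jordan (A \<union> C)" and D: "D \<in> sides (A \<union> B)"
    and C: "C - {a, b} \<subseteq> D" and BC: "B \<inter> C = {a, b}" and AB: "A \<inter> B = {a, b}" and AC: "A \<inter> C = {a, b}"
    and D': "D' \<in> sides (A \<union> B)" "D \<inter> D' = {}" "D \<union> D' = - (A \<union> B)"
  obtains D1 A1 where "D1 \<in> sides (A \<union> C)" "A1 \<in> sides (A \<union> C)" "D1 \<inter> A1 = {}" "D1 \<union> A1 = - (A \<union> C)"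
    "D' \<subseteq> A1" "B - {a, b} \<subseteq> A1" "D1 \<subseteq> D"
proof -
  have dD': "connected D'" "D' \<noteq> {}" "frontier D' = A \<union> B"
    by (rule side_props[OF JAB D'(1)])+
  have dis: "D' \<inter> (A \<union> C) = {}"
    using C D'(2) side_disjoint[OF JAB D'(1)] AC by blast
  obtain w where w: "w \<in> D'" using dD' by auto
  have "w \<in> inside (A \<union> C) \<union> outside (A \<union> C)"
    using w dis by (auto simp: inside_Un_outside)
  then obtain A1 where A1: "A1 \<in> sides (A \<union> C)" "w \<in> A1"
    unfolding sides_def by blast
  have DA1: "D' \<subseteq> A1" using connected_subset_side[OF JAC A1(1) dD'(1) dis] w A1 by blast
  obtain D1 where D1: "D1 \<in> sides (A \<union> C)" "A1 \<inter> D1 = {}" "A1 \<union> D1 = - (A \<union> C)"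
    by (rule jordan_side[OF JAC A1(1)])
  have BA1: "B - {a, b} \<subseteq> A1"
  proof
    fix z assume z: "z \<in> B - {a, b}"
    then have "z \<in> closure D'" using dD'(3) closure_Un_frontier by blast
    then have "z \<in> closure A1" using closure_mono[OF DA1] by blast
    then show "z \<in> A1" using closure_side[OF JAC A1(1)] z BC AB by blast
  qed
  have "D1 \<subseteq> D"
    using D1 DA1 BA1 D'(3) AB by blast
  then show ?thesis using that[OF D1(1) A1(1)] D1 DA1 BA1 by blast
qed

text \<open>If \<open>D1\<close> and \<open>D2\<close> met, \<open>D1\<close> would be contained in
  \<open>D2\<close>, and the interior of \<open>A\<close>, on the frontier of \<open>D1\<close>,
  would lie in \<open>D2\<close>; but it lies in the opposite side \<open>A2\<close>. That nothing
  else remains of \<open>D - C\<close> is where Janiszewski's theorem enters.\<close>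

lemma theta_split:
  assumes arcs: "arc gA" "arc gB" "arc gC" "path_image gA = A" "path_image gB = B" "path_image gC = C"
    and ends: "pathstart gA = a" "pathfinish gA = b" "pathstart gB = a" "pathfinish gB = b"
      "pathstart gC = a" "pathfinish gC = b"
    and AB: "A \<inter> B = {a, b}" and AC: "A \<inter> C = {a, b}" and BC: "B \<inter> C = {a, b}"
    and D: "D \<in> sides (A \<union> B)" and C: "C - {a, b} \<subseteq> D"
  obtains D1 D2 where "D1 \<in> sides (A \<union> C)" "D2 \<in> sides (B \<union> C)" "D1 \<inter> D2 = {}" "D - C = D1 \<union> D2"
proof -
  have JAB: "jordan (A \<union> B)" using jordan_two_arcs[of gA gB a b] assms by auto
  have JAC: "jordan (A \<union> C)" using jordan_two_arcs[of gA gC a b] assms by auto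
  have JBC: "jordan (B \<union> C)" using jordan_two_arcs[of gB gC a b] assms by auto
  obtain D' where D': "D' \<in> sides (A \<union> B)" "D \<inter> D' = {}" "D \<union> D' = - (A \<union> B)" "D' \<noteq> {}"
    by (rule jordan_side[OF JAB D])
  obtain D1 A1 where 1: "D1 \<in> sides (A \<union> C)" "A1 \<in> sides (A \<union> C)" "D1 \<inter> A1 = {}" "D1 \<union> A1 = - (A \<union> C)"
    "D' \<subseteq> A1" "B - {a, b} \<subseteq> A1" "D1 \<subseteq> D"
    by (rule theta_one_side[OF JAB JAC D C BC AB AC D'(1-3)])
  have BA: "B \<union> A = A \<union> B" "B \<inter> A = {a, b}" using AB by auto
  obtain D2 A2 where 2: "D2 \<in> sides (B \<union> C)" "A2 \<in> sides (B \<union> C)" "D2 \<inter> A2 = {}" "D2 \<union> A2 = - (B \<union> C)"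
    "D' \<subseteq> A2" "A - {a, b} \<subseteq> A2" "D2 \<subseteq> D"
    by (rule theta_one_side[of B A C D a b D', unfolded BA, OF JAB JBC D C AC _ BC D'(1-3)]) auto
  have ABD: "D \<inter> (A \<union> B) = {}" by (rule side_disjoint[OF JAB D])
  have con1: "connected D1" "frontier D1 = A \<union> C" by (rule side_props[OF JAC 1(1)])+
  have conA: "connected A1" "connected A2" by (rule side_props[OF JAC 1(2)], rule side_props[OF JBC 2(2)])
  have "D1 \<inter> D2 = {}"
  proof (rule ccontr)
    assume ne: "D1 \<inter> D2 \<noteq> {}"
    have "D1 \<inter> (B \<union> C) = {}" using 1 ABD by blast
    then have s: "D1 \<subseteq> D2" using connected_subset_side[OF JBC 2(1) con1(1)] ne by blast
    have "A - {a, b} \<noteq> {}"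
      using nonempty_simple_path_endless[OF arc_imp_simple_path[OF arcs(1)]] arcs ends by simp
    then obtain p where p: "p \<in> A" "p \<notin> {a, b}" by blast
    have "p \<in> closure D1" using con1(2) p closure_Un_frontier by blast
    then have "p \<in> D2" using closure_mono[OF s] closure_side[OF JBC 2(1)] p AB AC by blast
    then show False using 2 p by blast
  qed
  moreover have "D - C \<subseteq> D1 \<union> D2"
  proof
    fix z assume z: "z \<in> D - C"
    show "z \<in> D1 \<union> D2"
    proof (rule ccontr)
      assume n: "z \<notin> D1 \<union> D2"
      \<comment> \<open>A point in neither side can be joined to \<open>D'\<close> off
        \<open>A \<union> C\<close> and also off \<open>B \<union> C\<close>. These curves meet in
        the connected set \<open>C\<close>, so it can be joined to \<open>D'\<close> off all three
        arcs, which is impossible across the boundary of \<open>D\<close>.\<close>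
      have zA: "z \<in> A1" "z \<in> A2" using n z ABD 1(4) 2(4) by blast+
      obtain w where w: "w \<in> D'" using D'(4) by blast
      have c1: "connected_component (- (A \<union> C)) z w"
        unfolding connected_component_def by (rule exI[of _ A1]) (use conA zA w 1 in blast)
      have c2: "connected_component (- (B \<union> C)) z w"
        unfolding connected_component_def by (rule exI[of _ A2]) (use conA zA w 2 in blast)
      have "compact A" "compact B" "compact C" "connected C"
        using arcs compact_arc_image connected_arc_image by auto
      moreover have "(A \<union> C) \<inter> (B \<union> C) = C" using AB AC by blast
      ultimately have "connected_component (- ((A \<union> C) \<union> (B \<union> C))) z w"
        by (intro Janiszewski[OF _ _ _ c1 c2]) (simp_all add: compact_Un compact_imp_closed)
      then obtain T where T: "connected T" "T \<subseteq> - ((A \<union> C) \<union> (B \<union> C))" "z \<in> T" "w \<in> T"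
        unfolding connected_component_def by blast
      then have "T \<subseteq> D" using connected_subset_side[OF JAB D T(1)] z by blast
      then show False using T w D' by blast
    qed
  qed
  moreover have "D1 \<union> D2 \<subseteq> D - C" using 1 2 by blast
  ultimately show ?thesis using that[OF 1(1) 2(1)] by blast
qed

section \<open>Paths and cycles in vertex lists\<close>

fun path_edges :: "'v list \<Rightarrow> 'v set set" where
  "path_edges (x # y # zs) = insert {x, y} (path_edges (y # zs))"
| "path_edges zs = {}"

definition cycle_edges :: "'v list \<Rightarrow> 'v set set" where
  "cycle_edges vs = insert {last vs, hd vs} (path_edges vs)"

lemma path_edges_append:
  "xs \<noteq> [] \<Longrightarrow> ys \<noteq> [] \<Longrightarrow> path_edges (xs @ ys) = path_edges xs \<union> path_edges ys \<union> {{last xs, hd ys}}"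
  by (induction xs rule: path_edges.induct) (auto simp: neq_Nil_conv)

lemma path_edges_rev: "path_edges (rev xs) = path_edges xs"
proof (induction xs rule: path_edges.induct)
  case (1 x y zs)
  have "path_edges (rev (x # y # zs)) = path_edges (rev (y # zs) @ [x])" by simp
  also have "\<dots> = path_edges (rev (y # zs)) \<union> {{y, x}}" by (subst path_edges_append) auto
  finally show ?case using 1 by (auto simp: insert_commute)
qed auto

lemma path_edges_subset: "e \<in> path_edges xs \<Longrightarrow> e \<subseteq> set xs"
  by (induction xs rule: path_edges.induct) auto

lemma Union_path_edges: "2 \<le> length xs \<Longrightarrow> \<Union>(path_edges xs) = set xs"
proof (induction xs rule: path_edges.induct)
  case (1 x y zs) then show ?case by (cases zs) auto
qed auto

lemma path_edges_conv_nth: "path_edges xs = {{xs ! i, xs ! Suc i} | i. Suc i < length xs}"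
proof (induction xs rule: path_edges.induct)
  case (1 x y zs)
  have "{{(x # y # zs) ! i, (x # y # zs) ! Suc i} | i. Suc i < length (x # y # zs)} =
     insert {x, y} {{(y # zs) ! i, (y # zs) ! Suc i} | i. Suc i < length (y # zs)}" (is "?L = ?R")
  proof
    show "?L \<subseteq> ?R"
    proof
      fix e assume "e \<in> ?L"
      then obtain i where i: "Suc i < length (x # y # zs)" "e = {(x # y # zs) ! i, (x # y # zs) ! Suc i}" by blast
      then show "e \<in> ?R" by (cases i) auto
    qed
    show "?R \<subseteq> ?L"
    proof
      fix e assume "e \<in> ?R"
      then consider "e = {x, y}" | i where "Suc i < length (y # zs)" "e = {(y # zs) ! i, (y # zs) ! Suc i}" by blast
      then show "e \<in> ?L"
      proof cases
        case 1 then show ?thesis by (auto intro!: exI[of _ 0])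
      next
        case 2 then show ?thesis by (intro CollectI exI[of _ "Suc i"]) auto
      qed
    qed
  qed
  with 1 show ?case by simp
qed auto

lemma direct_path_edge:
  assumes "distinct (x # M @ [y])" "{x, y} \<in> path_edges (x # M @ [y])"
  shows "M = []"
proof (cases M)
  case (Cons m M')
  then have "{x, y} \<noteq> {x, m}" using assms(1) by (auto simp: doubleton_eq_iff)
  then have "{x, y} \<in> path_edges (m # M' @ [y])" using assms(2) Cons by simp
  then show ?thesis using path_edges_subset[of "{x, y}"] assms(1) Cons by fastforce
qed

lemma cycle_edges_split:
  "cycle_edges (A @ x # M @ y # B) = path_edges (x # M @ [y]) \<union> path_edges (y # B @ A @ [x])"
proof -
  have 1: "path_edges (x # M @ y # B) = path_edges (x # M @ [y]) \<union> path_edges (y # B)"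
  proof (cases "B = []")
    case False
    have "path_edges ((x # M @ [y]) @ B) = path_edges (x # M @ [y]) \<union> path_edges B \<union> {{y, hd B}}"
      using False by (subst path_edges_append) auto
    moreover have "path_edges ([y] @ B) = path_edges B \<union> {{y, hd B}}"
      using False by (subst path_edges_append) auto
    ultimately show ?thesis by auto
  qed simp
  show ?thesis
  proof (cases "A = []")
    case True
    have "path_edges ((y # B) @ [x]) = path_edges (y # B) \<union> {{last (y # B), x}}"
      by (subst path_edges_append) auto
    then show ?thesis using 1 True by (auto simp: cycle_edges_def)
  next
    case False
    have "path_edges ((y # B) @ (A @ [x])) = path_edges (y # B) \<union> path_edges (A @ [x]) \<union> {{last (y # B), hd A}}"
      using False by (subst path_edges_append) auto
    moreover have "path_edges (A @ [x]) = path_edges A \<union> {{last A, x}}"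
      using False by (subst path_edges_append) auto
    moreover have "path_edges (A @ (x # M @ y # B)) = path_edges A \<union> path_edges (x # M @ y # B) \<union> {{last A, x}}"
      using False by (subst path_edges_append) auto
    ultimately show ?thesis using 1 False by (auto simp: cycle_edges_def)
  qed
qed

lemma cycle_edges_rev: "vs \<noteq> [] \<Longrightarrow> cycle_edges (rev vs) = cycle_edges vs"
  by (simp add: cycle_edges_def path_edges_rev last_rev hd_rev insert_commute)

lemma Union_cycle_edges: "2 \<le> length vs \<Longrightarrow> \<Union>(cycle_edges vs) = set vs"
  using Union_path_edges[of vs] by (cases vs) (auto simp: cycle_edges_def)

lemma path_edges_successively: "successively (\<lambda>x y. {x, y} \<in> F) zs \<Longrightarrow> path_edges zs \<subseteq> F"
  by (induction zs rule: path_edges.induct) auto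

lemma rtrancl_distinct_path:
  assumes "(a, b) \<in> r\<^sup>*"
  shows "\<exists>zs. distinct zs \<and> zs \<noteq> [] \<and> hd zs = a \<and> last zs = b \<and> successively (\<lambda>x y. (x, y) \<in> r) zs"
  using assms
proof induction
  case base show ?case by (intro exI[of _ "[a]"]) auto
next
  case (step b c)
  then obtain zs where zs: "distinct zs" "zs \<noteq> []" "hd zs = a" "last zs = b" "successively (\<lambda>x y. (x, y) \<in> r) zs" by blast
  show ?case
  proof (cases "c \<in> set zs")
    case True
    then obtain p q where p: "zs = p @ c # q" by (meson split_list)
    then have "hd (p @ [c]) = a" using zs by (cases p) auto
    moreover have "successively (\<lambda>x y. (x, y) \<in> r) (p @ [c])" using zs(5) unfolding p
      by (auto simp: successively_append_iff)
    ultimately show ?thesis using zs(1) p by (intro exI[of _ "p @ [c]"]) auto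
  next
    case False
    then show ?thesis using zs step.hyps by (intro exI[of _ "zs @ [c]"]) (auto simp: successively_append_iff)
  qed
qed

section \<open>Plane drawings\<close>

text \<open>An edge is named by its pair of ends, which determines it in a simple graph, and
  \<open>\<delta>\<close> returns the arc. Thus a plain list of vertices describes a path or a cycle
  together with its curve.\<close>

locale drawing =
  fixes V :: "complex set" and G :: "complex set set" and \<delta> :: "complex set \<Rightarrow> complex set"
  assumes finite_G: "finite G"
    and edge_arc: "p \<in> G \<Longrightarrow> \<exists>g. arc g \<and> path_image g = \<delta> p \<and> p = {pathstart g, pathfinish g}"
    and edge_ends: "p \<in> G \<Longrightarrow> \<delta> p \<inter> V = p"
    and edge_Int: "p \<in> G \<Longrightarrow> q \<in> G \<Longrightarrow> p \<noteq> q \<Longrightarrow> \<delta> p \<inter> \<delta> q \<subseteq> V"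
begin

definition drawn :: "complex set set \<Rightarrow> complex set" where
  "drawn F = \<Union>(\<delta> ` F)"

lemma edge_Int_ends: "p \<in> G \<Longrightarrow> q \<in> G \<Longrightarrow> p \<noteq> q \<Longrightarrow> \<delta> p \<inter> \<delta> q \<subseteq> p \<inter> q"
  using edge_Int edge_ends by blast

lemma edge_pair: assumes "p \<in> G" "x \<in> p" obtains y where "p = {x, y}" "x \<noteq> y"
  using edge_arc[OF assms(1)] assms(2) arc_distinct_ends by (metis insertE insert_commute singletonD)

lemma edge_arc_from:
  assumes "{x, y} \<in> G"
  shows "\<exists>g. arc g \<and> path_image g = \<delta> {x, y} \<and> pathstart g = x \<and> pathfinish g = y"
proof -
  obtain g where g: "arc g" "path_image g = \<delta> {x, y}" "{x, y} = {pathstart g, pathfinish g}"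
    using edge_arc[OF assms] by blast
  show ?thesis
  proof (cases "pathstart g = x")
    case True then show ?thesis using g by (metis doubleton_eq_iff)
  next
    case False
    then have "pathstart g = y" "pathfinish g = x" using g(3) by (auto simp: doubleton_eq_iff)
    then show ?thesis using g by (intro exI[of _ "reversepath g"]) (auto simp: arc_reversepath)
  qed
qed

lemma edge_interior_connected:
  assumes "p \<in> G" "x \<in> p"
  shows "connected (insert x (\<delta> p - p))" "connected (\<delta> p - p)" "\<delta> p - p \<noteq> {}"
proof -
  obtain y where y: "p = {x, y}" "x \<noteq> y" using edge_pair[OF assms] .
  then obtain g where g: "arc g" "path_image g = \<delta> p" "pathstart g = x" "pathfinish g = y"
    using edge_arc_from assms by metis
  have "g ` {0..<1} = insert x (\<delta> p - p)"
  proof -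
    have inj: "inj_on g {0..1}" and g01: "g 0 = x" "g 1 = y"
      using g by (auto simp: arc_def pathstart_def pathfinish_def)
    have "{0..1::real} = insert 1 {0..<1}" by auto
    then have "\<delta> p = insert y (g ` {0..<1})" using g(2) g01 by (auto simp: path_image_def)
    moreover have "y \<notin> g ` {0..<1}"
    proof
      assume "y \<in> g ` {0..<1}"
      then obtain t where t: "g t = g 1" "0 \<le> t" "t < 1" using g01 by auto
      then show False using inj_onD[OF inj t(1)] by simp
    qed
    moreover have "x \<in> g ` {0..<1}" using g01 by (auto intro: image_eqI[of _ _ 0])
    ultimately show ?thesis using y by auto
  qed
  moreover have "continuous_on {0..<1} g" using g(1)
    by (auto simp: arc_def path_def intro: continuous_on_subset)
  moreover have "connected {0..<1::real}" by simp
  ultimately show "connected (insert x (\<delta> p - p))" using connected_continuous_image by metis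
  show "connected (\<delta> p - p)"
    using connected_simple_path_endless[OF arc_imp_simple_path[OF g(1)]] g y by simp
  show "\<delta> p - p \<noteq> {}"
    using nonempty_simple_path_endless[OF arc_imp_simple_path[OF g(1)]] g y by simp
qed

lemma path_arc:
  assumes "distinct zs" "2 \<le> length zs" "path_edges zs \<subseteq> G"
  shows "\<exists>g. arc g \<and> path_image g = drawn (path_edges zs) \<and> pathstart g = hd zs \<and> pathfinish g = last zs"
  using assms
proof (induction zs rule: path_edges.induct)
  case (1 x y zs)
  obtain g where g: "arc g" "path_image g = \<delta> {x, y}" "pathstart g = x" "pathfinish g = y"
    using edge_arc_from[of x y] "1.prems" by auto
  show ?case
  proof (cases "zs = []")
    case True then show ?thesis using g by (auto simp: drawn_def)
  next
    case False
    then obtain h where h: "arc h" "path_image h = drawn (path_edges (y # zs))" "pathstart h = y" "pathfinish h = last (y # zs)"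
      using 1 by (cases zs) auto
    have "\<delta> {x, y} \<inter> \<delta> q \<subseteq> {y}" if q: "q \<in> path_edges (y # zs)" for q
    proof -
      have "x \<notin> q" using path_edges_subset[OF q] "1.prems"(1) by auto
      then show ?thesis using edge_Int_ends[of "{x, y}" q] "1.prems"(3) q by auto
    qed
    then have "path_image g \<inter> path_image h \<subseteq> {pathstart h}"
      unfolding g h drawn_def by blast
    then have "arc (g +++ h)" using g h by (intro arc_join) auto
    moreover have "path_image (g +++ h) = drawn (path_edges (x # y # zs))"
      using g h by (simp add: path_image_join drawn_def)
    ultimately show ?thesis using g h False by (intro exI[of _ "g +++ h"]) auto
  qed
qed auto

lemma drawn_Un: "drawn (E \<union> F) = drawn E \<union> drawn F"
  by (auto simp: drawn_def)

lemma drawn_Int_V: "F \<subseteq> G \<Longrightarrow> drawn F \<inter> V = \<Union>F"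
  using edge_ends by (fastforce simp: drawn_def)

lemma drawn_disjoint_Int: "E \<subseteq> G \<Longrightarrow> F \<subseteq> G \<Longrightarrow> E \<inter> F = {} \<Longrightarrow> drawn E \<inter> drawn F = \<Union>E \<inter> \<Union>F"
proof
  assume a: "E \<subseteq> G" "F \<subseteq> G" "E \<inter> F = {}"
  show "drawn E \<inter> drawn F \<subseteq> \<Union>E \<inter> \<Union>F"
  proof
    fix z assume "z \<in> drawn E \<inter> drawn F"
    then obtain p q where pq: "p \<in> E" "z \<in> \<delta> p" "q \<in> F" "z \<in> \<delta> q" by (auto simp: drawn_def)
    then have "p \<noteq> q" using a by auto
    then show "z \<in> \<Union>E \<inter> \<Union>F" using edge_Int_ends[of p q] pq a by blast
  qed
  show "\<Union>E \<inter> \<Union>F \<subseteq> drawn E \<inter> drawn F"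
    using a drawn_Int_V[of E] drawn_Int_V[of F] by blast
qed

text \<open>A common edge could only be the direct edge between \<open>x\<close> and
  \<open>y\<close>. Then both paths would consist of this edge, which the last disjunction on
  \<open>M\<close> and \<open>N\<close> forbids.\<close>

lemma internally_disjoint_paths:
  assumes "distinct (x # M @ [y])" "distinct (x # N @ [y])" "set M \<inter> set N = {}" "M \<noteq> [] \<or> N \<noteq> []"
    and "path_edges (x # M @ [y]) \<subseteq> G" "path_edges (x # N @ [y]) \<subseteq> G"
  shows "drawn (path_edges (x # M @ [y])) \<inter> drawn (path_edges (x # N @ [y])) = {x, y}"
proof -
  have "path_edges (x # M @ [y]) \<inter> path_edges (x # N @ [y]) = {}"
  proof (rule ccontr)
    assume "path_edges (x # M @ [y]) \<inter> path_edges (x # N @ [y]) \<noteq> {}"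
    then obtain e where e: "e \<in> path_edges (x # M @ [y])" "e \<in> path_edges (x # N @ [y])" by blast
    have "e \<subseteq> {x, y}" using path_edges_subset[OF e(1)] path_edges_subset[OF e(2)] assms(1-3) by auto
    moreover have "e \<in> G" using e assms(5) by blast
    then have "\<exists>a b. a \<noteq> b \<and> e = {a, b}" using edge_arc[of e] arc_distinct_ends by metis
    ultimately have "e = {x, y}" by auto
    then show False using direct_path_edge e assms by metis
  qed
  then have "drawn (path_edges (x # M @ [y])) \<inter> drawn (path_edges (x # N @ [y])) = set (x # M @ [y]) \<inter> set (x # N @ [y])"
    using drawn_disjoint_Int[OF assms(5,6)] by (subst (asm) (1 2) Union_path_edges) auto
  also have "\<dots> = {x, y}" using assms by auto
  finally show ?thesis .
qed

definition cycle :: "complex list \<Rightarrow> bool" where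
  "cycle vs \<longleftrightarrow> distinct vs \<and> 3 \<le> length vs \<and> cycle_edges vs \<subseteq> G"

definition curve :: "complex list \<Rightarrow> complex set" where
  "curve vs = drawn (cycle_edges vs)"

lemma curve_Int_V: "cycle vs \<Longrightarrow> curve vs \<inter> V = set vs"
  using drawn_Int_V[of "cycle_edges vs"] Union_cycle_edges[of vs] by (auto simp: cycle_def curve_def)

lemma jordan_curve:
  assumes "cycle vs" shows "jordan (curve vs)"
proof -
  obtain x vs' where 1: "vs = x # vs'" using assms by (cases vs) (auto simp: cycle_def)
  obtain M y where vs: "vs = x # M @ [y]" using assms 1 by (cases vs' rule: rev_cases) (auto simp: cycle_def)
  have M: "M \<noteq> []" using assms vs by (auto simp: cycle_def)
  have ce: "cycle_edges vs = path_edges (x # M @ [y]) \<union> path_edges (y # [] @ [] @ [x])"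
    using cycle_edges_split[of "[]" x M y "[]"] vs by simp
  have d: "distinct (x # M @ [y])" using assms vs by (auto simp: cycle_def)
  have sub: "path_edges (x # M @ [y]) \<subseteq> G" "path_edges (x # [] @ [y]) \<subseteq> G"
    using assms ce by (auto simp: cycle_def insert_commute)
  obtain g where g: "arc g" "path_image g = drawn (path_edges (x # M @ [y]))" "pathstart g = x" "pathfinish g = y"
    using path_arc[OF d _ sub(1)] by auto
  obtain h where h: "arc h" "path_image h = drawn (path_edges (x # [] @ [y]))" "pathstart h = x" "pathfinish h = y"
    using path_arc[OF _ _ sub(2)] d by auto
  have "jordan (path_image g \<union> path_image h)"
    using jordan_two_arcs[OF g(1) h(1) g(3,4) h(3,4)] internally_disjoint_paths[OF d _ _ _ sub] M d g h by auto
  moreover have "curve vs = path_image g \<union> path_image h"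
    unfolding curve_def ce drawn_Un g h by (simp add: insert_commute)
  ultimately show ?thesis by simp
qed

text \<open>The arc with this one end added to its interior is connected and misses the curve, so
  the end is on the same side as the interior.\<close>

lemma edge_end_side:
  assumes "p \<in> G" "u \<in> p" "\<delta> p - p \<subseteq> D" "jordan J" "D \<in> sides J" "u \<notin> J"
  shows "u \<in> D"
proof -
  have "insert u (\<delta> p - p) \<subseteq> D"
    using assms edge_interior_connected[OF assms(1,2)] side_disjoint[OF assms(4,5)]
    by (intro connected_subset_side[OF assms(4,5)]) blast+
  then show ?thesis by blast
qed

text \<open>The theta graph in terms of lists: \<open>rev (B @ A)\<close> is the way from
  \<open>x\<close> to \<open>y\<close> around the back of the cycle. Both new cycles are listed in
  the direction of the old one, which is what allows their words to be spliced later.\<close>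

lemma theta_cycle_split:
  assumes cyc: "cycle (A @ x # M @ y # B)" and D: "D \<in> sides (curve (A @ x # M @ y # B))"
    and us: "distinct us" "set us \<inter> set (A @ x # M @ y # B) = {}"
    and pF: "path_edges (x # us @ [y]) \<subseteq> G" "\<And>e. e \<in> path_edges (x # us @ [y]) \<Longrightarrow> \<delta> e - e \<subseteq> D"
  shows "cycle (x # M @ y # rev us)" "cycle (A @ x # us @ y # B)"
    "cycle_edges (x # M @ y # rev us) \<union> cycle_edges (A @ x # us @ y # B) =
       cycle_edges (A @ x # M @ y # B) \<union> path_edges (x # us @ [y])"
    "\<exists>D1\<in>sides (curve (x # M @ y # rev us)). \<exists>D2\<in>sides (curve (A @ x # us @ y # B)).
       D1 \<inter> D2 = {} \<and> D - drawn (path_edges (x # us @ [y])) = D1 \<union> D2"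
proof -
  let ?vs = "A @ x # M @ y # B" and ?N = "rev (B @ A)"
  have J: "jordan (curve ?vs)" by (rule jordan_curve[OF cyc])
  have Neq: "path_edges (y # B @ A @ [x]) = path_edges (x # ?N @ [y])"
    using path_edges_rev[of "y # B @ A @ [x]"] by simp
  have Ueq: "path_edges (y # rev us @ [x]) = path_edges (x # us @ [y])"
    using path_edges_rev[of "y # rev us @ [x]"] by simp
  have ce: "cycle_edges ?vs = path_edges (x # M @ [y]) \<union> path_edges (x # ?N @ [y])"
    using cycle_edges_split[of A x M y B] Neq by simp
  have ce1: "cycle_edges (x # M @ y # rev us) = path_edges (x # M @ [y]) \<union> path_edges (x # us @ [y])"
    using cycle_edges_split[of "[]" x M y "rev us"] Ueq by simp
  have ce2: "cycle_edges (A @ x # us @ y # B) = path_edges (x # ?N @ [y]) \<union> path_edges (x # us @ [y])"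
    using cycle_edges_split[of A x us y B] Neq by auto
  show "cycle_edges (x # M @ y # rev us) \<union> cycle_edges (A @ x # us @ y # B) =
       cycle_edges ?vs \<union> path_edges (x # us @ [y])"
    using ce ce1 ce2 by auto
  have d: "distinct ?vs" "3 \<le> length ?vs" "cycle_edges ?vs \<subseteq> G" using cyc by (auto simp: cycle_def)
  have dM: "distinct (x # M @ [y])" and dN: "distinct (x # ?N @ [y])" and dU: "distinct (x # us @ [y])"
    and MN: "set M \<inter> set ?N = {}" "set M \<inter> set us = {}" "set ?N \<inter> set us = {}"
    using d(1) us by auto
  have gM: "path_edges (x # M @ [y]) \<subseteq> G" and gN: "path_edges (x # ?N @ [y]) \<subseteq> G" using d(3) ce by auto
  \<comment> \<open>A direct edge whose interior lies in \<open>D\<close> is not on the cycle, so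
    neither new cycle degenerates to two vertices.\<close>
  have nocyc: "{x, y} \<notin> cycle_edges ?vs" if "us = []"
  proof
    assume "{x, y} \<in> cycle_edges ?vs"
    then have "\<delta> {x, y} \<subseteq> curve ?vs" by (auto simp: curve_def drawn_def)
    moreover have "\<delta> {x, y} - {x, y} \<subseteq> D" "{x, y} \<in> G" using pF that by auto
    ultimately show False using edge_interior_connected(3)[of "{x, y}" x] side_disjoint[OF J D] by blast
  qed
  have MU: "M \<noteq> [] \<or> us \<noteq> []" using nocyc unfolding ce by (cases M; cases us) simp_all
  have NU: "?N \<noteq> [] \<or> us \<noteq> []" using nocyc unfolding ce by (cases ?N; cases us) simp_all
  have MN': "M \<noteq> [] \<or> ?N \<noteq> []" using d(2) by auto
  show c1: "cycle (x # M @ y # rev us)"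
    using dM dU MN(2) MU gM pF(1) ce1 by (cases M; cases us) (auto simp: cycle_def)
  have "3 \<le> length (A @ x # us @ y # B)" using NU by (cases A; cases B; cases us) auto
  then show c2: "cycle (A @ x # us @ y # B)"
    using d(1) us gN pF(1) ce2 by (auto simp: cycle_def)
  obtain gA where gA: "arc gA" "path_image gA = drawn (path_edges (x # M @ [y]))" "pathstart gA = x" "pathfinish gA = y"
    using path_arc[OF dM _ gM] by auto
  obtain gB where gB: "arc gB" "path_image gB = drawn (path_edges (x # ?N @ [y]))" "pathstart gB = x" "pathfinish gB = y"
    using path_arc[OF dN _ gN] by auto
  obtain gC where gC: "arc gC" "path_image gC = drawn (path_edges (x # us @ [y]))" "pathstart gC = x" "pathfinish gC = y"
    using path_arc[OF dU _ pF(1)] by auto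
  have usD: "u \<in> D" if u: "u \<in> set us" for u
  proof -
    have "u \<in> \<Union>(path_edges (x # us @ [y]))" using u by (subst Union_path_edges) auto
    then obtain e where e: "e \<in> path_edges (x # us @ [y])" "u \<in> e" by blast
    then have "e \<in> G" using pF by auto
    then have "u \<in> V" using edge_ends e by blast
    then have "u \<notin> curve ?vs" using curve_Int_V[OF cyc] u us by blast
    then show ?thesis using edge_end_side[OF \<open>e \<in> G\<close> e(2) pF(2)[OF e(1)] J D] by blast
  qed
  have CD: "drawn (path_edges (x # us @ [y])) - {x, y} \<subseteq> D"
  proof
    fix z assume z: "z \<in> drawn (path_edges (x # us @ [y])) - {x, y}"
    then obtain e where e: "e \<in> path_edges (x # us @ [y])" "z \<in> \<delta> e" by (auto simp: drawn_def)
    show "z \<in> D"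
    proof (cases "z \<in> e")
      case True
      then have "z \<in> set us" using path_edges_subset[OF e(1)] z by auto
      then show ?thesis by (rule usD)
    next
      case False then show ?thesis using pF(2)[OF e(1)] e by blast
    qed
  qed
  have cv: "curve ?vs = drawn (path_edges (x # M @ [y])) \<union> drawn (path_edges (x # ?N @ [y]))"
    "curve (x # M @ y # rev us) = drawn (path_edges (x # M @ [y])) \<union> drawn (path_edges (x # us @ [y]))"
    "curve (A @ x # us @ y # B) = drawn (path_edges (x # ?N @ [y])) \<union> drawn (path_edges (x # us @ [y]))"
    unfolding curve_def ce ce1 ce2 drawn_Un by auto
  obtain D1 D2 where "D1 \<in> sides (curve (x # M @ y # rev us))" "D2 \<in> sides (curve (A @ x # us @ y # B))"
     "D1 \<inter> D2 = {}" "D - drawn (path_edges (x # us @ [y])) = D1 \<union> D2"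
    unfolding cv
    by (rule theta_split[OF gA(1) gB(1) gC(1) gA(2) gB(2) gC(2) gA(3,4) gB(3,4) gC(3,4)
       internally_disjoint_paths[OF dM dN MN(1) MN' gM gN] internally_disjoint_paths[OF dM dU MN(2) MU gM pF(1)]
       internally_disjoint_paths[OF dN dU MN(3) NU gN pF(1)] D[unfolded cv] CD])
  then show "\<exists>D1\<in>sides (curve (x # M @ y # rev us)). \<exists>D2\<in>sides (curve (A @ x # us @ y # B)).
       D1 \<inter> D2 = {} \<and> D - drawn (path_edges (x # us @ [y])) = D1 \<union> D2" by blast
qed

end

section \<open>Words of plane drawings\<close>

text \<open>\<open>wd v\<close> is the walk around the tree that hangs at \<open>v\<close>. Only the
  host \<open>h\<close> may receive a tree although no edge of \<open>F\<close> touches it: it takes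
  the parts of \<open>F\<close> that miss the cycle. All other vertices off \<open>\<Union>F\<close>
  keep no letter but their own, which later protects the corners.\<close>

definition word_family :: "'v \<Rightarrow> 'v list \<Rightarrow> 'v set set \<Rightarrow> ('v \<Rightarrow> 'v list) \<Rightarrow> bool" where
  "word_family h vs F wd \<longleftrightarrow>
     (\<forall>v\<in>set vs. tree_word v (wd v) \<and> set (wd v) \<inter> set vs = {v} \<and> (set (wd v) = {v} \<or> v \<in> \<Union>F \<or> v = h)) \<and>
     (\<forall>v\<in>set vs. \<forall>v'\<in>set vs. v \<noteq> v' \<longrightarrow> set (wd v) \<inter> set (wd v') = {}) \<and>
     (\<Union>v\<in>set vs. set (wd v)) = \<Union>F \<union> set vs \<and>
     chord_word (concat (map wd vs)) (F \<union> cycle_edges vs) {}"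

context drawing
begin

text \<open>The root \<open>b\<close> is arbitrary, even a point off \<open>\<Union>F\<close>, so
  that a loose part can be hung anywhere.\<close>

definition tree_words :: "complex set set \<Rightarrow> bool" where
  "tree_words F \<longleftrightarrow> (\<forall>b. \<exists>w. tree_word b w \<and> set w = insert b (\<Union>F) \<and> chord_word w F {})"

definition disk_words :: "complex list \<Rightarrow> complex set set \<Rightarrow> bool" where
  "disk_words vs F \<longleftrightarrow> (\<forall>h\<in>set vs. \<exists>wd. word_family h vs F wd)"

definition in_side :: "complex set \<Rightarrow> complex set set \<Rightarrow> bool" where
  "in_side D F \<longleftrightarrow> F \<subseteq> G \<and> (\<forall>e\<in>F. \<delta> e - e \<subseteq> D)"

lemma in_side_mono: "in_side D F \<Longrightarrow> F' \<subseteq> F \<Longrightarrow> in_side D F'"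
  by (auto simp: in_side_def)

lemma in_side_verts:
  assumes "cycle vs" "D \<in> sides (curve vs)" "in_side D F"
  shows "\<Union>F - set vs \<subseteq> D"
proof
  fix u assume u: "u \<in> \<Union>F - set vs"
  then obtain e where e: "e \<in> F" "u \<in> e" by blast
  then have "e \<in> G" "u \<in> V" using assms(3) edge_ends by (auto simp: in_side_def)
  moreover have "u \<notin> curve vs" using u curve_Int_V[OF assms(1)] \<open>u \<in> V\<close> by blast
  ultimately show "u \<in> D"
    using edge_end_side[OF _ e(2) _ jordan_curve[OF assms(1)] assms(2)] assms(3) e by (auto simp: in_side_def)
qed

text \<open>Serves to compare words obtained on disjoint sides of a curve: apart from their roots
  they can have no letter in common.\<close>

lemma word_family_private:
  assumes "cycle vs" "D \<in> sides (curve vs)" "in_side D F" "word_family h vs F wd" "v \<in> set vs"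
  shows "set (wd v) - {v} \<subseteq> D" "v \<in> set (wd v)"
proof -
  have 1: "set (wd v) \<inter> set vs = {v}" "(\<Union>v\<in>set vs. set (wd v)) = \<Union>F \<union> set vs"
    using assms(4,5) by (auto simp: word_family_def)
  have "set (wd v) \<subseteq> \<Union>F \<union> set vs" using 1(2) assms(5) by blast
  then have "set (wd v) - {v} \<subseteq> \<Union>F - set vs" using 1(1) by blast
  also have "\<dots> \<subseteq> D" by (rule in_side_verts[OF assms(1-3)])
  finally show "set (wd v) - {v} \<subseteq> D" .
  show "v \<in> set (wd v)" using 1 by blast
qed

lemma disk_words_empty:
  assumes "cycle vs" shows "disk_words vs {}"
  unfolding disk_words_def
proof
  fix h assume "h \<in> set vs"
  have "concat (map (\<lambda>v. [v]) vs) = vs" by (induction vs) auto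
  moreover have "chord_word vs (cycle_edges vs) {}"
    using chord_word_cycle[of vs] assms by (simp add: cycle_def cycle_edges_def path_edges_conv_nth)
  ultimately have "word_family h vs {} (\<lambda>v. [v])"
    unfolding word_family_def by (auto simp: tree_word.single)
  then show "\<exists>wd. word_family h vs {} wd" by blast
qed

text \<open>Since \<open>K\<close> meets the cycle and the rest of \<open>F\<close> at most in
  \<open>v0\<close>, a walk around \<open>K\<close> rooted at \<open>v0\<close> can be appended to
  the walk already there, and the chords of \<open>K\<close> stay within that gap.\<close>

lemma disk_words_hang:
  assumes cyc: "cycle vs" and F: "F = K \<union> F'" and v0: "v0 \<in> set vs" "v0 \<in> \<Union>F \<or> v0 = h" and h: "h \<in> set vs"
    and dis: "\<Union>K \<inter> (\<Union>F' \<union> set vs) \<subseteq> {v0}" and K: "tree_words K" and F': "disk_words vs F'"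
  shows "\<exists>wd. word_family h vs F wd"
proof -
  obtain w where w: "tree_word v0 w" "set w = insert v0 (\<Union>K)" "chord_word w K {}"
    using K unfolding tree_words_def by blast
  obtain wd where wd: "word_family h vs F' wd" using F' h by (auto simp: disk_words_def)
  then have tw: "\<And>v. v \<in> set vs \<Longrightarrow> tree_word v (wd v)" and own: "\<And>v. v \<in> set vs \<Longrightarrow> set (wd v) \<inter> set vs = {v}"
    and triv: "\<And>v. v \<in> set vs \<Longrightarrow> set (wd v) = {v} \<or> v \<in> \<Union>F' \<or> v = h"
    and pair: "\<And>v v'. v \<in> set vs \<Longrightarrow> v' \<in> set vs \<Longrightarrow> v \<noteq> v' \<Longrightarrow> set (wd v) \<inter> set (wd v') = {}"
    and un: "(\<Union>v\<in>set vs. set (wd v)) = \<Union>F' \<union> set vs"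
    and cw: "chord_word (concat (map wd vs)) (F' \<union> cycle_edges vs) {}"
    by (auto simp: word_family_def)
  let ?wd = "wd(v0 := wd v0 @ w)"
  have sub: "set (wd v) \<subseteq> \<Union>F' \<union> set vs" if "v \<in> set vs" for v using un that by blast
  have wdis: "set w \<inter> set (wd v) \<subseteq> {v0}" if "v \<in> set vs" for v
    using sub[OF that] w(2) dis by blast
  have v0v: "v0 \<notin> set (wd v)" if "v \<in> set vs" "v \<noteq> v0" for v using own[OF that(1)] v0(1) that(2) by auto
  obtain A B where AB: "vs = A @ v0 # B" using v0 by (meson split_list)
  have nAB: "v0 \<notin> set A" "v0 \<notin> set B" using cyc AB by (auto simp: cycle_def)
  have mA: "map ?wd A = map wd A" "map ?wd B = map wd B" using nAB by (auto simp: map_eq_conv)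
  have "word_family h vs F ?wd"
    unfolding word_family_def
  proof (intro conjI ballI impI)
    fix v assume v: "v \<in> set vs"
    show "tree_word v (?wd v)"
    proof (cases "v = v0")
      case True
      then show ?thesis using tree_word.join[OF tw[OF v0(1)] w(1)] wdis[OF v0(1)] by (simp add: Int_commute)
    qed (simp add: tw v)
    show "set (?wd v) \<inter> set vs = {v}"
      using own[OF v] w(2) dis by (cases "v = v0") auto
    show "set (?wd v) = {v} \<or> v \<in> \<Union>F \<or> v = h"
      using triv[OF v] v0(2) F by (cases "v = v0") auto
    fix v' assume v': "v' \<in> set vs" "v \<noteq> v'"
    show "set (?wd v) \<inter> set (?wd v') = {}"
      using pair[OF v v'] wdis[OF v] wdis[OF v'(1)] v0v[OF v] v0v[OF v'(1)] v'(2)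
      by (cases "v = v0"; cases "v' = v0"; simp; blast)
  next
    have "(\<Union>v\<in>set vs. set (?wd v)) = (\<Union>v\<in>set vs. set (wd v)) \<union> set w"
      using v0(1) by (auto split: if_splits)
    then show "(\<Union>v\<in>set vs. set (?wd v)) = \<Union>F \<union> set vs" using un w(2) F v0(1) by auto
    have "chord_word ((concat (map wd A) @ wd v0) @ w @ concat (map wd B)) ((F' \<union> cycle_edges vs) \<union> K) {}"
      by (rule chord_word_insert[OF _ w(3)]) (use cw AB in auto)
    moreover have "concat (map ?wd vs) = (concat (map wd A) @ wd v0) @ w @ concat (map wd B)"
      unfolding AB map_append list.map concat_append concat.simps mA by simp
    moreover have "F \<union> cycle_edges vs = (F' \<union> cycle_edges vs) \<union> K" using F by auto
    ultimately show "chord_word (concat (map ?wd vs)) (F \<union> cycle_edges vs) {}" by metis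
  qed
  then show ?thesis by blast
qed

text \<open>The word of the first cycle is inserted into the word of the second one right after
  \<open>x\<close>. The vertices of the path then occur twice, once from either side, and these
  occurrences form the contour of a path hanging at \<open>y\<close>: the disc is cut along
  \<open>us\<close> from \<open>y\<close>, up to but not including \<open>x\<close>, where two trees
  are merely joined.\<close>

lemma disk_words_split:
  assumes cyc: "cycle vs" and vs: "vs = A @ x # M @ y # B" and D: "D \<in> sides (curve vs)"
    and us: "distinct us" "set us \<inter> set vs = {}"
    and pF: "path_edges (x # us @ [y]) \<subseteq> F" and F: "in_side D F" and h: "h \<in> set vs"
    and IH: "\<And>F' vs' D'. cycle vs' \<Longrightarrow> D' \<in> sides (curve vs') \<Longrightarrow> in_side D' F' \<Longrightarrow> card F' < card F \<Longrightarrow> disk_words vs' F'"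
  shows "\<exists>wd. word_family h vs F wd"
proof -
  let ?pe = "path_edges (x # us @ [y])" and ?C1 = "x # M @ y # rev us" and ?C2 = "A @ x # us @ y # B"
  have FG: "F \<subseteq> G" "\<And>e. e \<in> F \<Longrightarrow> \<delta> e - e \<subseteq> D" using F by (auto simp: in_side_def)
  have finF: "finite F" using FG finite_G finite_subset by blast
  note th = theta_cycle_split[of A x M y B D us, folded vs, OF cyc D us order_trans[OF pF FG(1)]]
  have pD: "\<delta> e - e \<subseteq> D" if "e \<in> ?pe" for e using pF FG(2) that by blast
  have c1: "cycle ?C1" and c2: "cycle ?C2" and ceq: "cycle_edges ?C1 \<union> cycle_edges ?C2 = cycle_edges vs \<union> ?pe"
    using th pD by auto
  obtain D1 D2 where D1: "D1 \<in> sides (curve ?C1)" and D2: "D2 \<in> sides (curve ?C2)" and D12: "D1 \<inter> D2 = {}"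
    and DD: "D - drawn ?pe = D1 \<union> D2"
    using th(4) pD by auto
  define F1 where "F1 = {e \<in> F - ?pe. \<delta> e - e \<subseteq> D1}"
  define F2 where "F2 = {e \<in> F - ?pe. \<delta> e - e \<subseteq> D2}"
  have J: "jordan (curve vs)" and J1: "jordan (curve ?C1)" and J2: "jordan (curve ?C2)" using cyc c1 c2 by (auto intro: jordan_curve)
  have sub: "e \<in> F1 \<union> F2" if e: "e \<in> F" "e \<notin> ?pe" for e
  proof -
    have eG: "e \<in> G" using e FG by auto
    then obtain a where a: "a \<in> e" using edge_arc by blast
    have int: "(\<delta> e - e) \<inter> drawn ?pe = {}"
    proof (rule ccontr)
      assume "(\<delta> e - e) \<inter> drawn ?pe \<noteq> {}"
      then obtain z q where z: "z \<in> \<delta> e" "z \<notin> e" "q \<in> ?pe" "z \<in> \<delta> q" by (auto simp: drawn_def)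
      then have "q \<in> G" "q \<noteq> e" using pF FG e by auto
      then show False using edge_Int_ends[OF eG, of q] z by blast
    qed
    have sD: "\<delta> e - e \<subseteq> D1 \<union> D2" using FG(2)[OF e(1)] int DD by blast
    have op: "open D1" "open D2" by (rule side_props(1)[OF J1 D1], rule side_props(1)[OF J2 D2])
    have "D1 \<inter> (\<delta> e - e) = {} \<or> D2 \<inter> (\<delta> e - e) = {}"
      using connectedD[OF edge_interior_connected(2)[OF eG a] op] D12 sD by blast
    then show ?thesis using sD e by (auto simp: F1_def F2_def)
  qed
  have Feq: "F = ?pe \<union> F1 \<union> F2" using sub pF by (auto simp: F1_def F2_def)
  have pne: "?pe \<noteq> {}" by (cases us) auto
  have "F1 \<subset> F" "F2 \<subset> F" using pne pF by (auto simp: F1_def F2_def)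
  then have card: "card F1 < card F" "card F2 < card F" using finF psubset_card_mono by blast+
  have i1: "in_side D1 F1" and i2: "in_side D2 F2" using FG by (auto simp: in_side_def F1_def F2_def)
  have xy: "x \<in> \<Union>F" "y \<in> \<Union>F"
  proof -
    have "{x, y} \<subseteq> \<Union>(path_edges (x # us @ [y]))" by (subst Union_path_edges) auto
    then show "x \<in> \<Union>F" "y \<in> \<Union>F" using Union_mono[OF pF] by blast+
  qed
  \<comment> \<open>Both halves use \<open>x\<close> as the host of loose parts. An edge of the path
    ends in \<open>x\<close>, so a tree at \<open>x\<close> is permitted whatever \<open>h\<close>
    is.\<close>
  obtain wd1 where w1: "word_family x ?C1 F1 wd1"
    using IH[OF c1 D1 i1 card(1)] by (auto simp: disk_words_def)
  obtain wd2 where w2: "word_family x ?C2 F2 wd2"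
    using IH[OF c2 D2 i2 card(2)] by (auto simp: disk_words_def)
  have tw1: "\<And>v. v \<in> set ?C1 \<Longrightarrow> tree_word v (wd1 v)"
    and triv1: "\<And>v. v \<in> set ?C1 \<Longrightarrow> set (wd1 v) = {v} \<or> v \<in> \<Union>F1 \<or> v = x"
    and pair1: "\<And>v v'. v \<in> set ?C1 \<Longrightarrow> v' \<in> set ?C1 \<Longrightarrow> v \<noteq> v' \<Longrightarrow> set (wd1 v) \<inter> set (wd1 v') = {}"
    and un1: "(\<Union>v\<in>set ?C1. set (wd1 v)) = \<Union>F1 \<union> set ?C1"
    and cw1: "chord_word (concat (map wd1 ?C1)) (F1 \<union> cycle_edges ?C1) {}"
    using w1 unfolding word_family_def by blast+
  have tw2: "\<And>v. v \<in> set ?C2 \<Longrightarrow> tree_word v (wd2 v)"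
    and triv2: "\<And>v. v \<in> set ?C2 \<Longrightarrow> set (wd2 v) = {v} \<or> v \<in> \<Union>F2 \<or> v = x"
    and pair2: "\<And>v v'. v \<in> set ?C2 \<Longrightarrow> v' \<in> set ?C2 \<Longrightarrow> v \<noteq> v' \<Longrightarrow> set (wd2 v) \<inter> set (wd2 v') = {}"
    and un2: "(\<Union>v\<in>set ?C2. set (wd2 v)) = \<Union>F2 \<union> set ?C2"
    and cw2: "chord_word (concat (map wd2 ?C2)) (F2 \<union> cycle_edges ?C2) {}"
    using w2 unfolding word_family_def by blast+
  note pr1 = word_family_private[OF c1 D1 i1 w1]
  note pr2 = word_family_private[OF c2 D2 i2 w2]
  have vsD: "set vs \<inter> D = {}"
    using side_disjoint[OF J D] curve_Int_V[OF cyc] by blast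
  have usC: "set us \<subseteq> drawn ?pe"
    using Union_path_edges[of "x # us @ [y]"] drawn_Int_V[OF order_trans[OF pF FG(1)]] by auto
  have vD: "(set vs \<union> set us) \<inter> (D1 \<union> D2) = {}" using vsD usC DD by blast
  have C1sub: "set ?C1 \<subseteq> set vs \<union> set us" and C2sub: "set ?C2 \<subseteq> set vs \<union> set us" unfolding vs by auto
  \<comment> \<open>Letters other than roots lie in the disjoint sides \<open>D1\<close> and
    \<open>D2\<close>, so words of different halves share at most a common root.\<close>
  have cross: "set (wd1 v) \<inter> set (wd2 v') \<subseteq> {v} \<inter> {v'}" if "v \<in> set ?C1" "v' \<in> set ?C2" for v v'
    using pr1[OF that(1)] pr2[OF that(2)] D12 vD C1sub C2sub that by blast
  have dv: "distinct (A @ x # M @ y # B)" using cyc vs by (simp add: cycle_def)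
  define wd where "wd v = (if v = x then wd2 x @ wd1 x
      else if v = y then wd1 y @ concat (map wd1 (rev us)) @ concat (map wd2 us) @ wd2 y
      else if v \<in> set M then wd1 v else wd2 v)" for v
  have wdx: "wd x = wd2 x @ wd1 x" by (simp add: wd_def)
  have wdy: "wd y = wd1 y @ concat (map wd1 (rev us)) @ concat (map wd2 us) @ wd2 y" using dv by (auto simp: wd_def)
  have wdM: "wd v = wd1 v" if "v \<in> set M" for v using that dv by (auto simp: wd_def)
  have wdAB: "wd v = wd2 v" if "v \<in> set A \<union> set B" for v using that dv by (auto simp: wd_def)
  have mA: "map wd A = map wd2 A" "map wd B = map wd2 B" "map wd M = map wd1 M"
    using wdAB wdM by auto
  have ccat: "concat (map wd vs) = (concat (map wd2 (A @ [x]))) @ concat (map wd1 ?C1) @ concat (map wd2 (us @ y # B))"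
    unfolding vs map_append list.map mA wdx wdy by simp
  have ywd: "tree_word y (wd y)"
    unfolding wdy
  proof (rule tree_word_path)
    show "distinct us" "y \<notin> set us" using us vs by auto
    have s: "insert y (set us) \<subseteq> set ?C1" "insert y (set us) \<subseteq> set ?C2" by auto
    show "tree_word v (wd1 v) \<and> tree_word v (wd2 v)" if "v \<in> insert y (set us)" for v
      using tw1 tw2 s that by blast
    show "set (wd1 v) \<inter> set (wd1 v') = {} \<and> set (wd2 v) \<inter> set (wd2 v') = {}"
      if "v \<in> insert y (set us)" "v' \<in> insert y (set us)" "v \<noteq> v'" for v v'
      using pair1[of v v'] pair2[of v v'] s that by blast
    show "set (wd1 v) \<inter> set (wd2 v') \<subseteq> {v} \<inter> {v'}"
      if "v \<in> insert y (set us)" "v' \<in> insert y (set us)" for v v'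
      using cross[of v v'] s that by blast
  qed
  have xwd: "tree_word x (wd x)"
    unfolding wdx using tw1[of x] tw2[of x] cross[of x x] by (intro tree_word.join) auto
  \<comment> \<open>The vertices whose words on the two new cycles make up \<open>wd v\<close>: the
    whole path belongs to \<open>y\<close>, every other vertex only has itself.\<close>
  define own where "own v = (if v = y then insert y (set us) else {v})" for v
  have wdsub: "set (wd v) = (\<Union>u\<in>own v \<inter> set ?C1. set (wd1 u)) \<union> (\<Union>u\<in>own v \<inter> set ?C2. set (wd2 u))" if v: "v \<in> set vs" for v
  proof -
    have "x \<noteq> y" using dv by auto
    consider "v = x" | "v = y" | "v \<in> set M" "v \<noteq> x" "v \<noteq> y" | "v \<in> set A \<union> set B" "v \<noteq> x" "v \<noteq> y"
      using v vs by auto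
    then show ?thesis
    proof cases
      case 1 then show ?thesis using wdx \<open>x \<noteq> y\<close> by (auto simp: own_def)
    next
      case 2
      have "own v \<inter> set ?C1 = insert y (set us)" "own v \<inter> set ?C2 = insert y (set us)" using 2 by (auto simp: own_def)
      then show ?thesis using wdy 2 by auto
    next
      case 3
      then have "own v \<inter> set ?C1 = {v}" "own v \<inter> set ?C2 = {}"
        using dv us vs by (auto simp: own_def)
      then show ?thesis using wdM[OF 3(1)] by simp
    next
      case 4
      then have "own v \<inter> set ?C2 = {v}" "own v \<inter> set ?C1 = {}"
        using dv us vs by (auto simp: own_def)
      then show ?thesis using wdAB[OF 4(1)] by simp
    qed
  qed
  have owndis: "own v \<inter> own v' = {}" if "v \<in> set vs" "v' \<in> set vs" "v \<noteq> v'" for v v'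
    using that us by (auto simp: own_def)
  have ownD: "own v \<inter> set vs = {v}" if "v \<in> set vs" for v using that us by (auto simp: own_def)
  have "word_family h vs F wd"
    unfolding word_family_def
  proof (intro conjI ballI impI)
    fix v assume v: "v \<in> set vs"
    show "tree_word v (wd v)"
    proof -
      consider "v = x" | "v = y" | "v \<in> set M" | "v \<in> set A \<union> set B" using v vs by auto
      then show ?thesis using xwd ywd wdM wdAB tw1[of v] tw2[of v] by cases auto
    qed
    have "set (wd v) \<subseteq> own v \<union> D1 \<union> D2"
      unfolding wdsub[OF v] using pr1(1) pr2(1) by blast
    moreover have "v \<in> set (wd v)" using tree_word_root[OF \<open>tree_word v (wd v)\<close>] .
    ultimately show "set (wd v) \<inter> set vs = {v}" using ownD[OF v] vD v by blast
    show "set (wd v) = {v} \<or> v \<in> \<Union>F \<or> v = h"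
    proof -
      consider "v = x" | "v = y" | "v \<in> set M" | "v \<in> set A \<union> set B" using v vs by auto
      then show ?thesis
      proof cases
        case 3
        then show ?thesis using triv1[of v] wdM[OF 3] xy Feq by auto
      next
        case 4
        then show ?thesis using triv2[of v] wdAB[OF 4] xy Feq by auto
      qed (use xy in auto)
    qed
    fix v' assume v': "v' \<in> set vs" "v \<noteq> v'"
    have o: "own v \<inter> own v' = {}" by (rule owndis[OF v v'])
    show "set (wd v) \<inter> set (wd v') = {}"
    proof (rule ccontr)
      assume "set (wd v) \<inter> set (wd v') \<noteq> {}"
      then obtain z where z: "z \<in> set (wd v)" "z \<in> set (wd v')" by blast
      from z(1) consider (1) u where "u \<in> own v" "u \<in> set ?C1" "z \<in> set (wd1 u)" | (2) u where "u \<in> own v" "u \<in> set ?C2" "z \<in> set (wd2 u)"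
        unfolding wdsub[OF v] by blast
      then show False
      proof cases
        case 1
        from z(2) consider (a) u' where "u' \<in> own v'" "u' \<in> set ?C1" "z \<in> set (wd1 u')" | (b) u' where "u' \<in> own v'" "u' \<in> set ?C2" "z \<in> set (wd2 u')"
          unfolding wdsub[OF v'(1)] by blast
        then show False
        proof cases
          case a then show False using 1 pair1[of u u'] o by blast
        next
          case b then show False using 1 cross[of u u'] o by blast
        qed
      next
        case 2
        from z(2) consider (a) u' where "u' \<in> own v'" "u' \<in> set ?C1" "z \<in> set (wd1 u')" | (b) u' where "u' \<in> own v'" "u' \<in> set ?C2" "z \<in> set (wd2 u')"
          unfolding wdsub[OF v'(1)] by blast
        then show False
        proof cases
          case a then show False using 2 cross[of u' u] o by blast
        next
          case b then show False using 2 pair2[of u u'] o by blast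
        qed
      qed
    qed
  next
    have "(\<Union>v\<in>set vs. set (wd v)) = set (concat (map wd vs))" by simp
    also have "\<dots> = (\<Union>v\<in>set ?C1. set (wd1 v)) \<union> (\<Union>v\<in>set ?C2. set (wd2 v))" unfolding ccat by auto
    also have "\<dots> = (\<Union>F1 \<union> \<Union>F2) \<union> (set ?C1 \<union> set ?C2)" unfolding un1 un2 by blast
    also have "set ?C1 \<union> set ?C2 = set vs \<union> set (x # us @ [y])" unfolding vs by auto
    also have "set (x # us @ [y]) = \<Union>?pe" by (subst Union_path_edges) auto
    finally show "(\<Union>v\<in>set vs. set (wd v)) = \<Union>F \<union> set vs" unfolding Feq by auto
    have "chord_word (concat (map wd2 (A @ [x])) @ concat (map wd1 ?C1) @ concat (map wd2 (us @ y # B)))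
       ((F2 \<union> cycle_edges ?C2) \<union> (F1 \<union> cycle_edges ?C1)) {}"
      by (rule chord_word_insert[OF _ cw1]) (use cw2 in auto)
    then show "chord_word (concat (map wd vs)) (F \<union> cycle_edges vs) {}"
      unfolding ccat[symmetric] by (rule chord_word_mono) (use ceq Feq in auto)
  qed
  then show ?thesis by blast
qed

text \<open>Either the part of \<open>F\<close> reachable from a cycle vertex returns to the cycle
  nowhere else and hangs there, or it contains a path to a second cycle vertex, along which the disc
  splits. If no edge touches the cycle, all of \<open>F\<close> hangs at \<open>h\<close>.\<close>

lemma disk_words_step:
  assumes cyc: "cycle vs" and D: "D \<in> sides (curve vs)" and F: "in_side D F"
    and IH: "\<And>F' vs' D'. cycle vs' \<Longrightarrow> D' \<in> sides (curve vs') \<Longrightarrow> in_side D' F' \<Longrightarrow> card F' < card F \<Longrightarrow> disk_words vs' F'"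
    and T: "\<And>K. K \<subseteq> F \<Longrightarrow> tree_words K"
  shows "disk_words vs F"
proof (cases "F = {}")
  case True then show ?thesis using disk_words_empty[OF cyc] by simp
next
  case False
  have FG: "F \<subseteq> G" using F by (auto simp: in_side_def)
  have finF: "finite F" using FG finite_G finite_subset by blast
  show ?thesis
    unfolding disk_words_def
  proof
    fix h assume h: "h \<in> set vs"
    show "\<exists>wd. word_family h vs F wd"
    proof (cases "\<Union>F \<inter> set vs = {}")
      case True
      have "disk_words vs {}" by (rule disk_words_empty[OF cyc])
      then show ?thesis using disk_words_hang[OF cyc, of F F "{}" h h] h True T[of F] by auto
    next
      case False
      then obtain v0 where v0: "v0 \<in> \<Union>F" "v0 \<in> set vs" by blast
      \<comment> \<open>The search never continues from a cycle vertex other than \<open>v0\<close>,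
        so a path that it finds has no inner vertex on the cycle.\<close>
      define r where "r = {(a, b). {a, b} \<in> F \<and> (a = v0 \<or> a \<notin> set vs)}"
      define R where "R = r\<^sup>* `` {v0}"
      have v0R: "v0 \<in> R" by (simp add: R_def)
      show ?thesis
      proof (cases "R \<inter> set vs \<subseteq> {v0}")
        case True
        define K where "K = {e \<in> F. e \<inter> R \<noteq> {}}"
        have KR: "\<Union>K \<subseteq> R"
        proof
          fix z assume "z \<in> \<Union>K"
          then obtain e a where e: "e \<in> F" "z \<in> e" "a \<in> e" "a \<in> R" by (auto simp: K_def)
          obtain b where b: "e = {a, b}" using edge_pair[of e a] FG e by blast
          show "z \<in> R"
          proof (cases "z = a")
            case False
            then have "(a, z) \<in> r" using e b True by (auto simp: r_def)
            then show ?thesis using e(4) by (auto simp: R_def intro: rtrancl_into_rtrancl)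
          qed (use e in simp)
        qed
        have "\<Union>K \<inter> (\<Union>(F - K) \<union> set vs) \<subseteq> {v0}" using KR True by (auto simp: K_def)
        moreover have "K \<noteq> {}" using v0 v0R by (auto simp: K_def)
        then have "card (F - K) < card F" using finF by (intro psubset_card_mono) (auto simp: K_def)
        then have "disk_words vs (F - K)" using IH[OF cyc D in_side_mono[OF F]] by auto
        moreover have "F = K \<union> (F - K)" by (auto simp: K_def)
        ultimately show ?thesis using disk_words_hang[OF cyc, of F K "F - K" v0 h] v0 h T[of K] by (auto simp: K_def)
      next
        case False
        then obtain v1 where v1: "v1 \<in> set vs" "v1 \<noteq> v0" "(v0, v1) \<in> r\<^sup>*" by (auto simp: R_def)
        obtain zs where zs: "distinct zs" "zs \<noteq> []" "hd zs = v0" "last zs = v1" "successively (\<lambda>x y. (x, y) \<in> r) zs"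
          using rtrancl_distinct_path[OF v1(3)] by blast
        obtain us where us: "zs = v0 # us @ [v1]"
        proof -
          obtain zs' where z: "zs = v0 # zs'" using zs by (cases zs) auto
          then obtain us where "zs' = us @ [v1]" using zs(4) v1(2) by (cases zs' rule: rev_cases) auto
          then show thesis using that z by blast
        qed
        have usvs: "set us \<inter> set vs = {}"
        proof (rule ccontr)
          assume "set us \<inter> set vs \<noteq> {}"
          then obtain u where u: "u \<in> set us" "u \<in> set vs" by blast
          then obtain p q where "us = p @ u # q" by (meson split_list)
          then have z: "zs = (v0 # p) @ u # (q @ [v1])" using us by simp
          have "successively (\<lambda>x y. (x, y) \<in> r) (u # (q @ [v1]))" using zs(5) unfolding z successively_append_iff by simp
          then have "(u, hd (q @ [v1])) \<in> r" by (cases q) auto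
          then show False using u zs(1) us by (auto simp: r_def)
        qed
        have "successively (\<lambda>x y. {x, y} \<in> F) zs"
          using zs(5) by (rule successively_mono) (auto simp: r_def)
        then have pe: "path_edges (v0 # us @ [v1]) \<subseteq> F" using path_edges_successively us by blast
        then have pe': "path_edges (v1 # rev us @ [v0]) \<subseteq> F" using path_edges_rev[of "v0 # us @ [v1]"] by simp
        have dus: "distinct us" using zs us by auto
        \<comment> \<open>The list gives the cycle a starting point, so \<open>v1\<close> may come
          before or after \<open>v0\<close>; in the former case the path is reversed.\<close>
        obtain A C where AC: "vs = A @ v0 # C" using v0 by (meson split_list)
        show ?thesis
        proof (cases "v1 \<in> set C")
          case True
          then obtain M B where "C = M @ v1 # B" by (meson split_list)
          then have eq: "vs = A @ v0 # M @ v1 # B" using AC by simp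
          show ?thesis by (rule disk_words_split[OF cyc eq D dus usvs pe F h IH])
        next
          case False
          then have "v1 \<in> set A" using v1 AC by auto
          then obtain A' M where "A = A' @ v1 # M" by (meson split_list)
          then have eq: "vs = A' @ v1 # M @ v0 # C" using AC by simp
          have "distinct (rev us)" "set (rev us) \<inter> set vs = {}" using dus usvs by auto
          then show ?thesis by (rule disk_words_split[OF cyc eq D _ _ pe' F h IH])
        qed
      qed
    qed
  qed
qed

text \<open>The case distinction is on an edge \<open>{b, u}\<close> at the root. If
  \<open>u\<close> can return to \<open>b\<close> without it, there is a cycle, which is opened at
  \<open>b\<close> to a path while its closing edge survives as a chord. Otherwise the edge is a
  bridge and what lies behind it is a subtree.\<close>

lemma tree_words_step:
  assumes FG: "F \<subseteq> G"
    and IHt: "\<And>F'. F' \<subseteq> G \<Longrightarrow> card F' < card F \<Longrightarrow> tree_words F'"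
    and IH: "\<And>F' vs' D'. cycle vs' \<Longrightarrow> D' \<in> sides (curve vs') \<Longrightarrow> in_side D' F' \<Longrightarrow> card F' < card F \<Longrightarrow> disk_words vs' F'"
  shows "tree_words F"
proof -
  have finF: "finite F" using FG finite_G finite_subset by blast
  have main: "\<exists>w. tree_word b w \<and> set w = insert b (\<Union>F) \<and> chord_word w F {}" if bF: "b \<in> \<Union>F" for b
  proof -
    obtain e where e: "e \<in> F" "b \<in> e" using bF by blast
    obtain u where u: "e = {b, u}" "b \<noteq> u" using edge_pair[of e b] FG e by blast
    define F' where "F' = F - {{b, u}}"
    define r where "r = {(x, y). {x, y} \<in> F'}"
    have cF': "card F' < card F" using finF e u unfolding F'_def by (intro psubset_card_mono) auto
    show ?thesis
    proof (cases "(u, b) \<in> r\<^sup>*")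
      case True
      obtain zs where zs: "distinct zs" "zs \<noteq> []" "hd zs = u" "last zs = b" "successively (\<lambda>x y. (x, y) \<in> r) zs"
        using rtrancl_distinct_path[OF True] by blast
      obtain Z where Z: "zs = u # Z @ [b]"
      proof -
        obtain zs' where z: "zs = u # zs'" using zs by (cases zs) auto
        then obtain us where "zs' = us @ [b]" using zs(4) u(2) by (cases zs' rule: rev_cases) auto
        then show thesis using that z by blast
      qed
      have "successively (\<lambda>x y. {x, y} \<in> F') zs"
        using zs(5) by (rule successively_mono) (auto simp: r_def)
      then have pe: "path_edges (u # Z @ [b]) \<subseteq> F'" using path_edges_successively Z by blast
      have Zne: "Z \<noteq> []" using pe by (auto simp: F'_def insert_commute)
      let ?cs = "u # Z" let ?C = "b # ?cs"
      have ceC: "cycle_edges ?C = insert {b, u} (path_edges (u # Z @ [b]))"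
        using path_edges_append[of "u # Z" "[b]"] by (auto simp: cycle_edges_def)
      then have ceF: "cycle_edges ?C \<subseteq> F" using pe e u by (auto simp: F'_def)
      have dC: "distinct ?C" using zs Z by auto
      have c1: "cycle ?C" unfolding cycle_def
        using dC order_trans[OF ceF FG] Zne by (simp add: Suc_le_eq)
      \<comment> \<open>For the outside the cycle is listed backwards with \<open>b\<close> at the
        end. The two boundary words in a row then read as the two sides of one path that hangs at
        \<open>b\<close>.\<close>
      have revC: "cycle_edges (rev ?cs @ [b]) = cycle_edges ?C" using cycle_edges_rev[of ?C] by simp
      have c2: "cycle (rev ?cs @ [b])" using c1 revC by (auto simp: cycle_def)
      have cveq: "curve (rev ?cs @ [b]) = curve ?C" using revC by (simp add: curve_def)
      define F1 where "F1 = {e \<in> F - cycle_edges ?C. \<delta> e - e \<subseteq> inside (curve ?C)}"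
      define F2 where "F2 = {e \<in> F - cycle_edges ?C. \<delta> e - e \<subseteq> outside (curve ?C)}"
      have J: "jordan (curve ?C)" by (rule jordan_curve[OF c1])
      have D1: "inside (curve ?C) \<in> sides (curve ?C)" and D2: "outside (curve ?C) \<in> sides (curve (rev ?cs @ [b]))"
        using cveq by (auto simp: sides_def)
      have i1: "in_side (inside (curve ?C)) F1" and i2: "in_side (outside (curve ?C)) F2"
        using FG by (auto simp: in_side_def F1_def F2_def)
      have sub: "a \<in> F1 \<union> F2" if a: "a \<in> F" "a \<notin> cycle_edges ?C" for a
      proof -
        have aG: "a \<in> G" using a FG by auto
        then obtain x where x: "x \<in> a" using edge_arc by blast
        have int: "(\<delta> a - a) \<inter> curve ?C = {}"
        proof (rule ccontr)
          assume "(\<delta> a - a) \<inter> curve ?C \<noteq> {}"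
          then obtain z q where z: "z \<in> \<delta> a" "z \<notin> a" "q \<in> cycle_edges ?C" "z \<in> \<delta> q" by (auto simp: curve_def drawn_def)
          then have "q \<in> G" "q \<noteq> a" using a ceF FG by auto
          then show False using edge_Int_ends[OF aG, of q] z by blast
        qed
        then have sD: "\<delta> a - a \<subseteq> inside (curve ?C) \<union> outside (curve ?C)"
          by (auto simp: inside_Un_outside)
        have op: "open (inside (curve ?C))" "open (outside (curve ?C))"
          by (rule side_props(1)[OF J], simp add: sides_def)+
        have "inside (curve ?C) \<inter> (\<delta> a - a) = {} \<or> outside (curve ?C) \<inter> (\<delta> a - a) = {}"
          using connectedD[OF edge_interior_connected(2)[OF aG x] op] sD inside_Int_outside by blast
        then have "\<delta> a - a \<subseteq> inside (curve ?C) \<or> \<delta> a - a \<subseteq> outside (curve ?C)" using sD by blast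
        then show ?thesis using a by (auto simp: F1_def F2_def)
      qed
      have Feq: "F = cycle_edges ?C \<union> F1 \<union> F2" using sub ceF by (auto simp: F1_def F2_def)
      have "cycle_edges ?C \<noteq> {}" by (simp add: cycle_edges_def)
      then have "F1 \<subset> F" "F2 \<subset> F" using ceF by (auto simp: F1_def F2_def)
      then have card: "card F1 < card F" "card F2 < card F" using finF psubset_card_mono by blast+
      obtain wd1 where w1: "word_family b ?C F1 wd1"
        using IH[OF c1 D1 i1 card(1)] by (auto simp: disk_words_def)
      obtain wd2 where w2: "word_family b (rev ?cs @ [b]) F2 wd2"
        using IH[OF c2 D2 i2 card(2)] by (auto simp: disk_words_def)
      have tw1: "\<And>v. v \<in> set ?C \<Longrightarrow> tree_word v (wd1 v)"
        and pair1: "\<And>v v'. v \<in> set ?C \<Longrightarrow> v' \<in> set ?C \<Longrightarrow> v \<noteq> v' \<Longrightarrow> set (wd1 v) \<inter> set (wd1 v') = {}"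
        and un1: "(\<Union>v\<in>set ?C. set (wd1 v)) = \<Union>F1 \<union> set ?C"
        and cw1: "chord_word (concat (map wd1 ?C)) (F1 \<union> cycle_edges ?C) {}"
        using w1 unfolding word_family_def by blast+
      have sC: "set (rev ?cs @ [b]) = set ?C" by auto
      have tw2: "\<And>v. v \<in> set ?C \<Longrightarrow> tree_word v (wd2 v)"
        and pair2: "\<And>v v'. v \<in> set ?C \<Longrightarrow> v' \<in> set ?C \<Longrightarrow> v \<noteq> v' \<Longrightarrow> set (wd2 v) \<inter> set (wd2 v') = {}"
        and un2: "(\<Union>v\<in>set ?C. set (wd2 v)) = \<Union>F2 \<union> set ?C"
        and cw2: "chord_word (concat (map wd2 (rev ?cs @ [b]))) (F2 \<union> cycle_edges ?C) {}"
        using w2 unfolding word_family_def sC revC by blast+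
      note pr1 = word_family_private[OF c1 D1 i1 w1]
      note pr2 = word_family_private[OF c2 D2 i2 w2, unfolded sC]
      have CD: "set ?C \<inter> inside (curve ?C) = {}" "set ?C \<inter> outside (curve ?C) = {}"
        using curve_Int_V[OF c1] inside_no_overlap[of "curve ?C"] outside_no_overlap[of "curve ?C"] by blast+
      have cross: "set (wd1 v) \<inter> set (wd2 v') \<subseteq> {v} \<inter> {v'}" if "v \<in> set ?C" "v' \<in> set ?C" for v v'
        using pr1[OF that(1)] pr2[OF that(2)] CD inside_Int_outside[of "curve ?C"] that by blast
      let ?w = "wd1 b @ concat (map wd1 (rev (rev ?cs))) @ concat (map wd2 (rev ?cs)) @ wd2 b"
      have "tree_word b ?w"
      proof (rule tree_word_path)
        show "distinct (rev ?cs)" "b \<notin> set (rev ?cs)" using dC by auto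
        have s: "insert b (set (rev ?cs)) = set ?C" by auto
        show "tree_word v (wd1 v) \<and> tree_word v (wd2 v)" if "v \<in> insert b (set (rev ?cs))" for v
          using tw1 tw2 s that by blast
        show "set (wd1 v) \<inter> set (wd1 v') = {} \<and> set (wd2 v) \<inter> set (wd2 v') = {}"
          if "v \<in> insert b (set (rev ?cs))" "v' \<in> insert b (set (rev ?cs))" "v \<noteq> v'" for v v'
          using pair1[of v v'] pair2[of v v'] s that by blast
        show "set (wd1 v) \<inter> set (wd2 v') \<subseteq> {v} \<inter> {v'}"
          if "v \<in> insert b (set (rev ?cs))" "v' \<in> insert b (set (rev ?cs))" for v v'
          using cross[of v v'] s that by blast
      qed
      moreover have weq: "?w = concat (map wd1 ?C) @ concat (map wd2 (rev ?cs @ [b]))" by simp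
      have "set ?w = (\<Union>v\<in>set ?C. set (wd1 v)) \<union> (\<Union>v\<in>set ?C. set (wd2 v))" unfolding weq by auto
      then have "set ?w = (\<Union>F1 \<union> \<Union>F2) \<union> set ?C" unfolding un1 un2 by blast
      moreover have "set ?C = \<Union>(cycle_edges ?C)" using Zne by (subst Union_cycle_edges) auto
      moreover have "\<Union>F = \<Union>(cycle_edges ?C) \<union> \<Union>F1 \<union> \<Union>F2"
        using arg_cong[OF Feq, of Union] by simp
      ultimately have "tree_word b ?w" "set ?w = insert b (\<Union>F)" using bF by blast+
      moreover have "chord_word ?w F {}"
        unfolding weq by (rule chord_word_mono[OF chord_word_append[OF cw1 cw2]]) (use Feq in auto)
      ultimately show ?thesis by blast
    next
      case False
      \<comment> \<open>The bridge case: \<open>K\<close> is the part behind \<open>{b, u}\<close>.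
        Its walk starts with \<open>u\<close> right after a walk that ends with \<open>b\<close>, so
        the bridge is a chord between neighbouring positions; the final \<open>[b]\<close> returns
        to the root.\<close>
      define R where "R = r\<^sup>* `` {u}"
      define K where "K = {a \<in> F'. a \<inter> R \<noteq> {}}"
      have bR: "b \<notin> R" using False by (simp add: R_def)
      have uR: "u \<in> R" by (simp add: R_def)
      have KR: "\<Union>K \<subseteq> R"
      proof
        fix z assume "z \<in> \<Union>K"
        then obtain e a where e: "e \<in> F'" "z \<in> e" "a \<in> e" "a \<in> R" by (auto simp: K_def)
        obtain c where c: "e = {a, c}" using edge_pair[of e a] FG e by (auto simp: F'_def)
        show "z \<in> R"
        proof (cases "z = a")
          case False
          then have "(a, z) \<in> r" using e c by (auto simp: r_def)
          then show ?thesis using e(4) by (auto simp: R_def intro: rtrancl_into_rtrancl)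
        qed (use e in simp)
      qed
      have fF': "finite F'" using finF by (simp add: F'_def)
      have "card K \<le> card F'" "card (F' - K) \<le> card F'" using fF' by (auto intro!: card_mono simp: K_def)
      then have "tree_words K" "tree_words (F' - K)"
        using cF' FG by (auto intro!: IHt simp: K_def F'_def)
      then obtain w1 w2 where w1: "tree_word u w1" "set w1 = insert u (\<Union>K)" "chord_word w1 K {}"
        and w2: "tree_word b w2" "set w2 = insert b (\<Union>(F' - K))" "chord_word w2 (F' - K) {}"
        unfolding tree_words_def by metis
      have d: "set w2 \<inter> set w1 = {}" "set [b] \<inter> set w1 = {}"
      proof -
        have "set w1 \<subseteq> R" unfolding w1(2) using KR uR by (rule insert_subsetI[rotated])
        moreover have "\<Union>(F' - K) \<inter> R = {}" by (auto simp: K_def)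
        then have "set w2 \<inter> R = {}" unfolding w2(2) using bR by simp
        ultimately show "set w2 \<inter> set w1 = {}" "set [b] \<inter> set w1 = {}" using bR by auto
      qed
      have tw: "tree_word b (w2 @ w1 @ [b])"
        by (rule tree_word.child[OF w2(1) w1(1) tree_word.single d]) auto
      have F: "F = insert {b, u} (K \<union> (F' - K))" using e u by (auto simp: F'_def K_def)
      have st: "set (w2 @ w1 @ [b]) = insert b (\<Union>F)" using w1(2) w2(2) by (subst F) auto
      have c: "chord_word (w2 @ w1 @ [b]) ((F' - K) \<union> (K \<union> {})) {}"
        by (intro chord_word_append w2(3) w1(3) chord_word_trivial)
      obtain p where p: "w2 = p @ [b]" using tree_word_ends[OF w2(1)] by (metis append_butlast_last_id)
      obtain q where q: "w1 = u # q" using tree_word_ends[OF w1(1)] by (metis list.collapse)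
      have weq: "w2 @ w1 @ [b] = p @ b # u # (q @ [b])" by (simp add: p q)
      have "chord_word (w2 @ w1 @ [b]) (insert {b, u} ((F' - K) \<union> (K \<union> {}))) {}"
        using c unfolding weq by (rule chord_word_adjacent)
      then have "chord_word (w2 @ w1 @ [b]) F {}" by (rule chord_word_mono) (use F in auto)
      then show ?thesis using tw st by blast
    qed
  qed
  show ?thesis
    unfolding tree_words_def
  proof
    fix b
    show "\<exists>w. tree_word b w \<and> set w = insert b (\<Union>F) \<and> chord_word w F {}"
    proof (cases "b \<in> \<Union>F")
      case True then show ?thesis by (rule main)
    next
      case b: False
      show ?thesis
      proof (cases "F = {}")
        case True
        then show ?thesis by (intro exI[of _ "[b]"]) (auto simp: tree_word.single chord_word_trivial)
      next
        case False
        then obtain e where "e \<in> F" by blast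
        then obtain u where u: "u \<in> \<Union>F" using edge_arc FG by blast
        obtain w where w: "tree_word u w" "set w = insert u (\<Union>F)" "chord_word w F {}" using main[OF u] by blast
        \<comment> \<open>No edge of \<open>F\<close> ends in \<open>b\<close>, so the whole part is
          placed below \<open>b\<close> as if an edge led there; this suffices for a tree
          word.\<close>
        have "tree_word b ([b] @ w @ [b])"
          by (rule tree_word.child[OF tree_word.single w(1) tree_word.single]) (use w(2) u b in auto)
        moreover have "chord_word ([b] @ w @ [b]) ({} \<union> (F \<union> {})) {}"
          by (intro chord_word_append w(3) chord_word_trivial)
        ultimately show ?thesis using w(2) u by (intro exI[of _ "[b] @ w @ [b]"]) auto
      qed
    qed
  qed
qed

text \<open>For one and the same \<open>F\<close>, trees come before discs: the step for trees uses
  discs with fewer edges only, whereas the step for discs may call for a tree word of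
  \<open>F\<close> itself, when all of \<open>F\<close> hangs at one vertex.\<close>

theorem tree_and_disk_words:
  "(F \<subseteq> G \<longrightarrow> tree_words F) \<and>
   (\<forall>vs D. cycle vs \<longrightarrow> D \<in> sides (curve vs) \<longrightarrow> in_side D F \<longrightarrow> disk_words vs F)"
proof (induction "card F" arbitrary: F rule: less_induct)
  case less
  have t: "tree_words F" if "F \<subseteq> G"
    by (rule tree_words_step[OF that]) (use less in auto)
  moreover have "disk_words vs F" if "cycle vs" "D \<in> sides (curve vs)" "in_side D F" for vs D
  proof (rule disk_words_step[OF that])
    have FG: "F \<subseteq> G" using that by (auto simp: in_side_def)
    fix K assume K: "K \<subseteq> F"
    show "tree_words K"
    proof (cases "K = F")
      case True then show ?thesis using t FG by simp
    next
      case False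
      then have "card K < card F" using K FG finite_G by (meson finite_subset psubset_card_mono psubsetI)
      then show ?thesis using less K FG by blast
    qed
  qed (use less in auto)
  ultimately show ?case by blast
qed

end

section \<open>Minors of sewings from vertex labellings\<close>

definition sewable :: "'a polygonal \<Rightarrow> bool" where
  "sewable Q \<longleftrightarrow> (\<forall>i j. twin Q i j \<longrightarrow> length (side Q i) = length (side Q j) \<and> set (side Q i) \<subseteq> verts Q)"

abbreviation vclass :: "'a polygonal \<Rightarrow> complex \<Rightarrow> complex set" where
  "vclass Q a \<equiv> (vertex_ident Q)\<^sup>* `` {a}"

abbreviation eclass :: "'a polygonal \<Rightarrow> complex set \<Rightarrow> complex set set" where
  "eclass Q e \<equiv> (edge_ident Q)\<^sup>* `` {e}"

lemma twin_sym: "twin Q i j \<Longrightarrow> twin Q j i"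
  by (auto simp: twin_def)

lemma length_oriented_side: "length (oriented_side Q i) = length (side Q i)"
  by (auto simp: oriented_side_def split: symbol.split)

lemma set_oriented_side: "set (oriented_side Q i) = set (side Q i)"
  by (auto simp: oriented_side_def split: symbol.split)

lemma sewableD:
  assumes "sewable Q" "twin Q i j"
  shows "length (side Q i) = length (side Q j)" "set (side Q i) \<subseteq> verts Q" "set (side Q j) \<subseteq> verts Q"
  using assms twin_sym unfolding sewable_def by blast+

lemma sym_vertex_ident: assumes "sewable Q" shows "sym (vertex_ident Q)"
proof (rule symI)
  fix x y assume "(x, y) \<in> vertex_ident Q"
  then obtain i j k where "x = oriented_side Q i ! k" "y = oriented_side Q j ! k" "twin Q i j" "k < length (side Q i)"
    by (auto simp: vertex_ident_def)
  then show "(y, x) \<in> vertex_ident Q"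
    using twin_sym[of Q i j] sewableD(1)[OF assms, of i j] unfolding vertex_ident_def by auto
qed

lemma sym_edge_ident: assumes "sewable Q" shows "sym (edge_ident Q)"
proof (rule symI)
  fix e f assume "(e, f) \<in> edge_ident Q"
  then obtain i j k where *: "e \<in> edges Q" "f \<in> edges Q" "twin Q i j" "Suc k < length (side Q i)"
      "e \<inter> verts Q = {oriented_side Q i ! k, oriented_side Q i ! Suc k}"
      "f \<inter> verts Q = {oriented_side Q j ! k, oriented_side Q j ! Suc k}"
    unfolding edge_ident_def by blast
  have "twin Q j i" "Suc k < length (side Q j)" using * twin_sym[of Q i j] sewableD(1)[OF assms, of i j] by auto
  with * show "(f, e) \<in> edge_ident Q" unfolding edge_ident_def by blast
qed

lemma vertex_ident_verts:
  assumes "sewable Q" "(a, b) \<in> vertex_ident Q" shows "a \<in> verts Q \<and> b \<in> verts Q"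
proof -
  obtain i j k where *: "a = oriented_side Q i ! k" "b = oriented_side Q j ! k" "twin Q i j" "k < length (side Q i)"
    using assms(2) by (auto simp: vertex_ident_def)
  then have "a \<in> set (oriented_side Q i)" "b \<in> set (oriented_side Q j)"
    using sewableD(1)[OF assms(1) *(3)] by (auto simp: length_oriented_side)
  then show ?thesis using sewableD(2,3)[OF assms(1) *(3)] unfolding set_oriented_side by blast
qed

lemma equiv_class_eq_iff_sym: "sym r \<Longrightarrow> r\<^sup>* `` {a} = r\<^sup>* `` {b} \<longleftrightarrow> (a, b) \<in> r\<^sup>*"
proof
  assume s: "sym r"
  { assume "r\<^sup>* `` {a} = r\<^sup>* `` {b}" then show "(a, b) \<in> r\<^sup>*" by blast }
  { assume ab: "(a, b) \<in> r\<^sup>*"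
    then have "(b, a) \<in> r\<^sup>*" using sym_rtrancl[OF s] by (auto simp: sym_def)
    then show "r\<^sup>* `` {a} = r\<^sup>* `` {b}" using ab by (auto intro: rtrancl_trans) }
qed

lemma edge_ident_edges:
  assumes "(e, f) \<in> (edge_ident Q)\<^sup>*" "e \<in> edges Q"
  shows "f \<in> edges Q"
  using assms by induction (auto simp: edge_ident_def)

lemma edge_ident_ends:
  assumes "sewable Q" "(e, f) \<in> (edge_ident Q)\<^sup>*"
  shows "vclass Q ` (e \<inter> verts Q) = vclass Q ` (f \<inter> verts Q)"
  using assms(2)
proof induction
  case (step f g)
  obtain i j k where ijk: "twin Q i j" "Suc k < length (side Q i)"
      "f \<inter> verts Q = {oriented_side Q i ! k, oriented_side Q i ! Suc k}"
      "g \<inter> verts Q = {oriented_side Q j ! k, oriented_side Q j ! Suc k}"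
    using step(2) by (auto simp: edge_ident_def)
  have "(oriented_side Q i ! k, oriented_side Q j ! k) \<in> vertex_ident Q"
    "(oriented_side Q i ! Suc k, oriented_side Q j ! Suc k) \<in> vertex_ident Q"
    using ijk by (auto simp: vertex_ident_def intro: Suc_lessD)
  then have "vclass Q (oriented_side Q i ! k) = vclass Q (oriented_side Q j ! k)"
    "vclass Q (oriented_side Q i ! Suc k) = vclass Q (oriented_side Q j ! Suc k)"
    using equiv_class_eq_iff_sym[OF sym_vertex_ident[OF assms(1)]] by blast+
  then have "vclass Q ` (f \<inter> verts Q) = vclass Q ` (g \<inter> verts Q)" unfolding ijk by simp
  then show ?case using step by simp
qed simp

lemma vclass_verts: "sewable Q \<Longrightarrow> a \<in> verts Q \<Longrightarrow> vclass Q a \<subseteq> verts Q"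
proof
  fix b assume Q: "sewable Q" "a \<in> verts Q" "b \<in> vclass Q a"
  then have "(a, b) \<in> (vertex_ident Q)\<^sup>*" by simp
  then show "b \<in> verts Q" using Q(2) by induction (auto dest: vertex_ident_verts[OF Q(1)])
qed

lemma mverts_sewing: "mverts (sewing Q) = vclass Q ` verts Q"
  by (auto simp: sewing_def quotient_def)

lemma medges_sewing: "medges (sewing Q) = eclass Q ` edges Q"
  by (auto simp: sewing_def quotient_def)

text \<open>Identified edges have identified ends, so any representative of an edge class shows all
  ends of the class.\<close>

lemma mends_sewing:
  assumes "sewable Q" "e \<in> edges Q"
  shows "mends (sewing Q) (eclass Q e) = vclass Q ` (e \<inter> verts Q)"
proof -
  note eq = equiv_class_eq_iff_sym[OF sym_vertex_ident[OF assms(1)]]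
  have "A \<in> vclass Q ` (e \<inter> verts Q)" if A: "A \<in> vclass Q ` verts Q" "f \<in> eclass Q e" "A \<inter> f \<noteq> {}" for A f
  proof -
    obtain a z where a: "A = vclass Q a" "a \<in> verts Q" "z \<in> vclass Q a" "z \<in> f" using A by blast
    then have "A = vclass Q z" using eq by auto
    moreover have "z \<in> verts Q" using a vclass_verts[OF assms(1)] by blast
    ultimately have "A \<in> vclass Q ` (f \<inter> verts Q)" using a by blast
    then show ?thesis using edge_ident_ends[OF assms(1), of e f] A(2) by auto
  qed
  moreover have "\<exists>f\<in>eclass Q e. A \<inter> f \<noteq> {}" if "A \<in> vclass Q ` (e \<inter> verts Q)" for A
    using that by (intro bexI[of _ e]) auto
  ultimately show ?thesis
    by (auto simp: sewing_def quotient_def)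
qed

text \<open>\<open>L\<close> names a vertex of \<open>P\<close> for some vertices of
  \<open>Q\<close>, and the branch set of a class consists of the classes of vertices with a label
  in it. Contracted are only edges with equal labels at both ends, not those whose labels are merely
  identified: an edge of \<open>P\<close> may turn into a loop of \<open>sewing P\<close>, and its
  model has to survive. \<open>L5\<close> follows a model through all its identifications, which
  makes the choice of models injective.\<close>

lemma sewing_minor:
  fixes P Q :: "'a polygonal" and L :: "complex \<Rightarrow> complex option"
  assumes P: "sewable P" and Q: "sewable Q"
    and two: "\<And>e. e \<in> edges P \<Longrightarrow> \<exists>a b. a \<noteq> b \<and> e \<inter> verts P = {a, b}"
    and simp: "\<And>e e'. e \<in> edges P \<Longrightarrow> e' \<in> edges P \<Longrightarrow> e \<inter> verts P = e' \<inter> verts P \<Longrightarrow> e = e'"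
    and L1: "\<And>x v. x \<in> verts Q \<Longrightarrow> L x = Some v \<Longrightarrow> v \<in> verts P"
    and L2: "\<And>x y v. (x, y) \<in> vertex_ident Q \<Longrightarrow> L x = Some v \<Longrightarrow> \<exists>w. L y = Some w \<and> (v, w) \<in> (vertex_ident P)\<^sup>*"
    and L3: "\<And>x y v w. x \<in> verts Q \<Longrightarrow> y \<in> verts Q \<Longrightarrow> L x = Some v \<Longrightarrow> L y = Some w \<Longrightarrow> (v, w) \<in> (vertex_ident P)\<^sup>* \<Longrightarrow>
       (x, y) \<in> (vertex_ident Q \<union> {(a, b). (\<exists>f\<in>edges Q. f \<inter> verts Q = {a, b}) \<and> L a = L b})\<^sup>*"
    and L4: "\<And>v. v \<in> verts P \<Longrightarrow> \<exists>x\<in>verts Q. L x = Some v"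
    and L5: "\<And>e. e \<in> edges P \<Longrightarrow> \<exists>f\<in>edges Q. L ` (f \<inter> verts Q) = Some ` (e \<inter> verts P) \<and>
       (\<forall>f'. (f, f') \<in> (edge_ident Q)\<^sup>* \<longrightarrow> (\<exists>e'. (e, e') \<in> (edge_ident P)\<^sup>* \<and> L ` (f' \<inter> verts Q) = Some ` (e' \<inter> verts P)))"
  shows "minor_of (sewing P) (sewing Q)"
proof -
  note eqP = equiv_class_eq_iff_sym[OF sym_vertex_ident[OF P]]
  note eqQ = equiv_class_eq_iff_sym[OF sym_vertex_ident[OF Q]]
  note eeP = equiv_class_eq_iff_sym[OF sym_edge_ident[OF P]]
  note eeQ = equiv_class_eq_iff_sym[OF sym_edge_ident[OF Q]]
  define SE where "SE = {(a, b). (\<exists>f\<in>edges Q. f \<inter> verts Q = {a, b}) \<and> L a = L b}"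
  define B where "B X = vclass Q ` {x \<in> verts Q. \<exists>v\<in>X. L x = Some v}" for X
  define T where "T X = eclass Q ` {f \<in> edges Q. \<exists>a b v. f \<inter> verts Q = {a, b} \<and> v \<in> X \<and> L a = Some v \<and> L b = Some v}" for X
  obtain fs where fs: "\<And>e. e \<in> edges P \<Longrightarrow> fs e \<in> edges Q \<and> L ` (fs e \<inter> verts Q) = Some ` (e \<inter> verts P) \<and>
       (\<forall>f'. (fs e, f') \<in> (edge_ident Q)\<^sup>* \<longrightarrow> (\<exists>e'. (e, e') \<in> (edge_ident P)\<^sup>* \<and> L ` (f' \<inter> verts Q) = Some ` (e' \<inter> verts P)))"
    using L5 by metis
  define rep where "rep E = (SOME e. e \<in> edges P \<and> E = eclass P e)" for E
  have rep: "rep E \<in> edges P \<and> E = eclass P (rep E)" if E: "E \<in> medges (sewing P)" for E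
  proof -
    have "\<exists>e. e \<in> edges P \<and> E = eclass P e" using E unfolding medges_sewing by blast
    then show ?thesis unfolding rep_def by (rule someI_ex)
  qed
  define \<psi> where "\<psi> E = eclass Q (fs (rep E))" for E
  have lab: "\<exists>w. L y = Some w \<and> (v, w) \<in> (vertex_ident P)\<^sup>*" if "(x, y) \<in> (vertex_ident Q)\<^sup>*" "L x = Some v" for x y v
    using that(1)
  proof induction
    case (step y z)
    then show ?case using L2 by (meson rtrancl_trans)
  qed (use that in auto)
  have labc: "(v, w) \<in> (vertex_ident P)\<^sup>*" if "vclass Q x = vclass Q y" "L x = Some v" "L y = Some w" for x y v w
    using lab[of x y v] that eqQ by auto
  have conn: "connected_subgraph (sewing Q) (B X) (T X)" if X: "X \<in> mverts (sewing P)" for X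
  proof -
    obtain v0 where v0: "v0 \<in> verts P" "X = vclass P v0" using X unfolding mverts_sewing by blast
    have "B X \<noteq> {}" using L4[OF v0(1)] v0(2) by (auto simp: B_def)
    moreover have "B X \<subseteq> mverts (sewing Q)" unfolding mverts_sewing B_def by blast
    moreover have "T X \<subseteq> medges (sewing Q)" unfolding medges_sewing T_def by blast
    moreover have "mends (sewing Q) F \<subseteq> B X" if FT: "F \<in> T X" for F
    proof -
      obtain f a b v where f: "F = eclass Q f" "f \<in> edges Q" "f \<inter> verts Q = {a, b}" "v \<in> X" "L a = Some v" "L b = Some v"
        using FT unfolding T_def by blast
      then have "a \<in> verts Q" "b \<in> verts Q" by blast+
      then show ?thesis using f unfolding f(1) mends_sewing[OF Q f(2)] f(3) B_def by blast
    qed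
    moreover have "(U, W) \<in> {(a, b). \<exists>f\<in>T X. mends (sewing Q) f = {a, b}}\<^sup>*" if UW: "U \<in> B X" "W \<in> B X" for U W
    proof -
      obtain x v where x: "U = vclass Q x" "x \<in> verts Q" "v \<in> X" "L x = Some v" using UW unfolding B_def by blast
      obtain y w where y: "W = vclass Q y" "y \<in> verts Q" "w \<in> X" "L y = Some w" using UW unfolding B_def by blast
      have "vclass P v = vclass P w" using x(3) y(3) unfolding v0 using eqP by auto
      then have "(x, y) \<in> (vertex_ident Q \<union> SE)\<^sup>*"
        using L3[OF x(2) y(2) x(4) y(4)] eqP unfolding SE_def by blast
      then have "y \<in> verts Q \<and> (\<exists>w\<in>X. L y = Some w) \<and> (vclass Q x, vclass Q y) \<in> {(a, b). \<exists>f\<in>T X. mends (sewing Q) f = {a, b}}\<^sup>*"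
      proof induction
        case base show ?case using x by blast
      next
        case (step y z)
        then obtain w where w: "y \<in> verts Q" "w \<in> X" "L y = Some w"
          "(vclass Q x, vclass Q y) \<in> {(a, b). \<exists>f\<in>T X. mends (sewing Q) f = {a, b}}\<^sup>*" by blast
        from step(2) show ?case
        proof
          assume yz: "(y, z) \<in> vertex_ident Q"
          obtain w' where w': "L z = Some w'" "(w, w') \<in> (vertex_ident P)\<^sup>*" using L2[OF yz w(3)] by blast
          then have "w' \<in> X" using w(2) unfolding v0 by (auto intro: rtrancl_trans)
          moreover have "vclass Q y = vclass Q z" using yz eqQ by blast
          moreover have "z \<in> verts Q" using vertex_ident_verts[OF Q yz] by blast
          ultimately show ?thesis using w w' by metis
        next
          assume "(y, z) \<in> SE"
          then obtain f where f: "f \<in> edges Q" "f \<inter> verts Q = {y, z}" "L y = L z" by (auto simp: SE_def)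
          then have "eclass Q f \<in> T X" unfolding T_def using w by (intro imageI CollectI) (metis)
          moreover have "mends (sewing Q) (eclass Q f) = {vclass Q y, vclass Q z}" unfolding mends_sewing[OF Q f(1)] f(2) by simp
          ultimately have "(vclass Q y, vclass Q z) \<in> {(a, b). \<exists>f\<in>T X. mends (sewing Q) f = {a, b}}" by blast
          moreover have "z \<in> verts Q" using f(2) by blast
          ultimately show ?thesis using w f(3) by (metis (no_types, lifting) rtrancl.rtrancl_into_rtrancl)
        qed
      qed
      then show ?thesis using x y by blast
    qed
    ultimately show ?thesis unfolding connected_subgraph_def by blast
  qed
  have disj: "B X \<inter> B Y = {}" if XY: "X \<in> mverts (sewing P)" "Y \<in> mverts (sewing P)" "X \<noteq> Y" for X Y
  proof (rule ccontr)
    assume "B X \<inter> B Y \<noteq> {}"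
    then obtain x y v w where xy: "vclass Q x = vclass Q y" "v \<in> X" "L x = Some v" "w \<in> Y" "L y = Some w"
      unfolding B_def by blast
    have "(v, w) \<in> (vertex_ident P)\<^sup>*" using labc xy by blast
    moreover have "X = vclass P v" "Y = vclass P w" using XY xy eqP unfolding mverts_sewing by blast+
    ultimately show False using eqP XY by blast
  qed
  have inj: "inj_on \<psi> (medges (sewing P))"
  proof
    fix E E' assume E: "E \<in> medges (sewing P)" "E' \<in> medges (sewing P)" "\<psi> E = \<psi> E'"
    note r = rep[OF E(1)] rep[OF E(2)]
    have "(fs (rep E), fs (rep E')) \<in> (edge_ident Q)\<^sup>*" using E(3) eeQ unfolding \<psi>_def by blast
    then obtain e' where e': "(rep E, e') \<in> (edge_ident P)\<^sup>*" "L ` (fs (rep E') \<inter> verts Q) = Some ` (e' \<inter> verts P)"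
      using fs[of "rep E"] r by blast
    then have "Some ` (e' \<inter> verts P) = Some ` (rep E' \<inter> verts P)" using fs[of "rep E'"] r by simp
    then have "e' \<inter> verts P = rep E' \<inter> verts P" by (simp add: inj_image_eq_iff)
    then have "e' = rep E'" using simp edge_ident_edges[OF e'(1)] r by blast
    then show "E = E'" using e'(1) r eeP by metis
  qed
  have edge: "\<psi> E \<in> medges (sewing Q) - (\<Union>X\<in>mverts (sewing P). T X) \<and>
           mends (sewing Q) (\<psi> E) \<subseteq> (\<Union>X\<in>mverts (sewing P). B X) \<and>
           mends (sewing P) E = {X \<in> mverts (sewing P). B X \<inter> mends (sewing Q) (\<psi> E) \<noteq> {}}"
    if E: "E \<in> medges (sewing P)" for E
  proof (intro conjI)
    let ?e = "rep E" let ?f = "fs ?e"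
    note r = rep[OF E]
    note fsr = fs[OF conjunct1[OF r]]
    have f: "?f \<in> edges Q" "L ` (?f \<inter> verts Q) = Some ` (?e \<inter> verts P)"
      "\<And>f'. (?f, f') \<in> (edge_ident Q)\<^sup>* \<Longrightarrow> \<exists>e'. (?e, e') \<in> (edge_ident P)\<^sup>* \<and> L ` (f' \<inter> verts Q) = Some ` (e' \<inter> verts P)"
      by (rule conjunct1[OF fsr], rule conjunct1[OF conjunct2[OF fsr]],
          rule conjunct2[OF conjunct2[OF fsr], rule_format])
    have mf: "mends (sewing Q) (\<psi> E) = vclass Q ` (?f \<inter> verts Q)" unfolding \<psi>_def by (rule mends_sewing[OF Q f(1)])
    have me: "mends (sewing P) E = vclass P ` (?e \<inter> verts P)" using mends_sewing[OF P, of ?e] r by simp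
    \<comment> \<open>Each edge in the class of the model shows the labels of an edge of
      \<open>P\<close>, hence two different ones, so the class contains no contracted edge.\<close>
    have "\<psi> E \<notin> T X" for X
    proof
      assume "\<psi> E \<in> T X"
      then obtain f1 a b v where f1: "eclass Q ?f = eclass Q f1" "f1 \<inter> verts Q = {a, b}" "L a = Some v" "L b = Some v"
        unfolding T_def \<psi>_def by blast
      have "(?f, f1) \<in> (edge_ident Q)\<^sup>*" using f1(1) by (simp only: eeQ)
      from f(3)[OF this] obtain e' where e': "(?e, e') \<in> (edge_ident P)\<^sup>*" "L ` (f1 \<inter> verts Q) = Some ` (e' \<inter> verts P)" by blast
      have "e' \<in> edges P" using edge_ident_edges[OF e'(1)] r by blast
      then obtain c d where "c \<noteq> d" "e' \<inter> verts P = {c, d}" using two by blast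
      then have "{Some v} = {Some c, Some d}" using e'(2) f1 by auto
      then show False using \<open>c \<noteq> d\<close> by auto
    qed
    then show "\<psi> E \<in> medges (sewing Q) - (\<Union>X\<in>mverts (sewing P). T X)"
      unfolding medges_sewing using f(1) by (auto simp: \<psi>_def)
    have Lf: "\<exists>v. v \<in> ?e \<inter> verts P \<and> L x = Some v" if "x \<in> ?f \<inter> verts Q" for x
    proof -
      have "L x \<in> Some ` (?e \<inter> verts P)" using f(2) that by blast
      then show ?thesis by blast
    qed
    show "mends (sewing Q) (\<psi> E) \<subseteq> (\<Union>X\<in>mverts (sewing P). B X)"
    proof
      fix W assume "W \<in> mends (sewing Q) (\<psi> E)"
      then obtain x where x: "W = vclass Q x" "x \<in> ?f \<inter> verts Q" unfolding mf by blast
      obtain v where v: "v \<in> ?e \<inter> verts P" "L x = Some v" using Lf[OF x(2)] by blast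
      have "W \<in> B (vclass P v)" unfolding B_def using x v by blast
      then show "W \<in> (\<Union>X\<in>mverts (sewing P). B X)" unfolding mverts_sewing using v by blast
    qed
    show "mends (sewing P) E = {X \<in> mverts (sewing P). B X \<inter> mends (sewing Q) (\<psi> E) \<noteq> {}}"
    proof
      show "mends (sewing P) E \<subseteq> {X \<in> mverts (sewing P). B X \<inter> mends (sewing Q) (\<psi> E) \<noteq> {}}"
      proof
        fix X assume "X \<in> mends (sewing P) E"
        then obtain v where v: "X = vclass P v" "v \<in> ?e \<inter> verts P" unfolding me by blast
        then have "Some v \<in> L ` (?f \<inter> verts Q)" using f(2) by blast
        then obtain x where x: "x \<in> ?f \<inter> verts Q" "L x = Some v" by force
        have "vclass Q x \<in> B X" unfolding B_def v(1) using x by blast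
        then show "X \<in> {X \<in> mverts (sewing P). B X \<inter> mends (sewing Q) (\<psi> E) \<noteq> {}}"
          unfolding mf mverts_sewing using x v by blast
      qed
      show "{X \<in> mverts (sewing P). B X \<inter> mends (sewing Q) (\<psi> E) \<noteq> {}} \<subseteq> mends (sewing P) E"
      proof
        fix X assume "X \<in> {X \<in> mverts (sewing P). B X \<inter> mends (sewing Q) (\<psi> E) \<noteq> {}}"
        then have X: "X \<in> mverts (sewing P)" "B X \<inter> mends (sewing Q) (\<psi> E) \<noteq> {}" by blast+
        then obtain x y w where xy: "vclass Q x = vclass Q y" "x \<in> ?f \<inter> verts Q" "w \<in> X" "L y = Some w"
          unfolding mf B_def by blast
        obtain v where v: "v \<in> ?e \<inter> verts P" "L x = Some v" using Lf[OF xy(2)] by blast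
        have "(v, w) \<in> (vertex_ident P)\<^sup>*" using labc[OF xy(1) v(2) xy(4)] .
        moreover have "X = vclass P w" using X(1) xy(3) eqP unfolding mverts_sewing by blast
        ultimately have "X = vclass P v" using eqP by blast
        then show "X \<in> mends (sewing P) E" unfolding me using v by blast
      qed
    qed
  qed
  show ?thesis unfolding minor_of_def
    by (intro exI[of _ B] exI[of _ T] exI[of _ \<psi>] conjI ballI impI)
      (simp_all only: conn disj inj edge[THEN conjunct1] edge[THEN conjunct2, THEN conjunct1] edge[THEN conjunct2, THEN conjunct2] not_False_eq_True)
qed

section \<open>Sides of polygons\<close>

lemma cycle_edges_conv_nth:
  assumes "vs \<noteq> []"
  shows "cycle_edges vs = {{vs ! k, vs ! (Suc k mod length vs)} | k. k < length vs}"
proof -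
  have "{{vs ! k, vs ! (Suc k mod length vs)} | k. k < length vs} =
     insert {last vs, hd vs} {{vs ! i, vs ! Suc i} | i. Suc i < length vs}" (is "?L = ?R")
  proof
    show "?L \<subseteq> ?R"
    proof
      fix e assume "e \<in> ?L"
      then obtain k where k: "k < length vs" "e = {vs ! k, vs ! (Suc k mod length vs)}" by blast
      show "e \<in> ?R"
      proof (cases "Suc k < length vs")
        case True then show ?thesis using k by auto
      next
        case False
        then have "Suc k = length vs" using k by simp
        then have "e = {last vs, hd vs}" using k assms by (auto simp: last_conv_nth hd_conv_nth dest: arg_cong[of _ _ "\<lambda>x. x - 1"])
        then show ?thesis by simp
      qed
    qed
    show "?R \<subseteq> ?L"
    proof
      fix e assume "e \<in> ?R"
      then consider "e = {last vs, hd vs}" | i where "Suc i < length vs" "e = {vs ! i, vs ! Suc i}" by blast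
      then show "e \<in> ?L"
      proof cases
        case 1
        then show ?thesis using assms
          by (intro CollectI exI[of _ "length vs - 1"]) (auto simp: last_conv_nth hd_conv_nth)
      next
        case 2
        then show ?thesis by (intro CollectI exI[of _ i]) auto
      qed
    qed
  qed
  then show ?thesis by (simp add: cycle_edges_def path_edges_conv_nth)
qed

lemma path_edges_blocks:
  "path_edges (concat (map (\<lambda>i. c i # I i) [0..<n]) @ [c n]) = (\<Union>i<n. path_edges (c i # I i @ [c (Suc i)]))"
proof (induction n)
  case (Suc n)
  let ?X = "concat (map (\<lambda>i. c i # I i) [0..<n])"
  have "path_edges (?X @ (c n # I n @ [c (Suc n)])) = path_edges (?X @ [c n]) \<union> path_edges (c n # I n @ [c (Suc n)])"
  proof (cases "?X = []")
    case False
    have "path_edges (?X @ (c n # I n @ [c (Suc n)])) = path_edges ?X \<union> path_edges (c n # I n @ [c (Suc n)]) \<union> {{last ?X, c n}}"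
      using False by (subst path_edges_append) auto
    moreover have "path_edges (?X @ [c n]) = path_edges ?X \<union> {{last ?X, c n}}"
      using False by (subst path_edges_append) auto
    ultimately show ?thesis by auto
  next
    case True
    then have "n = 0" by (cases n) auto
    then show ?thesis by simp
  qed
  then show ?case using Suc by (simp add: lessThan_Suc Un_commute)
qed simp

lemma cycle_edges_blocks:
  assumes "0 < s"
  shows "cycle_edges (concat (map (\<lambda>i. c i # I i) [0..<s])) = (\<Union>i<s. path_edges (c i # I i @ [c (Suc i mod s)]))"
proof -
  define c' where "c' i = (if i = s then c 0 else c i)" for i
  let ?X = "concat (map (\<lambda>i. c i # I i) [0..<s])"
  have ne: "?X \<noteq> []" using assms by (auto intro!: exI[of _ 0])
  have hd: "hd ?X = c 0" using assms by (simp add: upt_conv_Cons)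
  have "?X = concat (map (\<lambda>i. c' i # I i) [0..<s])" by (intro arg_cong[of _ _ concat] map_cong) (auto simp: c'_def)
  moreover have "c' s = c 0" by (simp add: c'_def)
  ultimately have "path_edges (?X @ [c 0]) = (\<Union>i<s. path_edges (c' i # I i @ [c' (Suc i)]))"
    using path_edges_blocks[of c' I s] by metis
  also have "\<dots> = (\<Union>i<s. path_edges (c i # I i @ [c (Suc i mod s)]))"
  proof (intro SUP_cong refl)
    fix i assume i: "i \<in> {..<s}"
    then have "c' i = c i" "c' (Suc i) = c (Suc i mod s)" by (auto simp: c'_def)
    then show "path_edges (c' i # I i @ [c' (Suc i)]) = path_edges (c i # I i @ [c (Suc i mod s)])" by simp
  qed
  moreover have "path_edges (?X @ [c 0]) = cycle_edges ?X"
    using ne hd path_edges_append[OF ne, of "[c 0]"] unfolding cycle_edges_def by auto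
  ultimately show ?thesis by simp
qed

lemma side_blocks:
  assumes o: "outer P = concat (map (\<lambda>i. c i # I i) [0..<s])" and b: "border P = map c [0..<s]"
    and d: "distinct (outer P)" and i: "i < s" and s: "2 \<le> s"
  shows "side P i = c i # I i @ [c (Suc i mod s)]"
proof -
  let ?B = "\<lambda>i. c i # I i"
  have "[0..<s] = [0..<i] @ i # [Suc i..<s]"
    using i upt_add_eq_append[of 0 i "s - i"] by (simp add: upt_conv_Cons)
  then have os: "outer P = concat (map ?B [0..<i]) @ c i # I i @ concat (map ?B [Suc i..<s])" using o by simp
  let ?pre = "concat (map ?B [0..<i])" and ?post = "concat (map ?B [Suc i..<s])"
  have dd: "distinct (?pre @ c i # I i @ ?post)" using d os by simp
  then have "c i \<notin> set ?pre" by auto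
  then have dw: "dropWhile (\<lambda>v. v \<noteq> c i) (outer P) = c i # I i @ ?post"
    unfolding os by (subst dropWhile_append2) auto
  have tw: "takeWhile (\<lambda>v. v \<noteq> c (Suc i mod s)) (c i # I i @ ?post) = c i # I i"
  proof (cases "Suc i < s")
    case True
    then have p: "?post = c (Suc i) # I (Suc i) @ concat (map ?B [Suc (Suc i)..<s])" by (simp add: upt_conv_Cons)
    have "c (Suc i) \<notin> set (c i # I i)" using dd unfolding p by auto
    moreover have "c i # I i @ ?post = (c i # I i) @ c (Suc i) # I (Suc i) @ concat (map ?B [Suc (Suc i)..<s])" using p by simp
    ultimately show ?thesis using True
      by (simp only: mod_less) (subst takeWhile_append2; auto)
  next
    case False
    \<comment> \<open>The last side ends at the first corner, which does not recur in the rest of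
      the list, so \<open>takeWhile\<close> runs to the end; \<open>2 \<le> s\<close> ensures that
      this corner is not \<open>c i\<close> itself.\<close>
    then have "Suc i = s" using i by simp
    then have "i \<noteq> 0" using s by auto
    then have "c 0 \<in> set ?pre" by (auto intro!: bexI[of _ 0])
    then have "c 0 \<notin> set (c i # I i)" using dd by auto
    then show ?thesis using \<open>Suc i = s\<close> by (auto simp: takeWhile_eq_all_conv)
  qed
  show ?thesis
    using i s tw dw b by (simp add: side_def Let_def)
qed

lemma subseq_blocks:
  assumes "subseq cs vs" "cs \<noteq> []" "vs \<noteq> []" "hd cs = hd vs"
  shows "\<exists>I. vs = concat (map (\<lambda>i. cs ! i # I i) [0..<length cs])"
  using assms
proof (induction cs arbitrary: vs)
  case (Cons c cs)
  then obtain vs' where vs: "vs = c # vs'" by (cases vs) auto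
  then have sub: "subseq cs vs'" using Cons.prems(1) by simp
  show ?case
  proof (cases cs)
    case Nil then show ?thesis using vs by (intro exI[of _ "\<lambda>_. vs'"]) auto
  next
    case (Cons c' cs')
    then obtain A B where AB: "vs' = A @ c' # B" "subseq cs' B"
      using sub list_emb_ConsD[of "(=)" c' cs' vs'] by auto
    then obtain I where I: "c' # B = concat (map (\<lambda>i. cs ! i # I i) [0..<length cs])"
      using Cons.IH[of "c' # B"] Cons by auto
    define I' where "I' i = (case i of 0 \<Rightarrow> A | Suc j \<Rightarrow> I j)" for i
    have "[0..<length (c # cs)] = 0 # map Suc [0..<length cs]" by (simp add: upt_conv_Cons map_Suc_upt del: upt_Suc)
    then have "concat (map (\<lambda>i. (c # cs) ! i # I' i) [0..<length (c # cs)]) = (c # A) @ concat (map (\<lambda>i. cs ! i # I i) [0..<length cs])"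
      by (simp add: I'_def comp_def del: upt_Suc)
    also have "\<dots> = vs" using I AB vs by simp
    finally show ?thesis by metis
  qed
qed simp

lemma real_nat_gap:
  assumes "real j < real b" "real b < real j + 1" shows False
proof -
  have "j < b" using assms(1) by (simp only: of_nat_less_iff)
  then have "real (Suc j) \<le> real b" by (simp only: of_nat_le_iff Suc_le_eq)
  then show False using assms(2) by simp
qed

section \<open>The drawing of \<open>\<bbbU>\<close>\<close>

text \<open>The common coordinate of the outer vertices on the diagonal, block by block. Corner
  \<open>0\<close> lies off the diagonal and is left out. The order along the outer cycle becomes
  the order of real numbers.\<close>

definition U_ts :: "nat \<Rightarrow> nat \<Rightarrow> nat \<Rightarrow> real list" where
  "U_ts s m i = (if i = 0 then [] else [real (i * m) - 1 + real i / real s]) @ map real [i * m..<Suc i * m]"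

definition U_diag :: "nat \<Rightarrow> nat \<Rightarrow> real list" where
  "U_diag s m = concat (map (U_ts s m) [0..<s])"

lemma U_ts_bounds:
  assumes "x \<in> set (U_ts s m i)" "i < s"
  shows "x < real (Suc i * m) - 1 + real (Suc i) / real s" "0 < i \<Longrightarrow> real (i * m) - 1 + real i / real s \<le> x"
proof -
  have sp: "0 < s" using assms by auto
  have div: "real i / real s < real (Suc i) / real s" "real i / real s < 1" "0 < real (Suc i) / real s"
    using assms sp by (auto simp: field_simps)
  consider "x = real (i * m) - 1 + real i / real s" | k where "x = real k" "i * m \<le> k" "k < Suc i * m"
    using assms(1) by (auto simp: U_ts_def split: if_splits)
  then have "x < real (Suc i * m) - 1 + real (Suc i) / real s \<and> real (i * m) - 1 + real i / real s \<le> x"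
  proof cases
    case 1
    have "real (i * m) \<le> real (Suc i * m)" by (simp only: of_nat_le_iff) simp
    then show ?thesis using 1 div by linarith
  next
    case 2
    have "real k + 1 \<le> real (Suc i * m)" using 2(3) by linarith
    moreover have "real (i * m) \<le> real k" using 2(2) by (simp only: of_nat_le_iff)
    ultimately show ?thesis using 2(1) div by linarith
  qed
  then show "x < real (Suc i * m) - 1 + real (Suc i) / real s" "0 < i \<Longrightarrow> real (i * m) - 1 + real i / real s \<le> x" by auto
qed

lemma U_ts_less:
  assumes "x \<in> set (U_ts s m i)" "y \<in> set (U_ts s m j)" "i < j" "j < s"
  shows "x < y"
proof -
  have "x < real (Suc i * m) - 1 + real (Suc i) / real s" using U_ts_bounds(1)[OF assms(1)] assms by simp
  also have "\<dots> \<le> real (j * m) - 1 + real j / real s"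
  proof -
    have "Suc i * m \<le> j * m" using assms(3) by (intro mult_right_mono) auto
    then have "real (Suc i * m) \<le> real (j * m)" by (simp only: of_nat_le_iff)
    moreover have "real (Suc i) / real s \<le> real j / real s" using assms(3) by (intro divide_right_mono) auto
    ultimately show ?thesis by linarith
  qed
  also have "\<dots> \<le> y" using U_ts_bounds(2)[OF assms(2,4)] assms(3) by simp
  finally show ?thesis .
qed

lemma U_ts_sorted:
  assumes "i < s" shows "sorted_wrt (<) (U_ts s m i)"
proof -
  have "sorted_wrt (<) (map real [i * m..<Suc i * m])"
    by (simp add: sorted_wrt_map)
  moreover have "real (i * m) - 1 + real i / real s < real k" if "i * m \<le> k" for k
  proof -
    have "real i / real s < 1" using assms by (simp add: field_simps)
    moreover have "real (i * m) \<le> real k" using that by (simp only: of_nat_le_iff)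
    ultimately show ?thesis by linarith
  qed
  ultimately show ?thesis by (auto simp: U_ts_def)
qed

lemma U_diag_sorted: "sorted_wrt (<) (U_diag s m)"
proof -
  have "sorted_wrt (<) (concat (map (U_ts s m) [0..<n]))" if "n \<le> s" for n
    using that
  proof (induction n)
    case (Suc n)
    then show ?case using U_ts_sorted[of n s m] U_ts_less[of _ s m _ _ n] by (auto simp: sorted_wrt_append)
  qed simp
  then show ?thesis by (simp add: U_diag_def)
qed

abbreviation on_diag :: "real \<Rightarrow> complex" where
  "on_diag t \<equiv> Complex t t"

lemma U_outer_diag:
  assumes "0 < s"
  shows "U_outer s m = Complex (real (s * m)) (-1) # map on_diag (U_diag s m)"
proof -
  let ?B = "\<lambda>i. U_corner s m i # map (\<lambda>k. grid_point k k) [i * m..<Suc i * m]"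
  have 1: "?B i = map on_diag (U_ts s m i)" if "0 < i" for i
    using that by (simp add: U_corner_def U_ts_def grid_point_def Let_def comp_def)
  have 0: "?B 0 = Complex (real (s * m)) (-1) # map on_diag (U_ts s m 0)"
    by (simp add: U_corner_def U_ts_def grid_point_def comp_def)
  have up: "[0..<s] = 0 # [1..<s]" using assms by (simp add: upt_conv_Cons)
  have "map ?B [1..<s] = map (\<lambda>i. map on_diag (U_ts s m i)) [1..<s]"
    by (rule map_cong[OF refl]) (use 1 in simp)
  then have "U_outer s m = ?B 0 @ concat (map (\<lambda>i. map on_diag (U_ts s m i)) [1..<s])"
    unfolding U_outer_def up list.map concat.simps by (simp only:)
  also have "\<dots> = Complex (real (s * m)) (-1) # map on_diag (concat (map (U_ts s m) (0 # [1..<s])))"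
    unfolding 0 by (simp add: map_concat comp_def)
  finally show ?thesis unfolding U_diag_def up .
qed

lemma distinct_U_outer:
  assumes "0 < s" shows "distinct (U_outer s m)"
proof -
  have "distinct (U_diag s m)" using U_diag_sorted strict_sorted_iff by blast
  then have "distinct (map on_diag (U_diag s m))" by (simp add: distinct_map inj_on_def)
  moreover have "Complex (real (s * m)) (-1) \<notin> set (map on_diag (U_diag s m))"
  proof
    assume "Complex (real (s * m)) (-1) \<in> set (map on_diag (U_diag s m))"
    then have "real (s * m) = -1" by auto
    then show False using of_nat_0_le_iff[of "s * m", where 'a = real] by linarith
  qed
  ultimately show ?thesis unfolding U_outer_diag[OF assms] by simp
qed

lemma set_U_diag:
  "set (U_diag s m) = {real (i * m) - 1 + real i / real s | i. 0 < i \<and> i < s} \<union> real ` {..<s * m}"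
proof -
  have "set (U_diag s m) = (\<Union>i<s. set (U_ts s m i))" by (auto simp: U_diag_def)
  also have "\<dots> = {real (i * m) - 1 + real i / real s | i. 0 < i \<and> i < s} \<union> (\<Union>i<s. real ` {i * m..<Suc i * m})"
    by (auto simp: U_ts_def split: if_splits)
  also have "(\<Union>i<s. real ` {i * m..<Suc i * m}) = real ` (\<Union>i<s. {i * m..<Suc i * m})" by blast
  also have "(\<Union>i<s. {i * m..<Suc i * m}) = {..<s * m}"
  proof (induction s)
    case (Suc s) then show ?case by (simp add: lessThan_Suc ivl_disj_un)  (auto simp: add.commute)
  qed simp
  finally show ?thesis .
qed

lemma U_verts:
  fixes \<sigma> :: "'a symbol list"
  assumes "length \<sigma> = s" "0 < s"
  shows "verts (U_embedding \<sigma> m) = {Complex (real (s * m)) (-1)} \<union> on_diag ` set (U_diag s m) \<union>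
     {grid_point i j | i j. j < i \<and> i < s * m}"
proof -
  have "{grid_point i j | i j. j \<le> i \<and> i < s * m} =
     on_diag ` real ` {..<s * m} \<union> {grid_point i j | i j. j < i \<and> i < s * m}"
  proof
    show "{grid_point i j | i j. j \<le> i \<and> i < s * m} \<subseteq> on_diag ` real ` {..<s * m} \<union> {grid_point i j | i j. j < i \<and> i < s * m}"
    proof
      fix z assume "z \<in> {grid_point i j | i j. j \<le> i \<and> i < s * m}"
      then obtain i j where z: "z = grid_point i j" "j \<le> i" "i < s * m" by blast
      show "z \<in> on_diag ` real ` {..<s * m} \<union> {grid_point i j | i j. j < i \<and> i < s * m}"
      proof (cases "j = i")
        case True then show ?thesis using z by (auto simp: grid_point_def)
      next
        case False then have "j < i" using z by simp
        then show ?thesis using z by blast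
      qed
    qed
    show "on_diag ` real ` {..<s * m} \<union> {grid_point i j | i j. j < i \<and> i < s * m} \<subseteq> {grid_point i j | i j. j \<le> i \<and> i < s * m}"
      by (auto simp: grid_point_def intro: less_imp_le)
  qed
  moreover have "U_corner s m ` {..<s} = {Complex (real (s * m)) (-1)} \<union> on_diag ` {real (i * m) - 1 + real i / real s | i. 0 < i \<and> i < s}"
  proof -
    have "{..<s} = insert 0 {i. 0 < i \<and> i < s}" using assms(2) by auto
    then have "U_corner s m ` {..<s} = insert (U_corner s m 0) (U_corner s m ` {i. 0 < i \<and> i < s})" by (metis image_insert)
    also have "U_corner s m ` {i. 0 < i \<and> i < s} = on_diag ` {real (i * m) - 1 + real i / real s | i. 0 < i \<and> i < s}"
      by (auto simp: U_corner_def Let_def image_iff)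
    finally show ?thesis by (simp add: U_corner_def)
  qed
  ultimately show ?thesis
    unfolding U_embedding_def Let_def set_U_diag image_Un using assms(1) by auto
qed

text \<open>A unit segment has one constant integral coordinate and contains grid points only at its
  ends. The corners on the diagonal have no integral coordinate, and corner \<open>0\<close> lies at
  height \<open>-1\<close>.\<close>

lemma U_grid_edge_ends:
  fixes \<sigma> :: "'a symbol list"
  assumes "length \<sigma> = s" "j \<le> i" "i < s * m" "j' \<le> i'" "i' < s * m" "\<bar>int i - int i'\<bar> + \<bar>int j - int j'\<bar> = 1"
  shows "closed_segment (grid_point i j) (grid_point i' j') \<inter> verts (U_embedding \<sigma> m) = {grid_point i j, grid_point i' j'}"
    (is "?S \<inter> ?V = _")
proof
  have sp: "0 < s" "0 < m" using assms by (cases s; cases m; auto)+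
  show "{grid_point i j, grid_point i' j'} \<subseteq> ?S \<inter> ?V"
    using assms by (auto simp: U_embedding_def Let_def)
  show "?S \<inter> ?V \<subseteq> {grid_point i j, grid_point i' j'}"
  proof
    fix z assume z: "z \<in> ?S \<inter> ?V"
    then obtain u where u: "0 \<le> u" "u \<le> 1" "z = (1 - u) *\<^sub>R grid_point i j + u *\<^sub>R grid_point i' j'"
      by (auto simp: in_segment)
    have re: "Re z = (1 - u) * real i + u * real i'" and im: "Im z = (1 - u) * real j + u * real j'"
      using u(3) by (auto simp: grid_point_def)
    have hv: "i = i' \<and> (j' = Suc j \<or> j = Suc j') \<or> j = j' \<and> (i' = Suc i \<or> i = Suc i')" using assms(6) by auto
    have gp: "z \<in> {grid_point i j, grid_point i' j'}" if ab: "z = grid_point a b" for a b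
    proof -
      have a: "real a = (1 - u) * real i + u * real i'" and b: "real b = (1 - u) * real j + u * real j'"
        using re im ab by (auto simp: grid_point_def)
      have "u = 0 \<or> u = 1"
      proof (rule ccontr)
        assume n: "\<not> (u = 0 \<or> u = 1)"
        then have u01: "0 < u" "u < 1" using u by auto
        from hv consider "j' = Suc j" | "j = Suc j'" | "i' = Suc i" | "i = Suc i'" by blast
        then show False
        proof cases
          case 1 then have "real b = real j + u" using b by (simp add: algebra_simps)
          then show False using u01 real_nat_gap[of j b] by linarith
        next
          case 2 then have "real b = real j - u" using b by (simp add: algebra_simps)
          then show False using u01 real_nat_gap[of b j] by linarith
        next
          case 3 then have "real a = real i + u" using a by (simp add: algebra_simps)
          then show False using u01 real_nat_gap[of i a] by linarith
        next
          case 4 then have "real a = real i - u" using a by (simp add: algebra_simps)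
          then show False using u01 real_nat_gap[of a i] by linarith
        qed
      qed
      then show ?thesis using u(3) by auto
    qed
    from z consider (a) a b where "z = grid_point a b" | (b) k where "z = U_corner s m k" "k < s"
      by (auto simp: U_embedding_def Let_def assms(1))
    then show "z \<in> {grid_point i j, grid_point i' j'}"
    proof cases
      case a then show ?thesis by (rule gp)
    next
      case b
      show ?thesis
      proof (cases "k = 0")
        case True
        then have "Im z = -1" using b by (simp add: U_corner_def)
        moreover have "0 \<le> Im z" unfolding im using u by auto
        ultimately show ?thesis by simp
      next
        case False
        define t where "t = real (k * m) - 1 + real k / real s"
        have zt: "Re z = t" "Im z = t" using b False by (auto simp: U_corner_def Let_def t_def)
        have tn: "t \<noteq> real a" for a
        proof
          assume ta: "t = real a"
          have fr: "0 < real k / real s" "real k / real s < 1" using b False sp by (auto simp: field_simps)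
          have "real k / real s = real a + 1 - real (k * m)" using ta unfolding t_def by linarith
          then have "real (k * m) < real a + 1" "real a + 1 < real (k * m) + 1" using fr by linarith+
          then show False using real_nat_gap[of "k * m" "Suc a"] by simp
        qed
        have "Re z = real i \<or> Im z = real j" using hv re im by (auto simp: algebra_simps)
        then show ?thesis using zt tn by auto
      qed
    qed
  qed
qed

text \<open>Vertices on the diagonal correspond to the entries of a strictly increasing list, so
  none lies between two successive ones, and no other vertex is on the diagonal.\<close>

lemma U_diag_edge_ends:
  assumes "length \<sigma> = s" "0 < s" "Suc k < length (U_diag s m)"
  shows "closed_segment (on_diag (U_diag s m ! k)) (on_diag (U_diag s m ! Suc k)) \<inter> verts (U_embedding \<sigma> m) =
     {on_diag (U_diag s m ! k), on_diag (U_diag s m ! Suc k)}" (is "?S \<inter> ?V = _")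
proof
  let ?t = "\<lambda>k. U_diag s m ! k"
  have mem: "?t k \<in> set (U_diag s m)" "?t (Suc k) \<in> set (U_diag s m)" using assms(3) by auto
  show "{on_diag (?t k), on_diag (?t (Suc k))} \<subseteq> ?S \<inter> ?V"
    unfolding U_verts[OF assms(1,2)] using mem by auto
  have mono: "?t a < ?t b" if "a < b" "b < length (U_diag s m)" for a b
    using U_diag_sorted[of s m] that by (simp add: sorted_wrt_iff_nth_less)
  show "?S \<inter> ?V \<subseteq> {on_diag (?t k), on_diag (?t (Suc k))}"
  proof
    fix z assume z: "z \<in> ?S \<inter> ?V"
    then obtain u where u: "0 \<le> u" "u \<le> 1" "z = (1 - u) *\<^sub>R on_diag (?t k) + u *\<^sub>R on_diag (?t (Suc k))"
      by (auto simp: in_segment)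
    define t where "t = (1 - u) * ?t k + u * ?t (Suc k)"
    have zt: "z = on_diag t" using u(3) by (simp add: complex_eq_iff t_def)
    have lt: "?t k < ?t (Suc k)" using mono assms(3) by simp
    have "t = ?t k + u * (?t (Suc k) - ?t k)" by (simp add: t_def algebra_simps)
    then have lo: "?t k \<le> t" using u lt by simp
    have "t = ?t (Suc k) - (1 - u) * (?t (Suc k) - ?t k)" by (simp add: t_def algebra_simps)
    then have hi: "t \<le> ?t (Suc k)" using u lt by simp
    have "t \<in> set (U_diag s m)"
    proof -
      have "real s * real m \<noteq> -1" using of_nat_0_le_iff[of "s * m", where 'a = real] unfolding of_nat_mult by linarith
      then show ?thesis
        using z unfolding zt U_verts[OF assms(1,2)] by (auto simp: grid_point_def complex_eq_iff)
    qed
    then obtain l where l: "l < length (U_diag s m)" "t = ?t l" by (metis in_set_conv_nth)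
    have "\<not> l < k" using mono[of l k] lo l assms(3) by auto
    moreover have "\<not> Suc k < l" using mono[of "Suc k" l] hi l by auto
    ultimately have "l = k \<or> l = Suc k" by linarith
    then show "z \<in> {on_diag (?t k), on_diag (?t (Suc k))}" using zt l by auto
  qed
qed

lemma U_diag_hd_last:
  assumes "2 \<le> s" "0 < m"
  shows "hd (U_diag s m) = 0" "last (U_diag s m) = real (s * m) - 1" "U_diag s m \<noteq> []"
proof -
  obtain m' where m': "m = Suc m'" using assms by (cases m) auto
  have up: "[0..<s] = 0 # [1..<s]" using assms by (simp add: upt_conv_Cons)
  show "hd (U_diag s m) = 0" unfolding U_diag_def up
    by (simp add: U_ts_def m' upt_conv_Cons del: upt_Suc)
  obtain s' where s': "s = Suc s'" using assms by (cases s) auto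
  have "U_diag s m = concat (map (U_ts s m) [0..<s']) @ U_ts s m s'" unfolding U_diag_def s' by simp
  moreover have ne: "[s' * m..<Suc s' * m] \<noteq> []" using assms by simp
  then have "U_ts s m s' \<noteq> []" "last (U_ts s m s') = real (Suc s' * m - 1)"
    by (auto simp: U_ts_def last_map last_upt)
  ultimately show "last (U_diag s m) = real (s * m) - 1" "U_diag s m \<noteq> []"
    using s' assms by (auto simp: of_nat_diff)
qed

text \<open>Before reaching its end, the segment to the first diagonal vertex stays below the
  half-grid, at negative height, and the segment to the last one stays to its right, with real part
  above \<open>s * m - 1\<close>.\<close>

lemma U_corner_edge_ends:
  assumes "length \<sigma> = s" "2 \<le> s" "t = hd (U_diag s m) \<or> t = last (U_diag s m)"
  shows "closed_segment (Complex (real (s * m)) (-1)) (on_diag t) \<inter> verts (U_embedding \<sigma> m) =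
     {Complex (real (s * m)) (-1), on_diag t}" (is "closed_segment ?c _ \<inter> ?V = _")
proof
  have sp: "0 < s" using assms by simp
  have ne: "U_diag s m \<noteq> []"
  proof -
    have "real (1 * m) - 1 + real 1 / real s \<in> set (U_diag s m)" unfolding set_U_diag using assms(2)
      by (intro UnI1 CollectI exI[of _ 1]) auto
    then show ?thesis by auto
  qed
  then have mem: "t \<in> set (U_diag s m)" using assms(3) by auto
  show "{?c, on_diag t} \<subseteq> closed_segment ?c (on_diag t) \<inter> ?V"
    unfolding U_verts[OF assms(1) sp] using mem by auto
  show "closed_segment ?c (on_diag t) \<inter> ?V \<subseteq> {?c, on_diag t}"
  proof
    fix z assume z: "z \<in> closed_segment ?c (on_diag t) \<inter> ?V"
    then obtain u where u: "0 \<le> u" "u \<le> 1" "z = (1 - u) *\<^sub>R ?c + u *\<^sub>R on_diag t"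
      by (auto simp: in_segment)
    have re: "Re z = (1 - u) * real (s * m) + u * t" and im: "Im z = - (1 - u) + u * t" using u(3) by auto
    from z consider "z = ?c" | t' where "z = on_diag t'" | i j where "z = grid_point i j" "j < i" "i < s * m"
      unfolding U_verts[OF assms(1) sp] by auto
    then show "z \<in> {?c, on_diag t}"
    proof cases
      case 2
      \<comment> \<open>Equating the two coordinates shows that the segment meets the diagonal only
        at its end \<open>u = 1\<close>.\<close>
      then have "(1 - u) * (real (s * m) + 1) = 0" using re im by (simp add: algebra_simps)
      moreover have "real (s * m) + 1 \<noteq> 0" using of_nat_0_le_iff[of "s * m", where 'a = real] by linarith
      ultimately have "u = 1" by simp
      then show ?thesis using u(3) by simp
    next
      case 3
      then have m: "0 < m" by (cases m) auto
      note hl = U_diag_hd_last[OF assms(2) m]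
      have "u = 1"
      proof (rule ccontr)
        assume "u \<noteq> 1" then have u1: "u < 1" using u by simp
        from assms(3) show False
        proof
          assume "t = hd (U_diag s m)"
          then have "Im z < 0" using im hl u1 by simp
          then show False using 3 by (simp add: grid_point_def)
        next
          assume "t = last (U_diag s m)"
          then have "Re z = (1 - u) * real (s * m) + u * (real (s * m) - 1)" using re hl(2) by simp
          then have "Re z = real (s * m) - u" by (simp add: algebra_simps)
          moreover have "Re z \<le> real (s * m) - 1"
          proof -
            have "real i + 1 \<le> real (s * m)" using 3(3) by linarith
            then show ?thesis using 3 by (simp add: grid_point_def)
          qed
          ultimately show False using u1 by simp
        qed
      qed
      then show ?thesis using u(3) by simp
    qed simp
  qed
qed

lemma U_outer_edge_ends:
  assumes "length \<sigma> = s" "2 \<le> s" "{a, b} \<in> cycle_edges (U_outer s m)"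
  shows "closed_segment a b \<in> edges (U_embedding \<sigma> m)"
    "closed_segment a b \<inter> verts (U_embedding \<sigma> m) = {a, b}"
proof -
  let ?vs = "U_outer s m"
  have sp: "0 < s" using assms by simp
  note vs = U_outer_diag[OF sp, of m]
  have ne: "?vs \<noteq> []" unfolding vs by simp
  obtain k where k: "k < length ?vs" "{a, b} = {?vs ! k, ?vs ! (Suc k mod length ?vs)}"
    using assms(3) unfolding cycle_edges_conv_nth[OF ne] by blast
  have seg: "closed_segment a b = closed_segment (?vs ! k) (?vs ! (Suc k mod length ?vs))"
    using k(2) by (auto simp: doubleton_eq_iff closed_segment_commute)
  have "U_outer_edges s m \<subseteq> edges (U_embedding \<sigma> m)" using assms(1) by (auto simp: U_embedding_def Let_def)
  moreover have "closed_segment a b \<in> U_outer_edges s m" unfolding U_outer_edges_def Let_def seg using k(1) by blast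
  ultimately show "closed_segment a b \<in> edges (U_embedding \<sigma> m)" by blast
  have dne: "U_diag s m \<noteq> []"
  proof -
    have "real (1 * m) - 1 + real 1 / real s \<in> set (U_diag s m)" unfolding set_U_diag using assms(2)
      by (intro UnI1 CollectI exI[of _ 1]) auto
    then show ?thesis by auto
  qed
  let ?c = "Complex (real (s * m)) (-1)"
  have "closed_segment (?vs ! k) (?vs ! (Suc k mod length ?vs)) \<inter> verts (U_embedding \<sigma> m) = {?vs ! k, ?vs ! (Suc k mod length ?vs)}"
  proof (cases k)
    case 0
    then have "?vs ! k = ?c" "?vs ! (Suc k mod length ?vs) = on_diag (hd (U_diag s m))"
      using dne unfolding vs by (auto simp: hd_conv_nth)
    then show ?thesis using U_corner_edge_ends[OF assms(1,2)] by simp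
  next
    case (Suc l)
    show ?thesis
    proof (cases "Suc k < length ?vs")
      case True
      then have "Suc l < length (U_diag s m)" using Suc unfolding vs by simp
      moreover have "?vs ! k = on_diag (U_diag s m ! l)" "?vs ! (Suc k mod length ?vs) = on_diag (U_diag s m ! Suc l)"
        using Suc True unfolding vs by auto
      ultimately show ?thesis using U_diag_edge_ends[OF assms(1) sp] by simp
    next
      case False
      then have len: "Suc k = length ?vs" using k(1) by simp
      then have "l = length (U_diag s m) - 1" using Suc unfolding vs by simp
      then have "?vs ! k = on_diag (last (U_diag s m))" using Suc dne unfolding vs by (simp add: last_conv_nth)
      moreover have "?vs ! (Suc k mod length ?vs) = ?c" unfolding len unfolding vs by simp
      ultimately show ?thesis using U_corner_edge_ends[OF assms(1,2), of "last (U_diag s m)" m]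
        by (simp add: closed_segment_commute insert_commute)
    qed
  qed
  then show "closed_segment a b \<inter> verts (U_embedding \<sigma> m) = {a, b}" by (simp only: seg k(2))
qed

lemma U_side:
  assumes "length \<sigma> = s" "2 \<le> s" "i < s"
  shows "side (U_embedding \<sigma> m) i =
     U_corner s m i # map (\<lambda>k. grid_point k k) [i * m..<Suc i * m] @ [U_corner s m (Suc i mod s)]"
proof (rule side_blocks)
  show "outer (U_embedding \<sigma> m) = concat (map (\<lambda>i. U_corner s m i # map (\<lambda>k. grid_point k k) [i * m..<Suc i * m]) [0..<s])"
    using assms(1) by (simp add: U_embedding_def Let_def U_outer_def)
  show "distinct (outer (U_embedding \<sigma> m))"
    using distinct_U_outer[of s m] assms by (simp add: U_embedding_def Let_def)
qed (use assms in \<open>auto simp: U_embedding_def Let_def\<close>)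

lemma U_side_edge:
  assumes "length \<sigma> = s" "2 \<le> s" "i < s" "{a, b} \<in> path_edges (side (U_embedding \<sigma> m) i)"
  shows "closed_segment a b \<in> edges (U_embedding \<sigma> m)"
    "closed_segment a b \<inter> verts (U_embedding \<sigma> m) = {a, b}"
proof -
  have "{a, b} \<in> cycle_edges (U_outer s m)"
    unfolding U_outer_def using assms
    by (subst cycle_edges_blocks) (auto simp: U_side[OF assms(1-3)] simp del: upt_Suc)
  then show "closed_segment a b \<in> edges (U_embedding \<sigma> m)"
    "closed_segment a b \<inter> verts (U_embedding \<sigma> m) = {a, b}"
    using U_outer_edge_ends[OF assms(1,2)] by blast+
qed

lemma grid_point_eq_iff [simp]: "grid_point i j = grid_point i' j' \<longleftrightarrow> i = i' \<and> j = j'"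
  by (simp add: grid_point_def)

lemma grid_point_neq_corner:
  assumes "k < s" "i < s * m" shows "grid_point i j \<noteq> U_corner s m k"
proof
  assume e: "grid_point i j = U_corner s m k"
  have sp: "0 < s" using assms by simp
  show False
  proof (cases "k = 0")
    case True then have "Im (grid_point i j) = -1" using e by (simp add: U_corner_def)
    then show False by (simp add: grid_point_def)
  next
    case False
    have ta: "real (k * m) - 1 + real k / real s = real i"
      using arg_cong[OF e, of Re] False by (simp add: U_corner_def Let_def grid_point_def)
    have fr: "0 < real k / real s" "real k / real s < 1" using assms False sp by (auto simp: field_simps)
    then have "real (k * m) < real i + 1" "real i + 1 < real (k * m) + 1" using ta by linarith+
    then show False using real_nat_gap[of "k * m" "Suc i"] by simp
  qed
qed

section \<open>Words for the sides of a polygon\<close>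

lemma distinct_blocks:
  assumes "distinct (concat (map f [0..<n]))" "i < n"
  shows "distinct (f i)" "j < n \<Longrightarrow> i \<noteq> j \<Longrightarrow> set (f i) \<inter> set (f j) = {}"
proof -
  have "distinct (f i) \<and> (\<forall>j<n. i \<noteq> j \<longrightarrow> set (f i) \<inter> set (f j) = {})"
    using assms
  proof (induction n arbitrary: i)
    case (Suc n)
    have d: "distinct (concat (map f [0..<n]))" "distinct (f n)" and "(\<Union>a\<in>{0..<n}. set (f a)) \<inter> set (f n) = {}"
      using Suc.prems(1) by auto
    then have d3: "\<And>i. i < n \<Longrightarrow> set (f i) \<inter> set (f n) = {}" by fastforce
    show ?case
    proof (cases "i = n")
      case True
      then show ?thesis using d(2) d3 by (auto simp: less_Suc_eq)
    next
      case False
      then have "i < n" using Suc.prems(2) by simp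
      then show ?thesis using Suc.IH[OF d(1), of i] d3[of i] by (auto simp: less_Suc_eq)
    qed
  qed simp
  then show "distinct (f i)" "j < n \<Longrightarrow> i \<noteq> j \<Longrightarrow> set (f i) \<inter> set (f j) = {}" by auto
qed

lemma length_remdups_adj_concat_le:
  "length (remdups_adj (concat (map g ks))) \<le> (\<Sum>k\<leftarrow>ks. length (remdups_adj (g k)))"
proof (induction ks)
  case (Cons k ks)
  then show ?case using length_remdups_adj_append_le[of "g k" "concat (map g ks)"] by simp
qed simp

lemma concat_map_concat: "concat (map f (concat xss)) = concat (map (\<lambda>xs. concat (map f xs)) xss)"
  by (induction xss) auto

text \<open>An \<open>Actual\<close> token stands for a vertex of \<open>P\<close> in its place on the outer cycle. A \<open>Dummy\<close> token
  on side \<open>i\<close> mirrors the symbol that its twin side \<open>t\<close> carries.\<close>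

datatype token = Actual complex | Dummy nat nat "nat + complex"

locale sewn_words =
  fixes P :: "'a polygonal" and c :: "nat \<Rightarrow> complex" and I :: "nat \<Rightarrow> complex list"
    and wd :: "complex \<Rightarrow> complex list" and F :: "complex set set" and M s :: nat
  assumes s: "s = length (signature P)" "2 \<le> s"
    and sig: "is_signature (signature P)"
    and outer: "outer P = concat (map (\<lambda>i. c i # I i) [0..<s])" and dist: "distinct (outer P)"
    and bord: "border P = map c [0..<s]"
    and twin_len: "twin P i j \<Longrightarrow> length (I i) = length (I j)"
    and fin: "finite (verts P)"
    and wd_tree: "v \<in> set (outer P) \<Longrightarrow> tree_word v (wd v)"
    and wd_own: "v \<in> set (outer P) \<Longrightarrow> set (wd v) \<inter> set (outer P) = {v}"
    and wd_pair: "v \<in> set (outer P) \<Longrightarrow> v' \<in> set (outer P) \<Longrightarrow> v \<noteq> v' \<Longrightarrow> set (wd v) \<inter> set (wd v') = {}"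
    and wd_un: "(\<Union>v\<in>set (outer P). set (wd v)) = verts P"
    and wd_corner: "i < s \<Longrightarrow> set (wd (c i)) = {c i}"
    and wd_chords: "chord_word (concat (map wd (outer P))) F {}"
    and F_two: "e \<in> F \<Longrightarrow> \<exists>a b. a \<noteq> b \<and> e = {a, b}"
    and F_corner: "e \<in> F \<Longrightarrow> i < s \<Longrightarrow> c i \<notin> e"
    and bound: "i < s \<Longrightarrow> length (I i) + 2 * card (verts P - set (outer P)) \<le> M"
begin

section \<open>The symbol word shared by twin sides\<close>

definition pos :: "nat \<Rightarrow> bool" where
  "pos i = (case signature P ! i of Pos _ \<Rightarrow> True | Neg _ \<Rightarrow> False)"

definition Len :: "nat \<Rightarrow> nat" where "Len i = length (I i) + 2"

abbreviation Os :: "nat \<Rightarrow> complex list" where "Os \<equiv> oriented_side P"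

definition ts :: "nat \<Rightarrow> nat list" where
  "ts i = filter (\<lambda>t. letter (signature P ! t) = letter (signature P ! i)) [0..<s]"

text \<open>The walk at the \<open>k\<close>-th vertex of side \<open>t\<close>, read along the
  orientation of the side. The root is written as the number \<open>k\<close>, which names different
  vertices on the two twins but a single one after sewing; internal vertices keep their names.
  \<open>lab\<close> turns a symbol back into a vertex.\<close>

definition rw :: "nat \<Rightarrow> nat \<Rightarrow> (nat + complex) list" where
  "rw t k = (let v = Os t ! k; w = map (\<lambda>z. if z = v then Inl k else Inr z) (wd v) in if pos t then w else rev w)"

definition lab :: "nat \<Rightarrow> nat + complex \<Rightarrow> complex" where
  "lab i y = (case y of Inl k \<Rightarrow> Os i ! k | Inr u \<Rightarrow> u)"

definition PL :: "nat \<Rightarrow> (nat \<times> nat) list" where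
  "PL i = List.product [1..<Len i - 1] (ts i)"

text \<open>At each interior place the walks of both twins follow each other, tagged by the twin
  they come from. The list depends on the pair only, so both twins get the same one.\<close>

definition YP :: "nat \<Rightarrow> (nat \<times> (nat + complex)) list" where
  "YP i = concat (map (\<lambda>(k, t). map (Pair t) (rw t k)) (PL i))"

definition Y :: "nat \<Rightarrow> (nat + complex) list" where "Y i = map snd (YP i)"

definition pad :: "nat \<Rightarrow> nat" where "pad i = M - length (remdups_adj (Y i))"

text \<open>A side of the target has exactly \<open>M + 2\<close> vertices. The surplus is filled by
  repeating the first corner, which merely enlarges the branch set of that corner.\<close>

definition X :: "nat \<Rightarrow> (nat + complex) list" where
  "X i = replicate (Suc (pad i)) (Inl 0) @ remdups_adj (Y i) @ [Inl (Len i - 1)]"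

lemma side_eq: "i < s \<Longrightarrow> side P i = c i # I i @ [c (Suc i mod s)]"
  by (rule side_blocks[OF outer bord dist _ s(2)])

lemma Os_eq: "Os i = (if pos i then side P i else rev (side P i))"
  by (simp add: oriented_side_def pos_def split: symbol.split)

lemma length_Os: "i < s \<Longrightarrow> length (Os i) = Len i"
  by (simp add: length_oriented_side side_eq Len_def)

lemma blocks: "i < s \<Longrightarrow> distinct (c i # I i)"
  "i < s \<Longrightarrow> j < s \<Longrightarrow> i \<noteq> j \<Longrightarrow> set (c i # I i) \<inter> set (c j # I j) = {}"
  using distinct_blocks[OF dist[unfolded outer]] by blast+

lemma set_outer: "set (outer P) = (\<Union>i<s. set (c i # I i))"
  unfolding outer by auto

lemma c_inj: "i < s \<Longrightarrow> j < s \<Longrightarrow> c i = c j \<Longrightarrow> i = j"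
  using blocks(2)[of i j] by auto

lemma c_outer: "i < s \<Longrightarrow> c i \<in> set (outer P)" unfolding set_outer by auto

lemma Suc_mod: "i < s \<Longrightarrow> Suc i mod s < s \<and> Suc i mod s \<noteq> i"
  using s(2) by (cases "Suc i = s") auto

lemma distinct_side: assumes "i < s" shows "distinct (side P i)"
proof -
  have "c (Suc i mod s) \<notin> set (c i # I i)" using blocks(2)[OF assms, of "Suc i mod s"] Suc_mod[OF assms] by auto
  then show ?thesis using blocks(1)[OF assms] side_eq[OF assms] by auto
qed

lemma distinct_Os: "i < s \<Longrightarrow> distinct (Os i)"
  using distinct_side by (simp add: Os_eq)

lemma set_Os: "i < s \<Longrightarrow> set (Os i) \<subseteq> set (outer P)"
  using c_outer[of "Suc i mod s"] Suc_mod[of i] by (auto simp: Os_eq side_eq set_outer)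

lemma map_Os_interior: assumes "i < s"
  shows "map (\<lambda>k. Os i ! k) (if pos i then [1..<Len i - 1] else rev [1..<Len i - 1]) = I i"
proof (rule nth_equalityI)
  have "length [1..<Len i - 1] = length (I i)" unfolding length_upt by (simp add: Len_def)
  then show "length (map (\<lambda>k. Os i ! k) (if pos i then [1..<Len i - 1] else rev [1..<Len i - 1])) = length (I i)"
    by (simp del: length_upt)
  fix j assume "j < length (map (\<lambda>k. Os i ! k) (if pos i then [1..<Len i - 1] else rev [1..<Len i - 1]))"
  then have j: "j < length (I i)" by (cases "I i") (simp_all add: Len_def split: if_splits)
  have sj: "side P i ! Suc j = I i ! j" using j by (simp add: side_eq[OF assms] nth_append)
  show "map (\<lambda>k. Os i ! k) (if pos i then [1..<Len i - 1] else rev [1..<Len i - 1]) ! j = I i ! j"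
  proof (cases "pos i")
    case True
    have "[1..<Len i - 1] ! j = Suc j" using j by (subst nth_upt) (auto simp: Len_def)
    moreover have "j < length [1..<Len i - 1]" using j by (simp add: Len_def del: upt_Suc)
    ultimately show ?thesis using True sj by (simp add: Os_eq del: upt_Suc)
  next
    case False
    have len: "length (side P i) = length (I i) + 2" by (simp add: side_eq[OF assms])
    have jl: "j < length [1..<Len i - 1]" using j by (simp add: Len_def del: upt_Suc)
    then have "rev [1..<Len i - 1] ! j = length (I i) - j" using j
      by (subst rev_nth) (auto simp: Len_def simp del: upt_Suc)
    moreover have "rev (side P i) ! (length (I i) - j) = side P i ! Suc j"
      using j len by (subst rev_nth) auto
    ultimately show ?thesis using False sj jl by (simp add: Os_eq del: upt_Suc)
  qed
qed

lemma Os_interior: assumes "i < s" "1 \<le> k" "k < Len i - 1" shows "Os i ! k \<in> set (I i)"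
proof -
  have "Os i ! k \<in> set (map (\<lambda>k. Os i ! k) (if pos i then [1..<Len i - 1] else rev [1..<Len i - 1]))"
    using assms by auto
  then show ?thesis unfolding map_Os_interior[OF assms(1)] .
qed

lemma Os_inj:
  assumes "i < s" "1 \<le> k" "k < Len i - 1" "i' < s" "1 \<le> k'" "k' < Len i' - 1" "Os i ! k = Os i' ! k'"
  shows "i = i' \<and> k = k'"
proof -
  have i: "i = i'" using Os_interior[OF assms(1-3)] Os_interior[OF assms(4-6)] blocks(2)[OF assms(1,4)] assms(7) by auto
  have "k < length (Os i)" "k' < length (Os i)" using assms(3,6) length_Os[OF assms(1)] i by auto
  then have "k = k'" using nth_eq_iff_index_eq[OF distinct_Os[OF assms(1)]] assms(7) i by blast
  then show ?thesis using i by simp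
qed

lemma Os_first: "i < s \<Longrightarrow> Os i ! 0 = (if pos i then c i else c (Suc i mod s))"
  by (simp add: Os_eq side_eq)

lemma Os_last: "i < s \<Longrightarrow> Os i ! (Len i - 1) = (if pos i then c (Suc i mod s) else c i)"
  by (simp add: Os_eq side_eq Len_def rev_nth nth_append)

lemma ts_props: assumes "i < s"
  shows "\<exists>t1 t2. ts i = [t1, t2] \<and> t1 \<noteq> t2 \<and> i \<in> {t1, t2} \<and> t1 < s \<and> t2 < s"
proof -
  let ?a = "letter (signature P ! i)" and ?\<sigma> = "signature P"
  have "?a \<in> letter ` set ?\<sigma>" using assms s by auto
  then have "count_list (map letter ?\<sigma>) ?a = 2" using sig by (auto simp: is_signature_def)
  moreover have "map letter ?\<sigma> = map (\<lambda>t. letter (?\<sigma> ! t)) [0..<s]"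
    by (rule nth_equalityI) (auto simp: s(1))
  ultimately have "count_list (map (\<lambda>t. letter (?\<sigma> ! t)) [0..<s]) ?a = 2" by simp
  moreover have "ts i = filter (\<lambda>t. ?a = letter (?\<sigma> ! t)) [0..<s]"
    unfolding ts_def by (rule filter_cong) auto
  ultimately have "length (ts i) = 2"
    by (simp add: count_list_eq_length_filter filter_map comp_def)
  then obtain t1 t2 where t: "ts i = [t1, t2]" by (auto simp: numeral_2_eq_2 length_Suc_conv)
  moreover have "distinct (ts i)" "i \<in> set (ts i)" "set (ts i) \<subseteq> {..<s}" using assms by (auto simp: ts_def)
  ultimately show ?thesis by auto
qed

lemma ts_twin: "i < s \<Longrightarrow> t \<in> set (ts i) \<Longrightarrow> t < s \<and> (t = i \<or> twin P i t) \<and> ts t = ts i \<and> Len t = Len i"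
  using twin_len[of i t] by (cases "i = t") (auto simp: ts_def twin_def Len_def s(1)[symmetric])

lemma twin_ts: "twin P i j \<Longrightarrow> i < s \<and> j < s \<and> ts i = ts j \<and> Len i = Len j \<and> j \<in> set (ts i) \<and> i \<in> set (ts j)"
  using twin_len[of i j] by (auto simp: ts_def twin_def Len_def s(1)[symmetric])

lemma twin_same: assumes "twin P i j" shows "YP i = YP j" "Y i = Y j" "X i = X j" "pad i = pad j"
  using twin_ts[OF assms] by (auto simp: YP_def PL_def Y_def X_def pad_def)

lemma PL_mem: "i < s \<Longrightarrow> (k, t) \<in> set (PL i) \<Longrightarrow> t \<in> set (ts i) \<and> t < s \<and> 1 \<le> k \<and> k < Len t - 1"
  using ts_twin[of i t] by (auto simp: PL_def)

lemma rw_root_outer: "t < s \<Longrightarrow> 1 \<le> k \<Longrightarrow> k < Len t - 1 \<Longrightarrow> Os t ! k \<in> set (outer P)"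
  using Os_interior[of t k] by (auto simp: set_outer)

lemma tree_word_rw:
  assumes "t < s" "1 \<le> k" "k < Len t - 1"
  shows "tree_word (Inl k) (rw t k)"
proof -
  let ?v = "Os t ! k" and ?h = "\<lambda>z. if z = Os t ! k then Inl k else Inr z"
  have "tree_word (?h ?v) (map ?h (wd ?v))"
    by (rule tree_word_map[OF wd_tree[OF rw_root_outer[OF assms]]]) (auto simp: inj_on_def)
  then show ?thesis using tree_word_rev by (auto simp: rw_def Let_def)
qed

lemma set_rw:
  assumes "t < s" "1 \<le> k" "k < Len t - 1"
  shows "set (rw t k) = insert (Inl k) (Inr ` (set (wd (Os t ! k)) - {Os t ! k}))"
  using tree_word_root[OF wd_tree[OF rw_root_outer[OF assms]]]
  by (auto simp: rw_def Let_def)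

lemma map_lab_rw: "map (lab t) (rw t k) = (if pos t then wd (Os t ! k) else rev (wd (Os t ! k)))"
proof -
  have "map (lab t) (map (\<lambda>z. if z = Os t ! k then Inl k else Inr z) (wd (Os t ! k))) = wd (Os t ! k)"
    unfolding map_map by (rule map_idI) (simp add: lab_def)
  then show ?thesis unfolding rw_def Let_def by (simp only: rev_map[symmetric] split: if_split) simp
qed

definition inner :: "complex set" where "inner = verts P - set (outer P)"

definition own :: "nat \<Rightarrow> nat \<Rightarrow> complex set" where "own t k = set (wd (Os t ! k)) - {Os t ! k}"

lemma own_inner: assumes "t < s" "1 \<le> k" "k < Len t - 1" shows "own t k \<subseteq> inner"
  using wd_own[OF rw_root_outer[OF assms]] wd_un rw_root_outer[OF assms] unfolding own_def inner_def by blast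

lemma own_disjoint:
  assumes "t < s" "1 \<le> k" "k < Len t - 1" "t' < s" "1 \<le> k'" "k' < Len t' - 1" "(t, k) \<noteq> (t', k')"
  shows "own t k \<inter> own t' k' = {}"
proof -
  have "Os t ! k \<noteq> Os t' ! k'" using Os_inj[OF assms(1-6)] assms(7) by auto
  then show ?thesis using wd_pair[OF rw_root_outer[OF assms(1-3)] rw_root_outer[OF assms(4-6)]] by (auto simp: own_def)
qed

lemma Y_concat: assumes "i < s" "ts i = [t1, t2]"
  shows "Y i = concat (map (\<lambda>k. rw t1 k @ rw t2 k) [1..<Len i - 1])"
proof -
  have "Y i = concat (map (\<lambda>(k, t). rw t k) (PL i))"
    by (simp add: Y_def YP_def map_concat comp_def case_prod_unfold)
  also have "\<dots> = concat (map (\<lambda>k. rw t1 k @ rw t2 k) [1..<Len i - 1])"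
  proof -
    have "concat (map (\<lambda>(k, t). rw t k) (List.product ks [t1, t2])) = concat (map (\<lambda>k. rw t1 k @ rw t2 k) ks)" for ks
      by (induction ks) auto
    then show ?thesis unfolding PL_def assms(2) .
  qed
  finally show ?thesis .
qed

lemma finite_inner: "finite inner" using fin by (simp add: inner_def)

text \<open>At one place the walks of both twins join to a single tree word with root
  \<open>k\<close>, of length at most one plus twice the number of its internal vertices. All these
  vertices are distinct over all places and both twins, so the second terms sum up to at most
  \<open>2 * card inner\<close>.\<close>

lemma length_Y: assumes i: "i < s" shows "length (remdups_adj (Y i)) \<le> M"
proof -
  obtain t1 t2 where t: "ts i = [t1, t2]" "t1 \<noteq> t2" "t1 < s" "t2 < s" using ts_props[OF i] by auto
  have Len: "Len t1 = Len i" "Len t2 = Len i" using ts_twin[OF i] t by auto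
  let ?g = "\<lambda>k. rw t1 k @ rw t2 k" and ?S = "\<lambda>k. own t1 k \<union> own t2 k"
  have each: "length (remdups_adj (?g k)) \<le> 1 + 2 * card (?S k)" if k: "1 \<le> k" "k < Len i - 1" for k
  proof -
    have k1: "1 \<le> k" "k < Len t1 - 1" and k2: "1 \<le> k" "k < Len t2 - 1" using k Len by auto
    note st = set_rw[OF t(3) k1, folded own_def] set_rw[OF t(4) k2, folded own_def]
    have "own t1 k \<inter> own t2 k = {}" using own_disjoint[OF t(3) k1 t(4) k2] t(2) by simp
    then have "set (rw t1 k) \<inter> set (rw t2 k) \<subseteq> {Inl k}" unfolding st by auto
    then have "tree_word (Inl k) (?g k)" by (rule tree_word.join[OF tree_word_rw[OF t(3) k1] tree_word_rw[OF t(4) k2]])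
    then have "length (remdups_adj (?g k)) + 1 \<le> 2 * card (set (?g k))" by (rule tree_word_length)
    moreover have "set (?g k) = insert (Inl k) (Inr ` ?S k)" unfolding set_append st by auto
    moreover have "finite (?S k)" using own_inner[OF t(3) k1] own_inner[OF t(4) k2] finite_inner by (meson finite_Un finite_subset)
    then have "card (insert (Inl k) (Inr ` ?S k)) = Suc (card (?S k))"
      by (subst card_insert_disjoint) (auto simp: card_image)
    ultimately show ?thesis by simp
  qed
  have "length (remdups_adj (Y i)) \<le> (\<Sum>k\<leftarrow>[1..<Len i - 1]. length (remdups_adj (?g k)))"
    unfolding Y_concat[OF i t(1)] by (rule length_remdups_adj_concat_le)
  also have "\<dots> \<le> (\<Sum>k\<leftarrow>[1..<Len i - 1]. 1 + 2 * card (?S k))"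
    by (rule sum_list_mono) (use each in auto)
  also have "\<dots> = (\<Sum>k\<in>{1..<Len i - 1}. 1 + 2 * card (?S k))"
    by (simp add: sum_list_distinct_conv_sum_set)
  also have "\<dots> = length (I i) + 2 * (\<Sum>k\<in>{1..<Len i - 1}. card (?S k))"
    by (simp only: sum.distrib sum_distrib_left[symmetric]) (simp add: Len_def)
  also have "(\<Sum>k\<in>{1..<Len i - 1}. card (?S k)) = card (\<Union>k\<in>{1..<Len i - 1}. ?S k)"
  proof (rule card_UN_disjoint[symmetric])
    show "\<forall>k\<in>{1..<Len i - 1}. finite (?S k)"
      using own_inner[OF t(3)] own_inner[OF t(4)] Len finite_inner by (metis atLeastLessThan_iff finite_Un finite_subset)
    show "\<forall>k\<in>{1..<Len i - 1}. \<forall>k'\<in>{1..<Len i - 1}. k \<noteq> k' \<longrightarrow> ?S k \<inter> ?S k' = {}"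
    proof (intro ballI impI)
      fix k k' assume k: "k \<in> {1..<Len i - 1}" "k' \<in> {1..<Len i - 1}" "k \<noteq> k'"
      have "own a k \<inter> own b k' = {}" if "a \<in> {t1, t2}" "b \<in> {t1, t2}" for a b
        using that k t Len by (intro own_disjoint) auto
      then show "?S k \<inter> ?S k' = {}" by blast
    qed
  qed simp
  also have "card (\<Union>k\<in>{1..<Len i - 1}. ?S k) \<le> card inner"
  proof (rule card_mono[OF finite_inner])
    show "(\<Union>k\<in>{1..<Len i - 1}. ?S k) \<subseteq> inner"
      using own_inner[OF t(3)] own_inner[OF t(4)] Len by fastforce
  qed
  finally have "length (remdups_adj (Y i)) \<le> length (I i) + 2 * card inner" by simp
  then show ?thesis using bound[OF i] unfolding inner_def by linarith
qed

section \<open>Positions of the symbols on the diagonal\<close>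

lemma length_X: "i < s \<Longrightarrow> length (X i) = M + 2"
  using length_Y[of i] by (simp add: X_def pad_def)

lemma X_first: "X i ! 0 = Inl 0" by (simp add: X_def)

lemma X_last: "i < s \<Longrightarrow> X i ! Suc M = Inl (Len i - 1)"
  using nth_append_length[of "replicate (Suc (pad i)) (Inl 0) @ remdups_adj (Y i)" "Inl (Len i - 1)" "[]"] length_X[of i]
  by (simp add: X_def)

text \<open>The monotone map that \<open>remdups_adj_altdef\<close> provides: from a position in
  \<open>Y i\<close> to the position of its letter after merging. A chosen function is needed
  because several positions collapse to one.\<close>

definition fm :: "nat \<Rightarrow> nat \<Rightarrow> nat" where
  "fm i = (SOME f. mono f \<and> f ` {0 ..< size (Y i)} = {0 ..< size (remdups_adj (Y i))}
    \<and> (\<forall>b < size (Y i). Y i ! b = remdups_adj (Y i) ! (f b))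
    \<and> (\<forall>b. b + 1 < size (Y i) \<longrightarrow> (Y i ! b = Y i ! (b+1) \<longleftrightarrow> f b = f(b+1))))"

lemma fm: "mono (fm i)" "fm i ` {0 ..< size (Y i)} = {0 ..< size (remdups_adj (Y i))}"
    "\<And>b. b < size (Y i) \<Longrightarrow> Y i ! b = remdups_adj (Y i) ! (fm i b)"
    "\<And>b. b + 1 < size (Y i) \<Longrightarrow> (Y i ! b = Y i ! (b+1) \<longleftrightarrow> fm i b = fm i (b+1))"
proof -
  have *: "mono (fm i) \<and> fm i ` {0 ..< size (Y i)} = {0 ..< size (remdups_adj (Y i))}
    \<and> (\<forall>b < size (Y i). Y i ! b = remdups_adj (Y i) ! (fm i b))
    \<and> (\<forall>b. b + 1 < size (Y i) \<longrightarrow> (Y i ! b = Y i ! (b+1) \<longleftrightarrow> fm i b = fm i (b+1)))"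
    using someI_ex[OF remdups_adj_altdef[of "Y i" "remdups_adj (Y i)", THEN iffD1, OF refl], folded fm_def] .
  show "mono (fm i)" "fm i ` {0 ..< size (Y i)} = {0 ..< size (remdups_adj (Y i))}"
    "\<And>b. b < size (Y i) \<Longrightarrow> Y i ! b = remdups_adj (Y i) ! (fm i b)"
    "\<And>b. b + 1 < size (Y i) \<Longrightarrow> (Y i ! b = Y i ! (b+1) \<longleftrightarrow> fm i b = fm i (b+1))"
    using * by blast+
qed

definition tgt :: "nat \<Rightarrow> nat \<Rightarrow> nat" where "tgt i b = Suc (pad i) + fm i b"

lemma length_YP: "length (YP i) = length (Y i)" by (simp add: Y_def)

lemma tgt_props: assumes "i < s" "b < length (Y i)"
  shows "1 \<le> tgt i b" "tgt i b \<le> M" "X i ! tgt i b = Y i ! b"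
proof -
  have f: "fm i b < length (remdups_adj (Y i))" using fm(2)[of i] assms(2) by (metis atLeastLessThan_iff imageI le0)
  then show "1 \<le> tgt i b" "tgt i b \<le> M" using length_Y[OF assms(1)] by (auto simp: tgt_def pad_def)
  show "X i ! tgt i b = Y i ! b"
    using f fm(3)[OF assms(2)] by (simp add: X_def tgt_def nth_append)
qed

lemma tgt_surj: assumes "i < s" "Suc (pad i) \<le> q" "q \<le> M" shows "\<exists>b<length (Y i). tgt i b = q"
proof -
  have "q - Suc (pad i) \<in> {0 ..< size (remdups_adj (Y i))}" using assms length_Y[OF assms(1)] by (auto simp: pad_def)
  then obtain b where "b < size (Y i)" "fm i b = q - Suc (pad i)" using fm(2)[of i] by (metis (no_types, lifting) atLeastLessThan_iff imageE)
  then show ?thesis using assms by (intro exI[of _ b]) (auto simp: tgt_def)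
qed

lemma X_pad: "q \<le> pad i \<Longrightarrow> X i ! q = Inl 0"
  by (simp add: X_def nth_append del: replicate_Suc)

text \<open>Converts positions along the orientation of a side into clockwise ones; on
  \<open>0\<close> to \<open>Suc M\<close> it is its own inverse.\<close>

definition cwi :: "nat \<Rightarrow> nat \<Rightarrow> nat" where "cwi i q = (if pos i then q else Suc M - q)"

text \<open>Position \<open>0\<close> of a side is its corner, which has no index on the diagonal;
  hence the shift by one.\<close>

definition dg :: "nat \<Rightarrow> nat \<Rightarrow> nat" where "dg i q = i * M + cwi i q - 1"

definition labd :: "nat \<Rightarrow> complex" where
  "labd g = lab (g div M) (X (g div M) ! cwi (g div M) (Suc (g mod M)))"

lemma dg_props: assumes "i < s" "1 \<le> q" "q \<le> M"
  shows "dg i q div M = i" "dg i q < s * M" "labd (dg i q) = lab i (X i ! q)"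
    "i * M \<le> dg i q" "dg i q < Suc i * M" "cwi i q = Suc (dg i q mod M)"
proof -
  have c: "1 \<le> cwi i q" "cwi i q \<le> M" using assms by (auto simp: cwi_def)
  then have d: "dg i q = i * M + (cwi i q - 1)" "cwi i q - 1 < M" using assms by (auto simp: dg_def)
  then show 1: "dg i q div M = i" by simp
  have m: "dg i q mod M = cwi i q - 1" using d by simp
  then show "cwi i q = Suc (dg i q mod M)" using c by simp
  have cc: "cwi i (cwi i q) = q" using assms by (auto simp: cwi_def)
  show "labd (dg i q) = lab i (X i ! q)" using 1 m c cc by (simp add: labd_def)
  show "i * M \<le> dg i q" "dg i q < Suc i * M" using d by auto
  then show "dg i q < s * M" using mult_le_mono1[of "Suc i" s M] assms(1) by linarith
qed

section \<open>The token word around the whole boundary\<close>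

fun tok :: "nat \<Rightarrow> nat \<times> (nat + complex) \<Rightarrow> token" where
  "tok i (t, y) = (if t = i then Actual (lab i y) else Dummy i t y)"

text \<open>Tokens are listed before doubled letters are merged, so several may share an index.
  Chords are found between tokens first and projected to the diagonal afterwards.\<close>

definition ES :: "nat \<Rightarrow> (token \<times> nat) list" where
  "ES i = map (\<lambda>b. (tok i (YP i ! b), dg i (tgt i b))) [0..<length (YP i)]"

text \<open>Corner tokens get the index \<open>i * M\<close> only to keep the indices sorted; chords
  that end in such tokens are discarded in the projection.\<close>

definition BB :: "nat \<Rightarrow> (token \<times> nat) list" where
  "BB i = map (\<lambda>z. (Actual z, i * M)) (wd (c i)) @ (if pos i then ES i else rev (ES i))"

definition BW :: "(token \<times> nat) list" where
  "BW = concat (map BB [0..<s])"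

lemma BB_range: assumes "i < s" "(z, g) \<in> set (BB i)" shows "i * M \<le> g" "g \<le> Suc i * M"
proof -
  have "i * M \<le> g \<and> g \<le> Suc i * M"
  proof (cases "(z, g) \<in> set (ES i)")
    case True
    then obtain b where b: "b < length (Y i)" "g = dg i (tgt i b)" by (auto simp: ES_def length_YP)
    then show ?thesis using dg_props(4,5)[OF assms(1) tgt_props(1,2)[OF assms(1) b(1)]] by simp
  next
    case False
    then show ?thesis using assms by (auto simp: BB_def split: if_splits)
  qed
  then show "i * M \<le> g" "g \<le> Suc i * M" by auto
qed

lemma sorted_BB: assumes "i < s" shows "sorted (map snd (BB i))"
proof -
  have mono: "tgt i b \<le> tgt i b'" if "b \<le> b'" for b b' using fm(1)[of i] that by (auto simp: tgt_def mono_def)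
  have msnd: "map snd (ES i) = map (\<lambda>b. dg i (tgt i b)) [0..<length (YP i)]" by (simp add: ES_def comp_def)
  have "sorted (map snd (if pos i then ES i else rev (ES i)))"
  proof (cases "pos i")
    case True
    then show ?thesis unfolding if_P[OF True] msnd
      by (auto simp: sorted_iff_nth_mono dg_def cwi_def intro!: diff_le_mono add_left_mono mono)
  next
    case False
    have "sorted_wrt (\<ge>) (map (\<lambda>b. dg i (tgt i b)) [0..<length (YP i)])"
      using False by (auto simp: sorted_wrt_iff_nth_less dg_def cwi_def intro!: diff_le_mono add_left_mono diff_le_mono2 mono)
    then have "sorted (rev (map (\<lambda>b. dg i (tgt i b)) [0..<length (YP i)]))" by (simp add: sorted_wrt_rev)
    then show ?thesis unfolding if_not_P[OF False] rev_map[symmetric] msnd .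
  qed
  moreover have "i * M \<le> g" if "g \<in> snd ` set (ES i)" for g
    using that BB_range(1)[OF assms] by (fastforce simp: BB_def split: if_splits)
  moreover have "sorted (map (\<lambda>x. i * M) (wd (c i)))" by (simp add: sorted_iff_nth_mono)
  ultimately show ?thesis by (auto simp: BB_def sorted_append comp_def)
qed

lemma sorted_BW: "sorted (map snd BW)"
proof -
  have "sorted (map snd (concat (map BB [0..<n])))" if "n \<le> s" for n
    using that
  proof (induction n)
    case (Suc n)
    have "g \<le> h" if g: "g \<in> snd ` set (concat (map BB [0..<n]))" and h: "h \<in> snd ` set (BB n)" for g h
    proof -
      obtain i z where i: "i < n" "(z, g) \<in> set (BB i)" using g by auto
      obtain z' where z': "(z', h) \<in> set (BB n)" using h by auto
      have "g \<le> Suc i * M" using BB_range(2)[OF _ i(2)] i Suc.prems by simp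
      also have "\<dots> \<le> n * M" using i(1) by (intro mult_le_mono1) simp
      also have "\<dots> \<le> h" using BB_range(1)[OF _ z'] Suc.prems by simp
      finally show ?thesis .
    qed
    then show ?case using Suc sorted_BB[of n] by (auto simp: sorted_append)
  qed simp
  then show ?thesis by (simp add: BW_def)
qed

text \<open>A triple \<open>(i, k, t)\<close> stands for the walk at place \<open>k\<close> of side
  \<open>t\<close>, as it is carried by side \<open>i\<close>: an actual walk if
  \<open>t = i\<close>, a mirrored one otherwise. The number \<open>0\<close> marks the corner that
  opens the block.\<close>

definition pieces :: "nat \<Rightarrow> (nat \<times> nat \<times> nat) list" where
  "pieces i = (i, 0, i) # map (Pair i) (if pos i then PL i else rev (PL i))"

fun pw :: "nat \<times> nat \<times> nat \<Rightarrow> token list" where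
  "pw (i, k, t) = (if k = 0 then map Actual (wd (c i))
     else (let w = map (\<lambda>y. tok i (t, y)) (rw t k) in if pos i then w else rev w))"

lemma PL_pos: "(k, t) \<in> set (PL i) \<Longrightarrow> 0 < k" by (auto simp: PL_def)

lemma fst_BB: "map fst (BB i) = concat (map pw (pieces i))"
proof -
  have ES: "map fst (ES i) = map (tok i) (YP i)"
  proof -
    have "map fst (ES i) = map (\<lambda>b. tok i (YP i ! b)) [0..<length (YP i)]" by (simp add: ES_def comp_def)
    also have "\<dots> = map (tok i) (map (\<lambda>b. YP i ! b) [0..<length (YP i)])" by simp
    also have "\<dots> = map (tok i) (YP i)" by (simp only: map_nth)
    finally show ?thesis .
  qed
  have Y: "map (tok i) (YP i) = concat (map (\<lambda>(k, t). map (\<lambda>y. tok i (t, y)) (rw t k)) (PL i))"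
    by (simp add: YP_def map_concat comp_def case_prod_unfold del: tok.simps)
  have tl: "map fst (if pos i then ES i else rev (ES i)) = concat (map pw (map (Pair i) (if pos i then PL i else rev (PL i))))"
  proof (cases "pos i")
    case True
    have "map (\<lambda>(k, t). map (\<lambda>y. tok i (t, y)) (rw t k)) (PL i) = map pw (map (Pair i) (PL i))"
      using True by (auto simp: Let_def simp del: tok.simps dest: PL_pos)
    then show ?thesis unfolding if_P[OF True] ES Y by (simp only:)
  next
    case False
    have "map (\<lambda>x. rev ((\<lambda>(k, t). map (\<lambda>y. tok i (t, y)) (rw t k)) x)) (rev (PL i)) = map pw (map (Pair i) (rev (PL i)))"
      using False by (auto simp: Let_def simp del: tok.simps dest: PL_pos)
    moreover have "rev (map (tok i) (YP i)) = concat (map (\<lambda>x. rev ((\<lambda>(k, t). map (\<lambda>y. tok i (t, y)) (rw t k)) x)) (rev (PL i)))"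
      unfolding Y rev_concat by (simp add: rev_map comp_def del: tok.simps)
    ultimately show ?thesis unfolding if_not_P[OF False] rev_map[symmetric] ES by (simp only:)
  qed
  show ?thesis unfolding BB_def map_append tl pieces_def by (simp add: comp_def)
qed

text \<open>On a negative side the reversals of the list and of each piece undo those in
  \<open>Os\<close> and \<open>rw\<close>, so the actual pieces read clockwise again.\<close>

lemma actual_pieces: assumes "i < s"
  shows "concat (map pw (filter (\<lambda>(i, k, t). t = i) (pieces i))) = map Actual (concat (map wd (c i # I i)))"
proof -
  obtain t1 t2 where t: "ts i = [t1, t2]" "t1 \<noteq> t2" "i \<in> {t1, t2}" using ts_props[OF assms] by auto
  have fPL: "filter (\<lambda>(k, t). t = i) (PL i) = map (\<lambda>k. (k, i)) [1..<Len i - 1]"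
  proof -
    have "filter (\<lambda>(k, t). t = i) (List.product ks [t1, t2]) = map (\<lambda>k. (k, i)) ks" for ks
      by (induction ks) (use t in auto)
    then show ?thesis unfolding PL_def t(1) .
  qed
  let ?ks = "if pos i then [1..<Len i - 1] else rev [1..<Len i - 1]"
  have "filter (\<lambda>(i, k, t). t = i) (map (Pair i) (if pos i then PL i else rev (PL i))) =
     map (Pair i) (if pos i then filter (\<lambda>(k, t). t = i) (PL i) else rev (filter (\<lambda>(k, t). t = i) (PL i)))"
    by (simp add: filter_map comp_def rev_filter case_prod_unfold)
  also have "\<dots> = map (\<lambda>k. (i, k, i)) ?ks" unfolding fPL by (simp add: rev_map)
  finally have f: "filter (\<lambda>(i, k, t). t = i) (pieces i) = (i, 0, i) # map (\<lambda>k. (i, k, i)) ?ks"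
    by (simp add: pieces_def)
  have "pw (i, k, i) = map Actual (wd (Os i ! k))" if "k \<in> set ?ks" for k
  proof -
    have k: "k \<noteq> 0" using that by (auto split: if_splits)
    have "map (\<lambda>y. tok i (i, y)) (rw i k) = map Actual (map (lab i) (rw i k))" by simp
    then show ?thesis unfolding map_lab_rw using k by (simp add: Let_def rev_map del: tok.simps)
  qed
  then have "map pw (map (\<lambda>k. (i, k, i)) ?ks) = map (\<lambda>k. map Actual (wd (Os i ! k))) ?ks" by simp
  also have "\<dots> = map (\<lambda>v. map Actual (wd v)) (map (\<lambda>k. Os i ! k) ?ks)" by simp
  also have "\<dots> = map (\<lambda>v. map Actual (wd v)) (I i)" unfolding map_Os_interior[OF assms] ..
  finally have m: "map pw (map (\<lambda>k. (i, k, i)) ?ks) = map (\<lambda>v. map Actual (wd v)) (I i)" .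
  have "map pw ((i, 0, i) # map (\<lambda>k. (i, k, i)) ?ks) = map (\<lambda>v. map Actual (wd v)) (c i # I i)"
    unfolding list.map(2)[of pw] m by simp
  then show ?thesis unfolding f by (simp add: map_concat comp_def)
qed

definition all_pieces :: "(nat \<times> nat \<times> nat) list" where
  "all_pieces = concat (map pieces [0..<s])"

lemma pieces_mem: "(i, k, t) \<in> set all_pieces \<Longrightarrow> t \<noteq> i \<Longrightarrow> i < s \<and> (k, t) \<in> set (PL i) \<and> 1 \<le> k \<and> k < Len t - 1 \<and> t < s"
  using PL_mem[of i k t] by (auto simp: all_pieces_def pieces_def split: if_splits)

lemma distinct_pieces: "distinct all_pieces"
proof -
  have "distinct (pieces i)" if i: "i < s" for i
  proof -
    obtain t1 t2 where t: "ts i = [t1, t2]" "t1 \<noteq> t2" using ts_props[OF i] by auto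
    then have "distinct (PL i)" unfolding PL_def by (intro distinct_product) auto
    then show ?thesis using PL_pos[of 0 _ i] by (auto simp: pieces_def distinct_map inj_on_def)
  qed
  then have "distinct (concat (map pieces [0..<n]))" if "n \<le> s" for n
    using that
  proof (induction n)
    case (Suc n)
    have "set (concat (map pieces [0..<n])) \<inter> set (pieces n) = {}" by (auto simp: pieces_def split: if_splits)
    then show ?case using Suc by auto
  qed simp
  then show ?thesis by (simp add: all_pieces_def)
qed

lemma pw_dummy:
  assumes "(i, k, t) \<in> set all_pieces" "t \<noteq> i"
  shows "set (pw (i, k, t)) = Dummy i t ` set (rw t k)" "chord_word (pw (i, k, t)) {} (set (pw (i, k, t)))"
proof -
  have m: "1 \<le> k" "k < Len t - 1" "t < s" using pieces_mem[OF assms] by auto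
  show "set (pw (i, k, t)) = Dummy i t ` set (rw t k)" using assms(2) m by (auto simp: Let_def)
  have "tree_word (Dummy i t (Inl k)) (map (Dummy i t) (rw t k))"
    by (rule tree_word_map[OF tree_word_rw[OF m(3,1,2)]]) (simp add: inj_on_def)
  moreover have "pw (i, k, t) = (if pos i then map (Dummy i t) (rw t k) else rev (map (Dummy i t) (rw t k)))"
    using m assms(2) by (simp add: Let_def)
  ultimately have "tree_word (Dummy i t (Inl k)) (pw (i, k, t))"
    using tree_word_rev by metis
  then show "chord_word (pw (i, k, t)) {} (set (pw (i, k, t)))" by (rule tree_word_full)
qed

text \<open>The actual pieces alone spell the boundary word of the disc, with its chords. A mirrored
  piece is a tree word whose tokens occur in no other piece, so it can be inserted between them and
  all its occurrences linked by \<open>tree_word_full\<close>.\<close>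

lemma BW_chords: "chord_word (map fst BW) ((`) Actual ` F)
    (\<Union>p\<in>{p \<in> set all_pieces. \<not> (case p of (i, k, t) \<Rightarrow> t = i)}. set (pw p))"
proof -
  let ?isr = "\<lambda>(i, k, t). t = (i::nat)"
  have fst: "map fst BW = concat (map pw all_pieces)"
  proof -
    have "map fst BW = concat (map (\<lambda>i. map fst (BB i)) [0..<s])" by (simp add: BW_def map_concat comp_def)
    also have "\<dots> = concat (map (\<lambda>i. concat (map pw (pieces i))) [0..<s])" by (simp only: fst_BB)
    also have "\<dots> = concat (map pw all_pieces)" unfolding all_pieces_def concat_map_concat
      by (simp add: comp_def)
    finally show ?thesis .
  qed
  have "concat (map pw (filter ?isr all_pieces)) = concat (map (\<lambda>i. concat (map pw (filter ?isr (pieces i)))) [0..<s])"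
    unfolding all_pieces_def filter_concat concat_map_concat by (simp add: comp_def)
  also have "\<dots> = concat (map (\<lambda>i. map Actual (concat (map wd (c i # I i)))) [0..<s])"
    by (intro arg_cong[of _ _ concat] map_cong refl actual_pieces) auto
  also have "\<dots> = map Actual (concat (map wd (outer P)))"
    unfolding outer concat_map_concat by (simp add: map_concat comp_def)
  finally have flt: "concat (map pw (filter ?isr all_pieces)) = map Actual (concat (map wd (outer P)))" .
  have real_set: "set (pw (i, k, i)) \<subseteq> range Actual" for i k by (auto simp: Let_def)
  have "chord_word ([] @ concat (map pw all_pieces)) ((`) Actual ` F)
     ({} \<union> (\<Union>p\<in>{p \<in> set all_pieces. \<not> ?isr p}. set (pw p)))"
  proof (rule chord_word_interleave)
    show "chord_word ([] @ concat (map pw (filter ?isr all_pieces))) ((`) Actual ` F) {}"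
      unfolding flt append_Nil by (rule chord_word_map[OF wd_chords])
    show "chord_word (pw p) {} (set (pw p))" if "p \<in> set all_pieces" "\<not> ?isr p" for p
    proof -
      obtain i k t where "p = (i, k, t)" by (cases p)
      then show ?thesis using pw_dummy(2)[of i k t] that by simp
    qed
    show "set (pw p) \<inter> set (pw q) = {}" if pq: "p \<in> set all_pieces" "\<not> ?isr p" "q \<in> set all_pieces" "?isr q" for p q
    proof -
      obtain i k t where p: "p = (i, k, t)" by (cases p)
      obtain i' k' where q: "q = (i', k', i')" using pq(4) by (cases q) auto
      have "set (pw p) \<subseteq> range (Dummy i t)" using pw_dummy(1)[of i k t] pq p by (auto simp del: pw.simps)
      then show ?thesis using real_set[of i' k'] q by blast
    qed
    show "pairwise (\<lambda>p q. set (pw p) \<inter> set (pw q) = {}) {p \<in> set all_pieces. \<not> ?isr p}"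
    proof (rule pairwiseI)
      fix p q assume p': "p \<in> {p \<in> set all_pieces. \<not> ?isr p}" and q': "q \<in> {p \<in> set all_pieces. \<not> ?isr p}" and pq: "p \<noteq> q"
      obtain i k t where p: "p = (i, k, t)" "(i, k, t) \<in> set all_pieces" "t \<noteq> i" using p' by (cases p) auto
      obtain i' k' t' where q: "q = (i', k', t')" "(i', k', t') \<in> set all_pieces" "t' \<noteq> i'" using q' by (cases q) auto
      note m = pieces_mem[OF p(2,3)] pieces_mem[OF q(2,3)]
      have "set (rw t k) \<inter> set (rw t' k') = {}" if "i = i'" "t = t'"
      proof -
        have "k \<noteq> k'" using pq p q that by auto
        have mk: "t < s" "1 \<le> k" "k < Len t - 1" "t' < s" "1 \<le> k'" "k' < Len t' - 1" using m by auto
        have "own t k \<inter> own t' k' = {}"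
          using own_disjoint[OF mk] \<open>k \<noteq> k'\<close> by simp
        then show ?thesis using set_rw[OF mk(1-3), folded own_def] set_rw[OF mk(4-6), folded own_def] \<open>k \<noteq> k'\<close> by auto
      qed
      then show "set (pw p) \<inter> set (pw q) = {}"
        unfolding p(1) q(1) pw_dummy(1)[OF p(2,3)] pw_dummy(1)[OF q(2,3)] by auto
    qed
    show "distinct all_pieces" by (rule distinct_pieces)
  qed auto
  then show ?thesis unfolding fst by simp
qed

fun tlab :: "token \<Rightarrow> complex" where
  "tlab (Actual v) = v"
| "tlab (Dummy i t y) = lab i y"

definition goodtok :: "token \<Rightarrow> bool" where "goodtok z \<longleftrightarrow> z \<notin> Actual ` c ` {..<s}"

text \<open>Tokens merged into one diagonal vertex must agree on its label. They do, since each
  agrees with the label read off the symbol word.\<close>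

lemma BW_label: assumes "(z, g) \<in> set BW" "goodtok z" shows "g < s * M" "labd g = tlab z"
proof -
  obtain i where i: "i < s" "(z, g) \<in> set (BB i)" using assms(1) by (auto simp: BW_def)
  have "z \<notin> Actual ` set (wd (c i))" using assms(2) wd_corner[OF i(1)] i(1) by (auto simp: goodtok_def)
  then have "(z, g) \<in> set (ES i)" using i(2) by (auto simp: BB_def split: if_splits)
  then obtain b where b: "b < length (Y i)" "z = tok i (YP i ! b)" "g = dg i (tgt i b)" by (auto simp: ES_def length_YP)
  note tg = tgt_props[OF i(1) b(1)]
  note d = dg_props[OF i(1) tg(1,2)]
  show "g < s * M" using b d by simp
  have "tlab z = lab i (Y i ! b)" using b by (cases "YP i ! b") (auto simp: Y_def)
  then show "labd g = tlab z" using b d tg by simp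
qed

lemma BW_dummy_mem:
  assumes "i < s" "b < length (Y i)" "YP i ! b = (t, y)" "t \<noteq> i"
  shows "(Dummy i t y, dg i (tgt i b)) \<in> set BW"
proof -
  have "(tok i (YP i ! b), dg i (tgt i b)) \<in> set (ES i)" using assms(2) by (auto simp: ES_def length_YP)
  then have "(Dummy i t y, dg i (tgt i b)) \<in> set (BB i)" using assms(3,4) by (auto simp: BB_def)
  then show ?thesis using assms(1) by (auto simp: BW_def)
qed

definition chain_rel :: "(nat \<times> nat) set \<Rightarrow> nat rel" where
  "chain_rel Ch = {(g, h). labd g = labd h \<and> ((g, h) \<in> Ch \<or> (h, g) \<in> Ch)}"

lemma chords_exist:
  "\<exists>Ch. noncrossing Ch \<and> (\<forall>g h. (g, h) \<in> Ch \<longrightarrow> g < h \<and> h < s * M) \<and>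
     (\<forall>e\<in>F. \<exists>g h. (g, h) \<in> Ch \<and> e = {labd g, labd h}) \<and>
     (\<forall>i b b' t y. i < s \<longrightarrow> b < length (Y i) \<longrightarrow> b' < length (Y i) \<longrightarrow> YP i ! b = (t, y) \<longrightarrow> YP i ! b' = (t, y) \<longrightarrow> t \<noteq> i \<longrightarrow>
        (dg i (tgt i b), dg i (tgt i b')) \<in> (chain_rel Ch)\<^sup>*)"
proof -
  let ?D = "(\<Union>p\<in>{p \<in> set all_pieces. \<not> (case p of (i, k, t) \<Rightarrow> t = i)}. set (pw p))"
  let ?w = "map fst BW"
  from BW_chords obtain C where C: "chords_of ?w C" "\<forall>e\<in>(`) Actual ` F. \<exists>p q. (p, q) \<in> C \<and> e = {?w ! p, ?w ! q}"
     "\<forall>z\<in>?D. \<forall>p q. p < length ?w \<longrightarrow> q < length ?w \<longrightarrow> ?w ! p = z \<longrightarrow> ?w ! q = z \<longrightarrow>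
          (p, q) \<in> (same_letter_chords ?w C z)\<^sup>*"
    by (elim chord_wordE) (rule that)
  define G where "G p = snd (BW ! p)" for p
  have Cb: "p < q \<and> q < length BW" if "(p, q) \<in> C" for p q using C(1) that by (auto simp: chords_of_def)
  have Gmono: "G p \<le> G q" if "p \<le> q" "q < length BW" for p q
    using sorted_nth_mono[OF sorted_BW, of p q] that by (simp add: G_def)
  define good where "good p \<longleftrightarrow> goodtok (fst (BW ! p))" for p
  have Gl: "G p < s * M" "labd (G p) = tlab (fst (BW ! p))" if "p < length BW" "good p" for p
    using BW_label[of "fst (BW ! p)" "G p"] that by (auto simp: G_def good_def)
  define Ch where "Ch = {(G p, G q) | p q. (p, q) \<in> C \<and> good p \<and> good q \<and> G p < G q}"
  have "noncrossing Ch"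
    unfolding noncrossing_def
  proof (intro allI impI notI)
    fix g h g' h' assume gh: "(g, h) \<in> Ch" "(g', h') \<in> Ch" and x: "g < g' \<and> g' < h \<and> h < h'"
    obtain p q where pq: "g = G p" "h = G q" "(p, q) \<in> C" using gh(1) by (auto simp: Ch_def)
    obtain p' q' where pq': "g' = G p'" "h' = G q'" "(p', q') \<in> C" using gh(2) by (auto simp: Ch_def)
    have "p < p'" using Gmono[of p' p] x pq(1) pq'(1) Cb[OF pq(3)] by linarith
    moreover have "p' < q" using Gmono[of q p'] x pq(2) pq'(1) Cb[OF pq'(3)] by linarith
    moreover have "q < q'" using Gmono[of q' q] x pq(2) pq'(2) Cb[OF pq(3)] by linarith
    ultimately show False using C(1) pq(3) pq'(3) unfolding chords_of_def noncrossing_def by blast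
  qed
  moreover have "g < h \<and> h < s * M" if gh: "(g, h) \<in> Ch" for g h
  proof -
    obtain p q where pq: "g = G p" "h = G q" "(p, q) \<in> C" "good q" "G p < G q" using gh by (auto simp: Ch_def)
    then show ?thesis using Gl(1)[of q] Cb[of p q] by auto
  qed
  moreover have "\<exists>g h. (g, h) \<in> Ch \<and> e = {labd g, labd h}" if e: "e \<in> F" for e
  proof -
    obtain p q where pq: "(p, q) \<in> C" "Actual ` e = {?w ! p, ?w ! q}" using C(2) e by blast
    have len: "p < length BW" "q < length BW" "p < q" using Cb[OF pq(1)] by auto
    obtain a b where ab: "e = {a, b}" "a \<noteq> b" using F_two[OF e] by blast
    have eq: "{fst (BW ! p), fst (BW ! q)} = {Actual a, Actual b}" using pq(2) len ab by simp
    have gd: "goodtok (Actual a)" "goodtok (Actual b)" using F_corner[OF e] ab by (auto simp: goodtok_def)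
    then have "good p" "good q" using eq unfolding good_def by (auto simp: doubleton_eq_iff)
    then have l: "labd (G p) = tlab (fst (BW ! p))" "labd (G q) = tlab (fst (BW ! q))" using Gl(2) len by auto
    then have el: "e = {labd (G p), labd (G q)}" using eq ab by (auto simp: doubleton_eq_iff)
    then have "G p \<noteq> G q" using ab by (auto simp: doubleton_eq_iff)
    then have "G p < G q" using Gmono[of p q] len by simp
    then have "(G p, G q) \<in> Ch" using pq(1) \<open>good p\<close> \<open>good q\<close> by (auto simp: Ch_def)
    then show ?thesis using el by blast
  qed
  moreover have "(dg i (tgt i b), dg i (tgt i b')) \<in> (chain_rel Ch)\<^sup>*"
    if i: "i < s" and b: "b < length (Y i)" "YP i ! b = (t, y)" and b': "b' < length (Y i)" "YP i ! b' = (t, y)" and t: "t \<noteq> i" for i b b' t y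
  proof -
    let ?z = "Dummy i t y"
    obtain p where p: "p < length BW" "BW ! p = (?z, dg i (tgt i b))"
      using BW_dummy_mem[OF i b t] by (metis in_set_conv_nth)
    obtain p' where p': "p' < length BW" "BW ! p' = (?z, dg i (tgt i b'))"
      using BW_dummy_mem[OF i b' t] by (metis in_set_conv_nth)
    have zD: "?z \<in> ?D"
    proof -
      have "(t, y) \<in> set (YP i)" using b by (metis length_YP nth_mem)
      then obtain k where k: "(k, t) \<in> set (PL i)" "y \<in> set (rw t k)" by (auto simp: YP_def)
      have mem: "(i, k, t) \<in> set all_pieces" using k i by (auto simp: all_pieces_def pieces_def)
      have "?z \<in> set (pw (i, k, t))" using k unfolding pw_dummy(1)[OF mem t] by blast
      then show ?thesis using mem t by (intro UN_I[of "(i, k, t)"]) (auto simp del: pw.simps)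
    qed
    have "(p, p') \<in> (same_letter_chords ?w C ?z)\<^sup>*" using C(3) zD p p' by auto
    then have "(G p, G p') \<in> (chain_rel Ch)\<^sup>*"
    proof induction
      case (step x x')
      then have xx: "?w ! x = ?z" "?w ! x' = ?z" "(x, x') \<in> C \<or> (x', x) \<in> C" by (auto simp: same_letter_chords_def)
      have len: "x < length BW" "x' < length BW" using xx(3) Cb[of x x'] Cb[of x' x] by auto
      have gd: "good x" "good x'" using xx len by (auto simp: good_def goodtok_def)
      have lb: "labd (G x) = labd (G x')" using Gl(2)[OF len(1) gd(1)] Gl(2)[OF len(2) gd(2)] xx len by simp
      have "G x = G x' \<or> (G x, G x') \<in> chain_rel Ch"
      proof (rule disjCI)
        assume "(G x, G x') \<notin> chain_rel Ch"
        then have n: "(G x, G x') \<notin> Ch" "(G x', G x) \<notin> Ch" using lb by (auto simp: chain_rel_def)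
        show "G x = G x'"
        proof (rule ccontr)
          assume "G x \<noteq> G x'"
          then consider "G x < G x'" | "G x' < G x" by linarith
          then show False
          proof cases
            case 1
            then have "(x, x') \<in> C" using xx(3) Cb[of x' x] Gmono[of x' x] len by auto
            then show False using n(1) gd 1 by (auto simp: Ch_def)
          next
            case 2
            then have "(x', x) \<in> C" using xx(3) Cb[of x x'] Gmono[of x x'] len by auto
            then show False using n(2) gd 2 by (auto simp: Ch_def)
          qed
        qed
      qed
      then show ?case using step.IH by (metis rtrancl.rtrancl_into_rtrancl)
    qed simp
    then show ?thesis using p p' by (simp add: G_def)
  qed
  ultimately show ?thesis by (intro exI[of _ Ch] conjI allI impI ballI) simp_all
qed

end

section \<open>The labelling of \<open>\<bbbU>\<close>\<close>

lemma remdups_adj_keeps_pair: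
  assumes "a \<noteq> b" shows "\<exists>A' B'. remdups_adj (A @ a # b # B) = A' @ a # b # B'"
proof -
  have 1: "remdups_adj (A @ a # b # B) = remdups_adj (A @ [a]) @ tl (remdups_adj (a # b # B))" by (rule remdups_adj_append)
  have 2: "tl (remdups_adj (a # b # B)) = remdups_adj (b # B)" using assms by simp
  have "remdups_adj (A @ [a]) \<noteq> []" "last (remdups_adj (A @ [a])) = a" by simp_all
  then obtain A' where 3: "remdups_adj (A @ [a]) = A' @ [a]" by (metis append_butlast_last_id)
  obtain B' where 4: "remdups_adj (b # B) = b # B'" by (metis remdups_adj_Cons_alt)
  show ?thesis unfolding 1 2 3 4 by auto
qed

text \<open>Where two numbers are neighbours, the number stays or grows by one. An edge of a side of
  the target between different numbers is then the copy of an edge on the side of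
  \<open>P\<close>.\<close>

definition inl_step :: "nat + 'b \<Rightarrow> nat + 'b \<Rightarrow> bool" where
  "inl_step y y' \<longleftrightarrow> (\<forall>k k'. y = Inl k \<longrightarrow> y' = Inl k' \<longrightarrow> k' = k \<or> k' = Suc k)"

lemma successively_inl_const:
  "(\<And>k'. Inl k' \<in> set w \<Longrightarrow> k' = k) \<Longrightarrow> successively inl_step w"
proof (induction w)
  case (Cons a w)
  then show ?case by (cases w) (auto simp: inl_step_def)
qed simp

locale sewn_polygon = sewn_words +
  assumes edges_two: "e \<in> edges P \<Longrightarrow> \<exists>a b. a \<noteq> b \<and> e \<inter> verts P = {a, b}"
    and edges_simple: "e \<in> edges P \<Longrightarrow> e' \<in> edges P \<Longrightarrow> e \<inter> verts P = e' \<inter> verts P \<Longrightarrow> e = e'"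
    and edges_cases: "e \<in> edges P \<Longrightarrow> e \<inter> verts P \<in> F \<or> e \<inter> verts P \<in> cycle_edges (outer P)"
    and cycle_drawn: "p \<in> cycle_edges (outer P) \<Longrightarrow> \<exists>e\<in>edges P. e \<inter> verts P = p"
begin

abbreviation U :: "'a polygonal" where "U \<equiv> U_embedding (signature P) M"

abbreviation ov :: "nat \<Rightarrow> nat \<Rightarrow> complex" where "ov i q \<equiv> oriented_side U i ! q"

abbreviation gp :: "nat \<Rightarrow> nat \<Rightarrow> complex" where "gp \<equiv> grid_point"

lemma signature_U: "signature U = signature P" by (simp add: U_embedding_def Let_def)

lemma twin_U: "twin U i j \<longleftrightarrow> twin P i j" by (simp add: twin_def signature_U)

lemma side_U: "i < s \<Longrightarrow> side U i = U_corner s M i # map (\<lambda>k. gp k k) [i * M..<Suc i * M] @ [U_corner s M (Suc i mod s)]"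
  by (rule U_side[OF s(1)[symmetric] s(2)])

lemma length_side_U: "i < s \<Longrightarrow> length (side U i) = M + 2"
  using side_U[of i] by (simp del: upt_Suc)

lemma oriented_side_U: "oriented_side U i = (if pos i then side U i else rev (side U i))"
  by (simp add: oriented_side_def signature_U pos_def split: symbol.split)

lemma verts_U: "verts U = {gp i j | i j. j \<le> i \<and> i < s * M} \<union> U_corner s M ` {..<s}"
  by (simp add: U_embedding_def Let_def s(1))

lemma ov_side: "i < s \<Longrightarrow> q \<le> Suc M \<Longrightarrow> ov i q = side U i ! cwi i q"
  by (auto simp: oriented_side_U cwi_def rev_nth length_side_U)

lemma side_U_nth:
  assumes "i < s"
  shows "side U i ! 0 = U_corner s M i" "side U i ! Suc M = U_corner s M (Suc i mod s)"
    "\<And>p. 1 \<le> p \<Longrightarrow> p \<le> M \<Longrightarrow> side U i ! p = gp (i * M + p - 1) (i * M + p - 1)"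
proof -
  show "side U i ! 0 = U_corner s M i" by (simp add: side_U[OF assms])
  have len: "length (map (\<lambda>k. gp k k) [i * M..<Suc i * M]) = M" by (simp del: upt_Suc)
  show "side U i ! Suc M = U_corner s M (Suc i mod s)"
    unfolding side_U[OF assms] using len by (simp add: nth_append del: upt_Suc)
  fix p assume p: "1 \<le> p" "p \<le> M"
  then obtain p' where p': "p = Suc p'" by (cases p) auto
  have "side U i ! p = map (\<lambda>k. gp k k) [i * M..<Suc i * M] ! p'"
    unfolding side_U[OF assms] p' using p p' len by (simp add: nth_append del: upt_Suc)
  also have "\<dots> = gp (i * M + p') (i * M + p')" using p p' by (subst nth_map) (auto simp del: upt_Suc)
  finally show "side U i ! p = gp (i * M + p - 1) (i * M + p - 1)" using p' by simp
qed

lemma ov_diag: "i < s \<Longrightarrow> 1 \<le> q \<Longrightarrow> q \<le> M \<Longrightarrow> ov i q = gp (dg i q) (dg i q)"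
  using side_U_nth(3)[of i "cwi i q"] by (auto simp: ov_side dg_def cwi_def)

lemma diag_ov: assumes "g < s * M"
  shows "\<exists>i q. i < s \<and> 1 \<le> q \<and> q \<le> M \<and> ov i q = gp g g \<and> dg i q = g"
proof -
  have M: "0 < M" using assms by (cases M) auto
  let ?i = "g div M" and ?q = "cwi (g div M) (Suc (g mod M))"
  have i: "?i < s" using assms by (simp add: less_mult_imp_div_less)
  have m: "g mod M < M" using M by simp
  have q: "1 \<le> ?q" "?q \<le> M" using m by (auto simp: cwi_def)
  have "cwi ?i ?q = Suc (g mod M)" using m by (auto simp: cwi_def)
  then have "dg ?i ?q = g" by (simp add: dg_def)
  then show ?thesis using i q ov_diag[OF i q] by metis
qed

lemma ov_first: "i < s \<Longrightarrow> ov i 0 = (if pos i then U_corner s M i else U_corner s M (Suc i mod s))"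
  using side_U_nth(1,2)[of i] by (simp add: ov_side cwi_def)

lemma ov_last: "i < s \<Longrightarrow> ov i (Suc M) = (if pos i then U_corner s M (Suc i mod s) else U_corner s M i)"
  using side_U_nth(1,2)[of i] by (simp add: ov_side cwi_def)

lemma ov_verts: assumes "i < s" "q \<le> Suc M" shows "ov i q \<in> verts U"
proof -
  consider "q = 0" | "q = Suc M" | "1 \<le> q" "q \<le> M" using assms(2) by linarith
  then show ?thesis
  proof cases
    case 1 then show ?thesis using assms Suc_mod[of i] by (auto simp: ov_first verts_U)
  next
    case 2 then show ?thesis using assms Suc_mod[of i] by (auto simp: ov_last verts_U)
  next
    case 3 then show ?thesis using ov_diag[OF assms(1) 3] dg_props(2)[OF assms(1) 3] by (auto simp: verts_U)
  qed
qed

lemma length_oriented_U: "i < s \<Longrightarrow> length (oriented_side U i) = M + 2"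
  by (simp add: length_oriented_side length_side_U)

lemma sewable_U: "sewable U"
  unfolding sewable_def twin_U
proof (intro allI impI conjI)
  fix i j assume t: "twin P i j"
  note tt = twin_ts[OF t]
  show "length (side U i) = length (side U j)" using tt length_side_U by simp
  show "set (side U i) \<subseteq> verts U"
  proof
    fix z assume "z \<in> set (side U i)"
    then obtain q where "q < M + 2" "z = ov i q" using length_oriented_U[of i] tt
      by (metis in_set_conv_nth set_oriented_side)
    then show "z \<in> verts U" using ov_verts[of i q] tt by simp
  qed
qed

lemma outer_verts: "set (outer P) \<subseteq> verts P"
  using wd_un wd_own by blast

lemma sewable_P: "sewable P"
  unfolding sewable_def
proof (intro allI impI conjI)
  fix i j assume t: "twin P i j"
  note tt = twin_ts[OF t]
  show "length (side P i) = length (side P j)" using tt length_Os length_oriented_side by metis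
  show "set (side P i) \<subseteq> verts P" using set_Os[of i] tt outer_verts by (simp add: set_oriented_side)
qed

lemma corner_U_inj: "inj_on (U_corner s M) {..<s}"
proof -
  have d: "distinct (concat (map (\<lambda>i. U_corner s M i # map (\<lambda>k. grid_point k k) [i * M..<Suc i * M]) [0..<s]))"
    using distinct_U_outer[of s M] s(2) unfolding U_outer_def by simp
  show ?thesis
  proof (rule inj_onI)
    fix i j assume ij: "i \<in> {..<s}" "j \<in> {..<s}" "U_corner s M i = U_corner s M j"
    show "i = j"
    proof (rule ccontr)
      assume "i \<noteq> j"
      then show False using distinct_blocks(2)[OF d, of i j] ij by auto
    qed
  qed
qed

section \<open>Hooks in the half-grid\<close>

definition Ch :: "(nat \<times> nat) set" where
  "Ch = (SOME Ch. noncrossing Ch \<and> (\<forall>g h. (g, h) \<in> Ch \<longrightarrow> g < h \<and> h < s * M) \<and>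
     (\<forall>e\<in>F. \<exists>g h. (g, h) \<in> Ch \<and> e = {labd g, labd h}) \<and>
     (\<forall>i b b' t y. i < s \<longrightarrow> b < length (Y i) \<longrightarrow> b' < length (Y i) \<longrightarrow> YP i ! b = (t, y) \<longrightarrow> YP i ! b' = (t, y) \<longrightarrow> t \<noteq> i \<longrightarrow>
        (dg i (tgt i b), dg i (tgt i b')) \<in> (chain_rel Ch)\<^sup>*))"

lemma Ch: "noncrossing Ch" "\<And>g h. (g, h) \<in> Ch \<Longrightarrow> g < h \<and> h < s * M"
     "\<And>e. e \<in> F \<Longrightarrow> \<exists>g h. (g, h) \<in> Ch \<and> e = {labd g, labd h}"
     "\<And>i b b' t y. i < s \<Longrightarrow> b < length (Y i) \<Longrightarrow> b' < length (Y i) \<Longrightarrow> YP i ! b = (t, y) \<Longrightarrow> YP i ! b' = (t, y) \<Longrightarrow> t \<noteq> i \<Longrightarrow>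
        (dg i (tgt i b), dg i (tgt i b')) \<in> (chain_rel Ch)\<^sup>*"
proof -
  note * = someI_ex[OF chords_exist, folded Ch_def]
  show "noncrossing Ch" using * by (rule conjunct1)
  show "\<And>g h. (g, h) \<in> Ch \<Longrightarrow> g < h \<and> h < s * M" using *[THEN conjunct2, THEN conjunct1] by blast
  show "\<And>e. e \<in> F \<Longrightarrow> \<exists>g h. (g, h) \<in> Ch \<and> e = {labd g, labd h}"
    by (rule bspec[OF *[THEN conjunct2, THEN conjunct2, THEN conjunct1]])
  show "\<And>i b b' t y. i < s \<Longrightarrow> b < length (Y i) \<Longrightarrow> b' < length (Y i) \<Longrightarrow> YP i ! b = (t, y) \<Longrightarrow> YP i ! b' = (t, y) \<Longrightarrow> t \<noteq> i \<Longrightarrow>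
        (dg i (tgt i b), dg i (tgt i b')) \<in> (chain_rel Ch)\<^sup>*"
    by (rule *[THEN conjunct2, THEN conjunct2, THEN conjunct2, rule_format])
qed

text \<open>The hooks of the diagonal vertices \<open>j < i\<close> cross at the grid point \<open>(i, j)\<close>. It goes to \<open>j\<close> if
  \<open>j\<close> still has to reach a chord beyond \<open>i\<close>, and otherwise to \<open>i\<close> if \<open>i\<close> has to come this far.\<close>

definition Lg :: "nat \<Rightarrow> nat \<Rightarrow> complex option" where
  "Lg i j = (if j = i then Some (labd i) else if \<exists>r>i. (j, r) \<in> Ch then Some (labd j)
     else if \<exists>l\<le>j. (l, i) \<in> Ch then Some (labd i) else None)"

definition L :: "complex \<Rightarrow> complex option" where
  "L z = (if z \<in> U_corner s M ` {..<s} then Some (c (inv_into {..<s} (U_corner s M) z))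
     else Lg (nat \<lfloor>Re z\<rfloor>) (nat \<lfloor>Im z\<rfloor>))"

lemma L_corner: "i < s \<Longrightarrow> L (U_corner s M i) = Some (c i)"
  using inv_into_f_f[OF corner_U_inj, of i] by (simp add: L_def)

lemma L_grid: assumes "i < s * M" shows "L (gp i j) = Lg i j"
proof -
  have "gp i j \<notin> U_corner s M ` {..<s}" using grid_point_neq_corner[OF _ assms] by auto
  then show ?thesis by (simp add: L_def grid_point_def)
qed

lemma L_diag: "g < s * M \<Longrightarrow> L (gp g g) = Some (labd g)"
  by (simp add: L_grid Lg_def)

lemma L_ov: assumes "i < s" "q \<le> Suc M" shows "L (ov i q) = Some (lab i (X i ! q))"
proof -
  consider "q = 0" | "q = Suc M" | "1 \<le> q" "q \<le> M" using assms(2) by linarith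
  then show ?thesis
  proof cases
    case 1 then show ?thesis using assms Suc_mod[of i] by (simp add: ov_first X_first lab_def Os_first L_corner)
  next
    case 2 then show ?thesis using assms Suc_mod[of i] Os_last[of i] by (simp add: ov_last X_last lab_def L_corner)
  next
    case 3 then show ?thesis using ov_diag[OF assms(1) 3] dg_props(2,3)[OF assms(1) 3] by (simp add: L_diag)
  qed
qed

text \<open>The relation in condition \<open>L3\<close> of \<open>sewing_minor\<close>: connected
  through sewing and through contracted edges.\<close>

definition CR :: "complex rel" where
  "CR = (vertex_ident U \<union> {(a, b). (\<exists>f\<in>edges U. f \<inter> verts U = {a, b}) \<and> L a = L b})\<^sup>*"

lemma CR_trans: "(a, b) \<in> CR \<Longrightarrow> (b, d) \<in> CR \<Longrightarrow> (a, d) \<in> CR"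
  unfolding CR_def by (rule rtrancl_trans)

lemma CR_refl: "(a, a) \<in> CR" unfolding CR_def by simp

lemma CR_sym: "(a, b) \<in> CR \<Longrightarrow> (b, a) \<in> CR"
proof -
  have "sym (vertex_ident U \<union> {(a, b). (\<exists>f\<in>edges U. f \<inter> verts U = {a, b}) \<and> L a = L b})"
    by (rule sym_Un[OF sym_vertex_ident[OF sewable_U]]) (auto simp: sym_def insert_commute)
  then have "sym CR" unfolding CR_def by (rule sym_rtrancl)
  then show "(a, b) \<in> CR \<Longrightarrow> (b, a) \<in> CR" by (rule symD)
qed

lemma CR_edge: "f \<in> edges U \<Longrightarrow> f \<inter> verts U = {a, b} \<Longrightarrow> L a = L b \<Longrightarrow> (a, b) \<in> CR"
  unfolding CR_def by blast

lemma CR_ident: "(a, b) \<in> vertex_ident U \<Longrightarrow> (a, b) \<in> CR"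
  unfolding CR_def by blast

lemma CR_twin: "twin P i j \<Longrightarrow> q \<le> Suc M \<Longrightarrow> (ov i q, ov j q) \<in> CR"
proof -
  assume "twin P i j" "q \<le> Suc M"
  then have "(ov i q, ov j q) \<in> vertex_ident U"
    using length_side_U[of i] twin_ts[of i j] unfolding vertex_ident_def twin_U
    by (intro CollectI exI[of _ i] exI[of _ j] exI[of _ q]) auto
  then show ?thesis by (rule CR_ident)
qed

lemma grid_edge:
  assumes "j \<le> i" "i < s * M" "j' \<le> i'" "i' < s * M" "\<bar>int i - int i'\<bar> + \<bar>int j - int j'\<bar> = 1"
  shows "closed_segment (gp i j) (gp i' j') \<in> edges U" "closed_segment (gp i j) (gp i' j') \<inter> verts U = {gp i j, gp i' j'}"
proof -
  show "closed_segment (gp i j) (gp i' j') \<inter> verts U = {gp i j, gp i' j'}"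
    by (rule U_grid_edge_ends[OF s(1)[symmetric] assms])
  have "closed_segment (gp i j) (gp i' j') \<in> U_grid_edges (s * M)" unfolding U_grid_edges_def using assms by blast
  then show "closed_segment (gp i j) (gp i' j') \<in> edges U" by (simp add: U_embedding_def Let_def s(1))
qed

lemma grid_CR:
  assumes "j \<le> i" "i < s * M" "j' \<le> i'" "i' < s * M" "\<bar>int i - int i'\<bar> + \<bar>int j - int j'\<bar> = 1" "L (gp i j) = L (gp i' j')"
  shows "(gp i j, gp i' j') \<in> CR"
  using CR_edge[OF grid_edge[OF assms(1-5)] assms(6)] .

lemma column:
  assumes "(j, r) \<in> Ch" "j \<le> i" "i < r"
  shows "L (gp i j) = Some (labd j) \<and> (gp j j, gp i j) \<in> CR"
proof -
  have r: "r < s * M" "j < r" using Ch(2)[OF assms(1)] by auto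
  have lab: "L (gp i j) = Some (labd j)" if "j \<le> i" "i < r" for i
    using that r assms(1) by (auto simp: L_grid Lg_def)
  from assms(2,3) show ?thesis
  proof (induction i rule: dec_induct)
    case base then show ?case using lab[of j] r by (simp add: CR_refl)
  next
    case (step i)
    then have "(gp j j, gp i j) \<in> CR" by simp
    moreover have "(gp i j, gp (Suc i) j) \<in> CR"
      using step r by (intro grid_CR) (auto simp: lab)
    ultimately show ?case using lab[of "Suc i"] step CR_trans by auto
  qed
qed

text \<open>A chord from a vertex strictly between \<open>l\<close> and \<open>i\<close> to one
  beyond \<open>i\<close> would cross \<open>(l, i)\<close>. So no other hook claims these points
  first.\<close>

lemma row:
  assumes "(l, i) \<in> Ch" "l < j" "j \<le> i"
  shows "L (gp i j) = Some (labd i) \<and> (gp i j, gp i i) \<in> CR"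
proof -
  have i: "i < s * M" using Ch(2)[OF assms(1)] by auto
  have lab: "L (gp i j) = Some (labd i)" if "l < j" "j \<le> i" for j
  proof (cases "j = i")
    case False
    have "\<not> (\<exists>r>i. (j, r) \<in> Ch)"
    proof
      assume "\<exists>r>i. (j, r) \<in> Ch"
      then obtain r where "r > i" "(j, r) \<in> Ch" by blast
      then show False using Ch(1) assms(1) that False unfolding noncrossing_def by (metis nless_le)
    qed
    moreover have "\<exists>l\<le>j. (l, i) \<in> Ch" using assms(1) that less_imp_le by blast
    ultimately show ?thesis using i False by (auto simp: L_grid Lg_def)
  qed (use L_diag i in simp)
  from assms(3,2) show ?thesis
  proof (induction j rule: inc_induct)
    case base then show ?case using lab[of i] by (simp add: CR_refl)
  next
    case (step j)
    then have "(gp i (Suc j), gp i i) \<in> CR" by simp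
    moreover have "(gp i j, gp i (Suc j)) \<in> CR"
      using step i by (intro grid_CR) (auto simp: lab)
    ultimately show ?case using lab[of j] step CR_trans by auto
  qed
qed

text \<open>The hooks of \<open>j\<close> and \<open>i\<close> meet at the grid point
  \<open>(i, j)\<close>. The edge leads from there to the nearest point of the other hook: to
  \<open>(i, j + 1)\<close> if \<open>j\<close> owns the meeting point, to \<open>(i - 1, j)\<close>
  if \<open>i\<close> does. The last conjunct places one end off the diagonal, so the edge lies on
  no side and is not affected by sewing.\<close>

lemma chord_edge:
  assumes "(j, i) \<in> Ch"
  shows "\<exists>f\<in>edges U. \<exists>x y. f \<inter> verts U = {x, y} \<and> L x = Some (labd j) \<and> L y = Some (labd i) \<and>
     (gp j j, x) \<in> CR \<and> (y, gp i i) \<in> CR \<and> gp i j \<in> {x, y}"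
proof -
  have ji: "j < i" "i < s * M" using Ch(2)[OF assms] by auto
  show ?thesis
  proof (cases "\<exists>r>i. (j, r) \<in> Ch")
    case True
    then obtain r where r: "i < r" "(j, r) \<in> Ch" by blast
    have x: "L (gp i j) = Some (labd j) \<and> (gp j j, gp i j) \<in> CR" using column[OF r(2) _ r(1)] ji by simp
    have y: "L (gp i (Suc j)) = Some (labd i) \<and> (gp i (Suc j), gp i i) \<in> CR" using row[OF assms, of "Suc j"] ji by simp
    have "\<bar>int i - int i\<bar> + \<bar>int j - int (Suc j)\<bar> = 1" by simp
    then show ?thesis using grid_edge[of j i "Suc j" i] ji x y by (meson insertI1 less_imp_le Suc_leI)
  next
    case False
    obtain i' where i': "i = Suc i'" using ji by (cases i) auto
    have x: "L (gp i' j) = Some (labd j) \<and> (gp j j, gp i' j) \<in> CR" using column[OF assms, of i'] ji i' by simp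
    have y: "L (gp i j) = Some (labd i)" using False assms ji by (auto simp: L_grid Lg_def)
    have "(gp i j, gp i i) \<in> CR"
    proof -
      have r: "L (gp i (Suc j)) = Some (labd i) \<and> (gp i (Suc j), gp i i) \<in> CR" using row[OF assms, of "Suc j"] ji by simp
      have "(gp i j, gp i (Suc j)) \<in> CR" using ji y r by (intro grid_CR) auto
      then show ?thesis using r CR_trans by blast
    qed
    moreover have "closed_segment (gp i' j) (gp i j) \<in> edges U" "closed_segment (gp i' j) (gp i j) \<inter> verts U = {gp i' j, gp i j}"
      using ji i' by (intro grid_edge; simp)+
    ultimately show ?thesis using x y by blast
  qed
qed

lemma chain_CR: "(g, h) \<in> (chain_rel Ch)\<^sup>* \<Longrightarrow> (gp g g, gp h h) \<in> CR"
proof (induction rule: rtrancl_induct)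
  case base show ?case by (rule CR_refl)
next
  case (step h k)
  have *: "(gp a a, gp b b) \<in> CR" if ab: "(a, b) \<in> Ch" "labd a = labd b" for a b
  proof -
    obtain f x y where f: "f \<in> edges U" "f \<inter> verts U = {x, y}" "L x = Some (labd a)" "L y = Some (labd b)"
      "(gp a a, x) \<in> CR" "(y, gp b b) \<in> CR" using chord_edge[OF ab(1)] by blast
    then have "(x, y) \<in> CR" using CR_edge[OF f(1,2)] ab(2) by simp
    then show ?thesis using f CR_trans by blast
  qed
  have "(gp h h, gp k k) \<in> CR" using step(2) * CR_sym by (auto simp: chain_rel_def)
  then show ?case using step.IH CR_trans by blast
qed

lemma grid_to_diag:
  assumes "j \<le> i" "i < s * M" "L (gp i j) = Some v"
  shows "\<exists>g<s * M. labd g = v \<and> (gp i j, gp g g) \<in> CR"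
proof (cases "j = i")
  case True then show ?thesis using assms CR_refl L_diag by auto
next
  case False
  show ?thesis
  proof (cases "\<exists>r>i. (j, r) \<in> Ch")
    case True
    then obtain r where r: "i < r" "(j, r) \<in> Ch" by blast
    then show ?thesis using column[OF r(2) assms(1) r(1)] assms CR_sym by (intro exI[of _ j]) auto
  next
    case F: False
    then have Lg: "\<exists>l\<le>j. (l, i) \<in> Ch" "labd i = v" using assms False by (auto simp: L_grid Lg_def split: if_splits)
    \<comment> \<open>Here \<open>l = j\<close> is possible, which \<open>row\<close> excludes for
      the point \<open>(i, j)\<close>; the row is therefore entered one step later, at
      \<open>Suc j\<close>.\<close>
    then obtain l where l: "l \<le> j" "(l, i) \<in> Ch" by blast
    have r: "L (gp i (Suc j)) = Some (labd i) \<and> (gp i (Suc j), gp i i) \<in> CR" using row[OF l(2), of "Suc j"] l assms(1) False by simp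
    have "(gp i j, gp i (Suc j)) \<in> CR" using assms False r Lg(2) by (intro grid_CR) auto
    then show ?thesis using r CR_trans assms(2) Lg(2) by blast
  qed
qed

section \<open>Linking the occurrences of a label along the sides\<close>

lemma side_edge_U:
  assumes "i < s" "q \<le> M"
  shows "closed_segment (ov i q) (ov i (Suc q)) \<in> edges U" "closed_segment (ov i q) (ov i (Suc q)) \<inter> verts U = {ov i q, ov i (Suc q)}"
proof -
  have "{ov i q, ov i (Suc q)} \<in> path_edges (oriented_side U i)"
    unfolding path_edges_conv_nth using assms length_oriented_U[of i] by auto
  then have "{ov i q, ov i (Suc q)} \<in> path_edges (side U i)" by (simp add: oriented_side_U path_edges_rev split: if_splits)
  then show "closed_segment (ov i q) (ov i (Suc q)) \<in> edges U" "closed_segment (ov i q) (ov i (Suc q)) \<inter> verts U = {ov i q, ov i (Suc q)}"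
    using U_side_edge[OF s(1)[symmetric] s(2) assms(1)] by blast+
qed

lemma ov_step_CR: assumes "i < s" "q \<le> M" "X i ! q = X i ! Suc q" shows "(ov i q, ov i (Suc q)) \<in> CR"
  using CR_edge[OF side_edge_U[OF assms(1,2)]] L_ov[OF assms(1), of q] L_ov[OF assms(1), of "Suc q"] assms by simp

lemma YP_mem: assumes "i < s" "(t, y) \<in> set (YP i)"
  shows "\<exists>k. (k, t) \<in> set (PL i) \<and> y \<in> set (rw t k) \<and> t \<in> set (ts i) \<and> t < s \<and> 1 \<le> k \<and> k < Len t - 1 \<and> Len t = Len i \<and>
     (y = Inl k \<or> (\<exists>u\<in>own t k. y = Inr u))"
proof -
  obtain k where k: "(k, t) \<in> set (PL i)" "y \<in> set (rw t k)" using assms(2) by (auto simp: YP_def)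
  note m = PL_mem[OF assms(1) k(1)]
  have "y = Inl k \<or> (\<exists>u\<in>own t k. y = Inr u)" using k(2) set_rw[of t k, folded own_def] m by auto
  then show ?thesis using k m ts_twin[OF assms(1), of t] by blast
qed

lemma X_cases:
  assumes "i < s" "q \<le> Suc M"
  obtains (first) "q \<le> pad i" "X i ! q = Inl 0" | (last) "q = Suc M" "X i ! q = Inl (Len i - 1)"
    | (mid) b t where "b < length (Y i)" "tgt i b = q" "YP i ! b = (t, X i ! q)" "1 \<le> q" "q \<le> M"
proof -
  consider "q \<le> pad i" | "q = Suc M" | "Suc (pad i) \<le> q" "q \<le> M" using assms(2) by linarith
  then show thesis
  proof cases
    case 1 then show thesis using first X_pad by blast
  next
    case 2 then show thesis using last X_last[OF assms(1)] by blast
  next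
    case 3
    then obtain b where b: "b < length (Y i)" "tgt i b = q" using tgt_surj[OF assms(1)] by blast
    have "X i ! q = snd (YP i ! b)" using tgt_props(3)[OF assms(1) b(1)] b by (simp add: Y_def)
    then show thesis using mid[OF b, of "fst (YP i ! b)"] 3 by simp
  qed
qed

lemma Len_ge: "2 \<le> Len i" by (simp add: Len_def)

lemma mid_sym: assumes "i < s" "b < length (Y i)" "YP i ! b = (t, y)"
  shows "y \<noteq> Inl 0" "y \<noteq> Inl (Len i - 1)"
proof -
  have "(t, y) \<in> set (YP i)" using assms(2,3) length_YP by (metis nth_mem)
  from YP_mem[OF assms(1) this] show "y \<noteq> Inl 0" "y \<noteq> Inl (Len i - 1)" by auto
qed

lemma pad_CR: assumes "i < s" shows "q \<le> pad i \<Longrightarrow> (ov i 0, ov i q) \<in> CR"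
proof (induction q)
  case 0 show ?case by (rule CR_refl)
next
  case (Suc q)
  have "pad i \<le> M" by (simp add: pad_def)
  then have "(ov i q, ov i (Suc q)) \<in> CR" using Suc assms X_pad[of q i] X_pad[of "Suc q" i] by (intro ov_step_CR) auto
  then show ?case using CR_trans[OF Suc.IH] Suc.prems by simp
qed

lemma fm_twin: "twin P i j \<Longrightarrow> tgt i b = tgt j b"
  using twin_same[of i j] by (simp add: tgt_def fm_def)

text \<open>If the walk comes from the other twin, it is a mirrored one on side \<open>i\<close> and
  its occurrences are linked there by chords. If it is the own walk of side \<open>i\<close>, it is
  mirrored on the twin; the links exist there at the same positions, and sewing carries them
  back.\<close>

lemma same_portion_CR:
  assumes i: "i < s" and b: "b < length (Y i)" "b' < length (Y i)" "YP i ! b = (t, y)" "YP i ! b' = (t, y)"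
  shows "(ov i (tgt i b), ov i (tgt i b')) \<in> CR"
proof -
  have *: "(ov j (tgt j b), ov j (tgt j b')) \<in> CR"
    if j: "j < s" "t \<noteq> j" and b: "b < length (Y j)" "b' < length (Y j)" "YP j ! b = (t, y)" "YP j ! b' = (t, y)" for j
  proof -
    have "(dg j (tgt j b), dg j (tgt j b')) \<in> (chain_rel Ch)\<^sup>*" using Ch(4)[OF j(1) b j(2)] .
    then show ?thesis using chain_CR tgt_props[OF j(1) b(1)] tgt_props[OF j(1) b(2)] ov_diag[OF j(1)] by simp
  qed
  show ?thesis
  proof (cases "t = i")
    case False then show ?thesis using *[OF i _ b] by simp
  next
    case True
    obtain t1 t2 where t: "ts i = [t1, t2]" "t1 \<noteq> t2" "i \<in> {t1, t2}" using ts_props[OF i] by auto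
    then obtain j where j: "j \<in> set (ts i)" "j \<noteq> i" by auto
    then have tw: "twin P i j" "j < s" using ts_twin[OF i, of j] by auto
    note ss = twin_same[OF tw(1)]
    have "(ov j (tgt j b), ov j (tgt j b')) \<in> CR" using *[OF tw(2)] b True j(2) unfolding ss by auto
    then have "(ov j (tgt i b), ov j (tgt i b')) \<in> CR" using fm_twin[OF tw(1)] by simp
    moreover have "(ov i (tgt i b), ov j (tgt i b)) \<in> CR" "(ov i (tgt i b'), ov j (tgt i b')) \<in> CR"
      using CR_twin[OF tw(1)] tgt_props(2)[OF i b(1)] tgt_props(2)[OF i b(2)] by auto
    ultimately show ?thesis using CR_trans CR_sym by blast
  qed
qed

lemma YP_concat: assumes "i < s" "ts i = [t1, t2]"
  shows "YP i = concat (map (\<lambda>k. map (Pair t1) (rw t1 k) @ map (Pair t2) (rw t2 k)) [1..<Len i - 1])"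
proof -
  have "concat (map (\<lambda>(k, t). map (Pair t) (rw t k)) (List.product ks [t1, t2])) =
     concat (map (\<lambda>k. map (Pair t1) (rw t1 k) @ map (Pair t2) (rw t2 k)) ks)" for ks
    by (induction ks) auto
  then show ?thesis unfolding YP_def PL_def assms(2) .
qed

text \<open>The walk of the first twin ends with its root and that of the second begins with its
  root. Both roots are the symbol \<open>Inl k\<close>, so merging makes them one position. This
  connects the two portions, which \<open>same_portion_CR\<close> only handles separately.\<close>

lemma portions_meet:
  assumes i: "i < s" and t: "ts i = [t1, t2]" and k: "1 \<le> k" "k < Len i - 1"
  shows "\<exists>b. Suc b < length (Y i) \<and> YP i ! b = (t1, Inl k) \<and> YP i ! Suc b = (t2, Inl k) \<and> tgt i b = tgt i (Suc b)"
proof -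
  have tt: "t1 < s" "t2 < s" "Len t1 = Len i" "Len t2 = Len i" using ts_twin[OF i] t by auto
  have "tree_word (Inl k) (rw t1 k)" "tree_word (Inl k) (rw t2 k)" using tree_word_rw tt k by auto
  then obtain u w where u: "rw t1 k = u @ [Inl k]" and w: "rw t2 k = Inl k # w"
    using tree_word_ends by (metis append_butlast_last_id list.collapse)
  have "[1..<Len i - 1] = [1..<k] @ k # [Suc k..<Len i - 1]"
    using k upt_add_eq_append[of 1 k "Len i - 1 - k"] by (simp add: upt_conv_Cons)
  then have "YP i = (concat (map (\<lambda>k. map (Pair t1) (rw t1 k) @ map (Pair t2) (rw t2 k)) [1..<k]) @ map (Pair t1) u) @ (t1, Inl k) # (t2, Inl k) #
     (map (Pair t2) w @ concat (map (\<lambda>k. map (Pair t1) (rw t1 k) @ map (Pair t2) (rw t2 k)) [Suc k..<Len i - 1]))"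
    unfolding YP_concat[OF i t] by (simp add: u w)
  then obtain A B where AB: "YP i = A @ (t1, Inl k) # (t2, Inl k) # B" by blast
  let ?b = "length A"
  have 1: "Suc ?b < length (Y i)" using arg_cong[OF AB, of length] length_YP[of i] by simp
  have 2: "YP i ! ?b = (t1, Inl k)" "YP i ! Suc ?b = (t2, Inl k)" unfolding AB by (auto simp: nth_append)
  then have "Y i ! ?b = Y i ! (?b + 1)" using 1 by (simp add: Y_def)
  then have "fm i ?b = fm i (?b + 1)" using fm(4)[of ?b i] 1 by simp
  then show ?thesis using 1 2 by (intro exI[of _ ?b]) (simp add: tgt_def)
qed

lemma same_symbol_CR:
  assumes i: "i < s" and q: "q \<le> Suc M" "q' \<le> Suc M" and eq: "X i ! q = X i ! q'"
  shows "(ov i q, ov i q') \<in> CR"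
proof -
  have L: "Inl (Len i - 1) \<noteq> (Inl 0 :: nat + complex)" using Len_ge[of i] by simp
  show ?thesis
  proof (cases rule: X_cases[OF i q(1), case_names first last mid])
    case first
    show ?thesis
    proof (cases rule: X_cases[OF i q(2), case_names first last mid])
      case f: first
      show ?thesis using pad_CR[OF i first(1)] pad_CR[OF i f(1)] CR_sym CR_trans by blast
    next
      case (mid b t) then show ?thesis using first eq mid_sym(1)[OF i] by auto
    qed (use first eq L in auto)
  next
    case last
    show ?thesis
    proof (cases rule: X_cases[OF i q(2), case_names first last mid])
      case l: last
      show ?thesis using last l CR_refl by simp
    next
      case (mid b t) then show ?thesis using last eq mid_sym(2)[OF i] by auto
    qed (use last eq L in auto)
  next
    case (mid b t)
    note m = mid
    show ?thesis
    proof (cases rule: X_cases[OF i q(2), case_names first last mid])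
      case (mid b' t')
      let ?y = "X i ! q"
      have b: "YP i ! b = (t, ?y)" and b': "YP i ! b' = (t', ?y)" using m mid eq by auto
      show ?thesis
      proof (cases "t = t'")
        case True
        then show ?thesis using same_portion_CR[OF i m(1) mid(1) b] b' m mid by simp
      next
        case False
        have "(t, ?y) \<in> set (YP i)" "(t', ?y) \<in> set (YP i)"
          using b b' m(1) mid(1) length_YP by (metis nth_mem)+
        from YP_mem[OF i this(1)] YP_mem[OF i this(2)]
        obtain k k' where k: "t \<in> set (ts i)" "t < s" "1 \<le> k" "k < Len t - 1" "Len t = Len i" "?y = Inl k \<or> (\<exists>u\<in>own t k. ?y = Inr u)"
          and k': "t' \<in> set (ts i)" "t' < s" "1 \<le> k'" "k' < Len t' - 1" "?y = Inl k' \<or> (\<exists>u\<in>own t' k'. ?y = Inr u)" by blast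
        \<comment> \<open>An internal vertex belongs to one tree only, so a symbol found in the
          portions of both twins is a root.\<close>
        have "own t k \<inter> own t' k' = {}" using own_disjoint[OF k(2-4) k'(2-4)] False by simp
        then have y: "?y = Inl k" using k(6) k'(5) by auto
        obtain t1 t2 where ts: "ts i = [t1, t2]" "t1 \<noteq> t2" using ts_props[OF i] by auto
        obtain b0 where b0: "Suc b0 < length (Y i)" "YP i ! b0 = (t1, Inl k)" "YP i ! Suc b0 = (t2, Inl k)" "tgt i b0 = tgt i (Suc b0)"
          using portions_meet[OF i ts(1) k(3)] k(4,5) by auto
        have tt: "t = t1 \<and> t' = t2 \<or> t = t2 \<and> t' = t1" using False k(1) k'(1) ts by auto
        have any: "(ov i (tgt i b), ov i (tgt i b0)) \<in> CR" if "b < length (Y i)" "YP i ! b = (a, Inl k)" "a = t1 \<or> a = t2" for b a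
          using that same_portion_CR[OF i that(1), of b0 a "Inl k"] same_portion_CR[OF i that(1), of "Suc b0" a "Inl k"] b0 by auto
        have "(ov i (tgt i b), ov i (tgt i b0)) \<in> CR" "(ov i (tgt i b'), ov i (tgt i b0)) \<in> CR"
          using any[OF m(1)] any[OF mid(1)] b b' y tt by auto
        then show ?thesis using CR_trans CR_sym m(2) mid(2) by blast
      qed
    next
      case first then show ?thesis using m eq mid_sym(1)[OF i m(1,3)] by simp
    next
      case last then show ?thesis using m eq mid_sym(2)[OF i m(1,3)] by simp
    qed
  qed
qed

lemma symbol_cases:
  assumes "i < s" "q \<le> Suc M"
  obtains (corner) a where "a < s" "lab i (X i ! q) = c a" "(ov i q, U_corner s M a) \<in> CR" "X i ! q = Inl 0 \<or> X i ! q = Inl (Len i - 1)"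
    | (interior) k where "X i ! q = Inl k" "1 \<le> k" "k < Len i - 1" "lab i (X i ! q) \<in> set (I i)"
    | (inner) u t k where "X i ! q = Inr u" "t \<in> set (ts i)" "t < s" "1 \<le> k" "k < Len t - 1" "u \<in> own t k" "lab i (X i ! q) = u" "u \<in> inner"
proof (cases rule: X_cases[OF assms, case_names first last mid])
  case first
  have "(ov i q, ov i 0) \<in> CR" using pad_CR[OF assms(1) first(1)] CR_sym by blast
  then show thesis using corner[of "if pos i then i else Suc i mod s"] first ov_first[OF assms(1)] Os_first[OF assms(1)] Suc_mod[OF assms(1)] assms(1)
    by (auto simp: lab_def split: if_splits)
next
  case last
  then show thesis using corner[of "if pos i then Suc i mod s else i"] ov_last[OF assms(1)] Os_last[OF assms(1)] Suc_mod[OF assms(1)] assms(1) CR_refl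
    by (auto simp: lab_def split: if_splits)
next
  case (mid b t)
  have "(t, X i ! q) \<in> set (YP i)" using mid(1,3) length_YP by (metis nth_mem)
  from YP_mem[OF assms(1) this] obtain k where k: "t \<in> set (ts i)" "t < s" "1 \<le> k" "k < Len t - 1" "Len t = Len i"
    "X i ! q = Inl k \<or> (\<exists>u\<in>own t k. X i ! q = Inr u)" by blast
  from k(6) show thesis
  proof
    assume "X i ! q = Inl k"
    then show thesis using interior[of k] k Os_interior[OF assms(1), of k] by (simp add: lab_def)
  next
    assume "\<exists>u\<in>own t k. X i ! q = Inr u"
    then obtain u where "u \<in> own t k" "X i ! q = Inr u" by blast
    then show thesis using inner[of u t k] k own_inner[OF k(2-4)] by (auto simp: lab_def)
  qed
qed

lemma inner_outer: "u \<in> inner \<Longrightarrow> u \<notin> set (outer P)" by (simp add: inner_def)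

lemma I_outer: "i < s \<Longrightarrow> z \<in> set (I i) \<Longrightarrow> z \<in> set (outer P) \<and> (\<forall>a<s. z \<noteq> c a)"
proof -
  assume i: "i < s" "z \<in> set (I i)"
  have "z \<noteq> c a" if "a < s" for a
    using blocks(1)[OF i(1)] blocks(2)[OF i(1) that] i by (cases "a = i") auto
  then show ?thesis using i by (auto simp: set_outer)
qed

text \<open>A corner label leads to one and the same corner of the target from either of its sides.
  An interior vertex of a side determines the side and its number. An internal vertex determines its
  tree and thereby the pair of twins, whose words agree.\<close>

lemma same_label_CR:
  assumes i: "i < s" "q \<le> Suc M" and j: "j < s" "q' \<le> Suc M" and eq: "lab i (X i ! q) = lab j (X j ! q')"
  shows "(ov i q, ov j q') \<in> CR"
proof (cases rule: symbol_cases[OF i, case_names corner interior inner])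
  case (corner a)
  show ?thesis
  proof (cases rule: symbol_cases[OF j, case_names corner interior inner])
    case (corner a')
    then have "a = a'" using \<open>lab i (X i ! q) = c a\<close> \<open>a < s\<close> eq c_inj by metis
    then show ?thesis using corner \<open>(ov i q, U_corner s M a) \<in> CR\<close> CR_sym CR_trans by blast
  next
    case (interior k') then show ?thesis using corner eq I_outer[OF j(1)] by auto
  next
    case (inner u t k') then show ?thesis using corner eq inner_outer c_outer by auto
  qed
next
  case (interior k)
  note int = interior
  show ?thesis
  proof (cases rule: symbol_cases[OF j, case_names corner interior inner])
    case (corner a') then show ?thesis using int eq I_outer[OF i(1)] by auto
  next
    case (interior k')
    have "Os i ! k = Os j ! k'" using int interior eq by (simp add: lab_def)
    then have "i = j" "k = k'" using Os_inj[OF i(1) int(2,3) j(1) interior(2,3)] by auto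
    then show ?thesis using same_symbol_CR[OF i(1,2), of q'] j int interior by simp
  next
    case (inner u t k') then show ?thesis using int eq inner_outer I_outer[OF i(1)] by auto
  qed
next
  case (inner u t k)
  note inn = inner
  show ?thesis
  proof (cases rule: symbol_cases[OF j, case_names corner interior inner])
    case (corner a') then show ?thesis using inn eq inner_outer c_outer by auto
  next
    case (interior k') then show ?thesis using inn eq inner_outer I_outer[OF j(1)] by auto
  next
    case (inner u' t' k')
    have u: "u = u'" using inn inner eq by simp
    then have "(t, k) = (t', k')" using own_disjoint[OF inn(3-5) inner(3-5)] inn(6) inner(6) by blast
    then have "ts i = ts j" using ts_twin[OF i(1) inn(2)] ts_twin[OF j(1) inner(2)] by simp
    then have jt: "j \<in> set (ts i)" using j(1) by (simp add: ts_def)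
    then consider "j = i" | "twin P i j" using ts_twin[OF i(1) jt] by blast
    then show ?thesis
    proof cases
      case 1 then show ?thesis using same_symbol_CR[OF i(1,2) j(2)] inn(1) inner(1) u by simp
    next
      case 2
      have "X i ! q = X i ! q'" using twin_same(3)[OF 2] inn(1) inner(1) u by simp
      then have "(ov i q, ov i q') \<in> CR" using same_symbol_CR[OF i(1,2) j(2)] by simp
      then show ?thesis using CR_twin[OF 2 j(2)] CR_trans by blast
    qed
  qed
qed

lemma to_pos:
  assumes "x \<in> verts U" "L x = Some v"
  shows "\<exists>i q. i < s \<and> q \<le> Suc M \<and> lab i (X i ! q) = v \<and> (x, ov i q) \<in> CR"
proof -
  from assms(1) consider (g) i j where "x = gp i j" "j \<le> i" "i < s * M" | (c) a where "x = U_corner s M a" "a < s"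
    unfolding verts_U by blast
  then show ?thesis
  proof cases
    case g
    then obtain h where h: "h < s * M" "labd h = v" "(x, gp h h) \<in> CR" using grid_to_diag[OF g(2,3)] assms(2) by blast
    obtain i q where iq: "i < s" "1 \<le> q" "q \<le> M" "ov i q = gp h h" "dg i q = h" using diag_ov[OF h(1)] by blast
    then show ?thesis using dg_props(3)[OF iq(1-3)] h by (intro exI[of _ i] exI[of _ q]) auto
  next
    case c
    \<comment> \<open>Corner \<open>a\<close> is the clockwise start of side \<open>a\<close>, hence
      its last position if the orientation is negative.\<close>
    let ?q = "if pos a then 0 else Suc M"
    have q: "?q \<le> Suc M" by simp
    have o: "ov a ?q = x" using c ov_first[of a] ov_last[of a] by auto
    then have "lab a (X a ! ?q) = v" using L_ov[OF c(2) q] assms(2) by simp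
    then show ?thesis using c(2) q o CR_refl by metis
  qed
qed

section \<open>Consecutive vertices in the symbol words\<close>

definition Yn :: "nat \<Rightarrow> nat \<Rightarrow> nat \<Rightarrow> (nat + complex) list" where
  "Yn t1 t2 n = concat (map (\<lambda>k. rw t1 k @ rw t2 k) [1..<n])"

text \<open>\<open>Yn\<close> is the word cut off before number \<open>n\<close>, which allows
  induction. The walks at one place begin and end with their root, so the numbers \<open>k\<close>
  and \<open>Suc k\<close> are neighbours where two places meet; \<open>Inl 0\<close> in front plays
  the first corner.\<close>

lemma Yn_struct:
  assumes t: "t1 < s" "t2 < s" "Len t1 = l" "Len t2 = l" and n: "1 \<le> n" "n \<le> l - 1"
  shows "successively inl_step (Inl 0 # Yn t1 t2 n) \<and> last (Inl 0 # Yn t1 t2 n) = Inl (n - 1) \<and>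
    (\<forall>k<n. \<exists>A B. Inl 0 # Yn t1 t2 n @ [Inl n] = A @ Inl k # Inl (Suc k) # B)"
  using n
proof (induction n rule: dec_induct)
  case base show ?case by (auto simp: Yn_def)
next
  case (step n)
  then have IH: "successively inl_step (Inl 0 # Yn t1 t2 n)" "last (Inl 0 # Yn t1 t2 n) = Inl (n - 1)"
    "\<And>k. k < n \<Longrightarrow> \<exists>A B. Inl 0 # Yn t1 t2 n @ [Inl n] = A @ Inl k # Inl (Suc k) # B" by auto
  let ?g = "rw t1 n @ rw t2 n"
  have Y: "Inl 0 # Yn t1 t2 (Suc n) = (Inl 0 # Yn t1 t2 n) @ ?g" using step by (simp add: Yn_def)
  have n1: "1 \<le> n" "n < Len t1 - 1" "n < Len t2 - 1" using step t by auto
  have tw: "tree_word (Inl n) (rw t1 n)" "tree_word (Inl n) (rw t2 n)" using tree_word_rw t n1 by auto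
  note te = tree_word_ends[OF tw(1)] tree_word_ends[OF tw(2)]
  have gl: "last ?g = Inl n" "hd ?g = Inl n" "?g \<noteq> []" using te by auto
  have "successively inl_step ?g"
    by (rule successively_inl_const[of _ n]) (use set_rw[OF t(1) n1(1,2)] set_rw[OF t(2) n1(1,3)] in auto)
  moreover have "inl_step (Inl (n - 1)) (Inl n)" using n1 by (auto simp: inl_step_def)
  ultimately have s: "successively inl_step ((Inl 0 # Yn t1 t2 n) @ ?g)"
    using IH gl by (subst successively_append_iff) auto
  obtain g' where g': "?g = Inl n # g'" using gl by (metis list.collapse)
  obtain g'' where g'': "(Inl 0 # Yn t1 t2 n) @ ?g = g'' @ [Inl n]" using gl
    by (metis append_butlast_last_id append_is_Nil_conv last_appendR)
  have "\<exists>A B. (Inl 0 # Yn t1 t2 n) @ ?g @ [Inl (Suc n)] = A @ Inl k # Inl (Suc k) # B" if k: "k < Suc n" for k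
  proof (cases "k = n")
    case True
    then have "(Inl 0 # Yn t1 t2 n) @ ?g @ [Inl (Suc n)] = g'' @ Inl k # Inl (Suc k) # []" using g'' by simp
    then show ?thesis by blast
  next
    case False
    then obtain A B where "Inl 0 # Yn t1 t2 n @ [Inl n] = A @ Inl k # Inl (Suc k) # B" using IH(3)[of k] k by auto
    then have "(Inl 0 # Yn t1 t2 n) @ ?g @ [Inl (Suc n)] = A @ Inl k # Inl (Suc k) # (B @ g' @ [Inl (Suc n)])"
      unfolding g' by (metis (no_types, lifting) append.assoc append_Cons append_Nil)
    then show ?thesis by blast
  qed
  then have "\<forall>k<Suc n. \<exists>A B. Inl 0 # Yn t1 t2 (Suc n) @ [Inl (Suc n)] = A @ Inl k # Inl (Suc k) # B"
    using Y by (metis append.assoc append_Cons)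
  then have "\<forall>k<Suc n. \<exists>A B. ((Inl 0 # Yn t1 t2 n) @ ?g) @ [Inl (Suc n)] = A @ Inl k # Inl (Suc k) # B"
    unfolding Y[symmetric] by simp
  moreover have "last ((Inl 0 # Yn t1 t2 n) @ ?g) = Inl (Suc n - 1)" using gl(1) by (subst last_appendR[OF gl(3)]) simp
  ultimately show ?case using s unfolding append_Cons[symmetric] Y by blast
qed

lemma X_struct: assumes i: "i < s"
  shows "successively inl_step (X i)" "\<And>k. Suc k < Len i \<Longrightarrow> \<exists>A B. X i = A @ Inl k # Inl (Suc k) # B"
proof -
  obtain t1 t2 where t: "ts i = [t1, t2]" "t1 < s" "t2 < s" using ts_props[OF i] by auto
  have Ln: "Len t1 = Len i" "Len t2 = Len i" using ts_twin[OF i] t by auto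
  let ?n = "Len i - 1"
  have n: "1 \<le> ?n" "?n \<le> Len i - 1" using Len_ge[of i] by auto
  have Y: "Yn t1 t2 ?n = Y i" using Y_concat[OF i t(1)] by (simp add: Yn_def)
  note st = Yn_struct[OF t(2,3) Ln n, unfolded Y]
  have mem: "y \<noteq> Inl 0 \<and> y \<noteq> Inl ?n" if y: "y \<in> set (Y i)" for y
  proof -
    obtain b where "b < length (Y i)" "Y i ! b = y" using y by (metis in_set_conv_nth)
    then have "YP i ! b = (fst (YP i ! b), y)" by (auto simp: Y_def)
    then show ?thesis using mid_sym[OF i \<open>b < length (Y i)\<close>] by blast
  qed
  let ?Z = "Inl 0 # Y i @ [Inl ?n]"
  have R: "remdups_adj ?Z = Inl 0 # remdups_adj (Y i) @ [Inl ?n]"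
  proof (cases "Y i = []")
    case True then show ?thesis using n by simp
  next
    case False
    then have "last (Y i) \<noteq> Inl ?n" "hd (Y i) \<noteq> Inl 0" using mem last_in_set hd_in_set by metis+
    obtain y ys where y: "Y i = ys @ [y]" using False by (metis append_butlast_last_id)
    have "remdups_adj (Y i @ [Inl ?n]) = remdups_adj (Y i) @ [Inl ?n]"
      using remdups_adj_append_two[of ys y "Inl ?n"] \<open>last (Y i) \<noteq> Inl ?n\<close> y by simp
    moreover have "remdups_adj (Inl 0 # (Y i @ [Inl ?n])) = Inl 0 # remdups_adj (Y i @ [Inl ?n])"
      using \<open>hd (Y i) \<noteq> Inl 0\<close> False by (cases "Y i") auto
    ultimately show ?thesis by simp
  qed
  have X: "X i = replicate (pad i) (Inl 0) @ remdups_adj ?Z" unfolding R X_def by (simp add: replicate_app_Cons_same)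
  have "inl_step (last (Inl 0 # Y i)) (Inl ?n)" using st n by (auto simp: inl_step_def)
  then have "successively inl_step ((Inl 0 # Y i) @ [Inl ?n])" using st by (subst successively_append_iff) auto
  then have "successively inl_step (remdups_adj ?Z)" by (intro successively_remdups_adjI) simp
  moreover have "successively inl_step (replicate (pad i) (Inl 0 :: nat + complex))"
    by (rule successively_inl_const[of _ 0]) auto
  moreover have "inl_step (Inl 0) (Inl 0 :: nat + complex)" by (auto simp: inl_step_def)
  moreover have "last (replicate (pad i) (Inl 0 :: nat + complex)) = Inl 0" if "pad i \<noteq> 0" using that by simp
  ultimately show "successively inl_step (X i)" unfolding X R
    by (subst successively_append_iff) (cases "pad i = 0"; simp)
  fix k assume "Suc k < Len i"
  then obtain A B where "?Z = A @ Inl k # Inl (Suc k) # B" using st by (metis less_diff_conv Suc_eq_plus1)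
  then obtain A' B' where "remdups_adj ?Z = A' @ Inl k # Inl (Suc k) # B'"
    using remdups_adj_keeps_pair[of "Inl k" "Inl (Suc k)" A B] by auto
  then show "\<exists>A B. X i = A @ Inl k # Inl (Suc k) # B" unfolding X by (metis append.assoc)
qed

lemma X_step: assumes "i < s" "q \<le> M" "X i ! q = Inl k" "X i ! Suc q = Inl k'" shows "k' = k \<or> k' = Suc k"
proof -
  have "inl_step (X i ! q) (X i ! Suc q)"
    using X_struct(1)[OF assms(1)] length_X[OF assms(1)] assms(2) by (auto simp: successively_conv_nth)
  then show ?thesis using assms by (auto simp: inl_step_def)
qed

lemma X_consec: assumes "i < s" "Suc k < Len i" shows "\<exists>q\<le>M. X i ! q = Inl k \<and> X i ! Suc q = Inl (Suc k)"
proof -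
  obtain A B where AB: "X i = A @ Inl k # Inl (Suc k) # B" using X_struct(2)[OF assms] by blast
  have "length A \<le> M" using length_X[OF assms(1)] AB by simp
  then show ?thesis unfolding AB by (intro exI[of _ "length A"]) (auto simp: nth_append)
qed

lemma X_occurs: assumes "i < s" "k < Len i" shows "\<exists>q\<le>Suc M. X i ! q = Inl k"
proof (cases "Suc k < Len i")
  case True then show ?thesis using X_consec[OF assms(1) True] le_SucI by blast
next
  case False
  then have "k = Len i - 1" using assms by simp
  then show ?thesis using X_last[OF assms(1)] by blast
qed

lemma lab_verts: assumes "i < s" "q \<le> Suc M" shows "lab i (X i ! q) \<in> verts P"
  using outer_verts c_outer I_outer[OF assms(1)] by (cases rule: symbol_cases[OF assms, case_names corner interior inner]) (auto simp: inner_def)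

text \<open>An identification in \<open>P\<close> at place \<open>k\<close> of twins
  \<open>a\<close> and \<open>b\<close> is imitated at a position \<open>p\<close> whose symbol is
  \<open>Inl k\<close>. Twins have equal words, so \<open>p\<close> carries this symbol on both
  sides, and sewing identifies the two positions.\<close>

lemma class_CR:
  assumes "(v, w) \<in> (vertex_ident P)\<^sup>*" "i < s" "q \<le> Suc M" "lab i (X i ! q) = v"
    "j < s" "q' \<le> Suc M" "lab j (X j ! q') = w"
  shows "(ov i q, ov j q') \<in> CR"
  using assms(1,5-7)
proof (induction arbitrary: j q')
  case base then show ?case using same_label_CR[OF assms(2,3) base(1,2)] assms(4) by simp
next
  case (step w w')
  obtain a b k where abk: "w = Os a ! k" "w' = Os b ! k" "twin P a b" "k < length (side P a)"
    using step(2) by (auto simp: vertex_ident_def)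
  note tt = twin_ts[OF abk(3)]
  have "k < Len a" using abk(4) length_Os[of a] tt by (simp add: length_oriented_side)
  then obtain p where p: "p \<le> Suc M" "X a ! p = Inl k" using X_occurs[of a k] tt by blast
  have "(ov i q, ov a p) \<in> CR" using step.IH[of a p] tt p abk by (simp add: lab_def)
  moreover have "(ov a p, ov b p) \<in> CR" using CR_twin[OF abk(3) p(1)] .
  moreover have "X b ! p = Inl k" using twin_same(3)[OF abk(3)] p by simp
  then have "(ov b p, ov j q') \<in> CR" using same_label_CR[of b p j q'] tt p step.prems abk by (simp add: lab_def)
  ultimately show ?case using CR_trans by blast
qed

section \<open>Models of the edges\<close>

lemma side_pair: assumes "i < s" "Suc k < Len i" shows "{Os i ! k, Os i ! Suc k} \<in> cycle_edges (outer P)"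
proof -
  have "{Os i ! k, Os i ! Suc k} \<in> path_edges (Os i)" unfolding path_edges_conv_nth using assms length_Os by auto
  then have "{Os i ! k, Os i ! Suc k} \<in> path_edges (side P i)" by (simp add: Os_eq path_edges_rev split: if_splits)
  then show ?thesis unfolding outer using assms(1) s(2) by (subst cycle_edges_blocks) (auto simp: side_eq)
qed

lemma cycle_pair: assumes "p \<in> cycle_edges (outer P)" shows "\<exists>i k. i < s \<and> Suc k < Len i \<and> p = {Os i ! k, Os i ! Suc k}"
proof -
  have "p \<in> (\<Union>i<s. path_edges (c i # I i @ [c (Suc i mod s)]))"
    using assms s(2) unfolding outer by (subst (asm) cycle_edges_blocks) auto
  then obtain i where i: "i < s" "p \<in> path_edges (side P i)" by (auto simp: side_eq)
  then have "p \<in> path_edges (Os i)" by (simp add: Os_eq path_edges_rev)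
  then show ?thesis unfolding path_edges_conv_nth using i(1) length_Os[OF i(1)] by auto
qed

lemma cycle_pair_outer: "p \<in> cycle_edges (outer P) \<Longrightarrow> p \<subseteq> set (outer P)"
proof -
  assume "p \<in> cycle_edges (outer P)"
  then obtain i k where ik: "i < s" "Suc k < Len i" "p = {Os i ! k, Os i ! Suc k}" using cycle_pair by blast
  have "Os i ! k \<in> set (Os i)" "Os i ! Suc k \<in> set (Os i)" using ik(2) length_Os[OF ik(1)] by auto
  then show ?thesis using set_Os[OF ik(1)] ik(3) by blast
qed

lemma off_diag_not_ov: assumes "j < i" "i < s * M" "a < s" "q \<le> Suc M" shows "gp i j \<noteq> ov a q"
proof -
  consider "q = 0" | "q = Suc M" | "1 \<le> q" "q \<le> M" using assms(4) by linarith
  then show ?thesis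
  proof cases
    case 1 then show ?thesis using grid_point_neq_corner[OF _ assms(2)] assms(3) Suc_mod[of a] by (simp add: ov_first)
  next
    case 2 then show ?thesis using grid_point_neq_corner[OF _ assms(2)] assms(3) Suc_mod[of a] by (simp add: ov_last)
  next
    case 3 then show ?thesis using ov_diag[OF assms(3) 3] assms(1) by simp
  qed
qed

lemma edge_ident_U: assumes "(f, f') \<in> edge_ident U"
  obtains i j q where "twin P i j" "i < s" "j < s" "q \<le> M" "f \<inter> verts U = {ov i q, ov i (Suc q)}" "f' \<inter> verts U = {ov j q, ov j (Suc q)}"
proof -
  obtain i j q where *: "twin P i j" "Suc q < length (side U i)" "f \<inter> verts U = {ov i q, ov i (Suc q)}" "f' \<inter> verts U = {ov j q, ov j (Suc q)}"
    using assms unfolding edge_ident_def twin_U by blast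
  then show thesis using that[of i j q] twin_ts[OF *(1)] length_side_U[of i] by auto
qed

text \<open>The edge that realises the chord has an end off the diagonal, so it is identified with
  no other edge and only the edge itself has to be checked.\<close>

lemma inner_edge_model:
  assumes "e \<in> edges P" "e \<inter> verts P \<in> F"
  shows "\<exists>f\<in>edges U. L ` (f \<inter> verts U) = Some ` (e \<inter> verts P) \<and>
       (\<forall>f'. (f, f') \<in> (edge_ident U)\<^sup>* \<longrightarrow> (\<exists>e'. (e, e') \<in> (edge_ident P)\<^sup>* \<and> L ` (f' \<inter> verts U) = Some ` (e' \<inter> verts P)))"
proof -
  obtain g h where gh: "(g, h) \<in> Ch" "e \<inter> verts P = {labd g, labd h}" using Ch(3)[OF assms(2)] by blast
  obtain f x y where f: "f \<in> edges U" "f \<inter> verts U = {x, y}" "L x = Some (labd g)" "L y = Some (labd h)" "gp h g \<in> {x, y}"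
    using chord_edge[OF gh(1)] by blast
  have lab: "L ` (f \<inter> verts U) = Some ` (e \<inter> verts P)" using f gh by simp
  have no: "(f, f') \<notin> edge_ident U" for f'
  proof
    assume "(f, f') \<in> edge_ident U"
    then obtain i j q where "i < s" "q \<le> M" "f \<inter> verts U = {ov i q, ov i (Suc q)}" by (rule edge_ident_U)
    then have "gp h g = ov i q \<or> gp h g = ov i (Suc q)" using f by auto
    then show False using off_diag_not_ov[of g h i q] off_diag_not_ov[of g h i "Suc q"] Ch(2)[OF gh(1)] \<open>i < s\<close> \<open>q \<le> M\<close> by auto
  qed
  have "f' = f" if "(f, f') \<in> (edge_ident U)\<^sup>*" for f' using that no by (metis converse_rtranclE)
  then show ?thesis using f(1) lab by (intro bexI[of _ f]) auto
qed

text \<open>The model lies on a side, between symbols \<open>Inl k\<close> and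
  \<open>Inl (Suc k)\<close>, so that sewing treats it like the original. Every identification on
  the target side is then matched by one between edges of \<open>P\<close>, which is followed step
  by step.\<close>

lemma outer_edge_model:
  assumes "e \<in> edges P" "e \<inter> verts P \<in> cycle_edges (outer P)"
  shows "\<exists>f\<in>edges U. L ` (f \<inter> verts U) = Some ` (e \<inter> verts P) \<and>
       (\<forall>f'. (f, f') \<in> (edge_ident U)\<^sup>* \<longrightarrow> (\<exists>e'. (e, e') \<in> (edge_ident P)\<^sup>* \<and> L ` (f' \<inter> verts U) = Some ` (e' \<inter> verts P)))"
proof -
  obtain i k where ik: "i < s" "Suc k < Len i" "e \<inter> verts P = {Os i ! k, Os i ! Suc k}" using cycle_pair[OF assms(2)] by blast
  obtain q where q: "q \<le> M" "X i ! q = Inl k" "X i ! Suc q = Inl (Suc k)" using X_consec[OF ik(1,2)] by blast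
  let ?f = "closed_segment (ov i q) (ov i (Suc q))"
  note fe = side_edge_U[OF ik(1) q(1)]
  have lab0: "L ` (?f \<inter> verts U) = Some ` (e \<inter> verts P)"
    unfolding fe(2) ik(3) using L_ov[OF ik(1), of q] L_ov[OF ik(1), of "Suc q"] q by (simp add: lab_def)
  have "\<exists>e'. (e, e') \<in> (edge_ident P)\<^sup>* \<and> L ` (f' \<inter> verts U) = Some ` (e' \<inter> verts P) \<and> e' \<in> edges P \<and> e' \<inter> verts P \<in> cycle_edges (outer P)"
    if "(?f, f') \<in> (edge_ident U)\<^sup>*" for f'
    using that
  proof induction
    case base then show ?case using lab0 assms by blast
  next
    case (step f' f'')
    then obtain e' where e': "(e, e') \<in> (edge_ident P)\<^sup>*" "L ` (f' \<inter> verts U) = Some ` (e' \<inter> verts P)" "e' \<in> edges P" "e' \<inter> verts P \<in> cycle_edges (outer P)" by blast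
    obtain a b p where ab: "twin P a b" "a < s" "b < s" "p \<le> M" "f' \<inter> verts U = {ov a p, ov a (Suc p)}" "f'' \<inter> verts U = {ov b p, ov b (Suc p)}"
      using step(2) by (rule edge_ident_U)
    have p: "p \<le> Suc M" "Suc p \<le> Suc M" using ab(4) by auto
    have l: "L (ov a p) = Some (lab a (X a ! p))" "L (ov a (Suc p)) = Some (lab a (X a ! Suc p))"
      "L (ov b p) = Some (lab b (X b ! p))" "L (ov b (Suc p)) = Some (lab b (X b ! Suc p))" using L_ov ab p by auto
    have "Some ` {lab a (X a ! p), lab a (X a ! Suc p)} = Some ` (e' \<inter> verts P)" using e'(2) l ab(5) by simp
    then have ends: "e' \<inter> verts P = {lab a (X a ! p), lab a (X a ! Suc p)}" by (simp only: inj_image_eq_iff[OF inj_Some])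
    then have out: "lab a (X a ! p) \<in> set (outer P)" "lab a (X a ! Suc p) \<in> set (outer P)" using cycle_pair_outer[OF e'(4)] by auto
    have inl: "\<exists>k. X a ! q = Inl k \<and> k < Len a" if "q \<le> Suc M" "lab a (X a ! q) \<in> set (outer P)" for q
      using that(2) Len_ge[of a] inner_outer by (cases rule: symbol_cases[OF ab(2) that(1), case_names corner interior inner]) auto
    obtain k1 where k1: "X a ! p = Inl k1" "k1 < Len a" using inl[OF p(1) out(1)] by blast
    obtain k2 where k2: "X a ! Suc p = Inl k2" "k2 < Len a" using inl[OF p(2) out(2)] by blast
    obtain u v where "u \<noteq> v" "e' \<inter> verts P = {u, v}" using edges_two[OF e'(3)] by blast
    \<comment> \<open>The labels are the two ends of an edge, so the numbers differ, and
      neighbouring numbers grow by at most one. They name consecutive vertices of the side, and the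
      same two places on the twin give the partner of \<open>e'\<close>.\<close>
    then have "k1 \<noteq> k2" using ends k1 k2 by (auto simp: doubleton_eq_iff)
    then have k: "k2 = Suc k1" using X_step[OF ab(2,4) k1(1) k2(1)] by simp
    have e'1: "e' \<inter> verts P = {Os a ! k1, Os a ! Suc k1}" using ends k1 k2 k by (simp add: lab_def)
    note tt = twin_ts[OF ab(1)]
    have pr: "{Os b ! k1, Os b ! Suc k1} \<in> cycle_edges (outer P)" using side_pair[OF ab(3)] k2 k tt by simp
    obtain e'' where e'': "e'' \<in> edges P" "e'' \<inter> verts P = {Os b ! k1, Os b ! Suc k1}" using cycle_drawn[OF pr] by blast
    have "Suc k1 < length (side P a)" using k2 k length_Os[OF ab(2)] by (simp add: length_oriented_side)
    then have "(e', e'') \<in> edge_ident P" unfolding edge_ident_def using e'(3) e'' e'1 ab(1) by blast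
    moreover have "L ` (f'' \<inter> verts U) = Some ` (e'' \<inter> verts P)"
      unfolding ab(6) e''(2) using l k1 k2 k twin_same(3)[OF ab(1)] by (simp add: lab_def)
    ultimately show ?case using e'(1) e'' pr by (metis rtrancl.rtrancl_into_rtrancl)
  qed
  then show ?thesis using fe(1) lab0 by (intro bexI[of _ ?f] conjI allI impI) blast+
qed

theorem sewing_minor_U: "minor_of (sewing P) (sewing U)"
proof (rule sewing_minor[OF sewable_P sewable_U edges_two edges_simple])
  show "v \<in> verts P" if "x \<in> verts U" "L x = Some v" for x v
    using to_pos[OF that] lab_verts by blast
  show "\<exists>w. L y = Some w \<and> (v, w) \<in> (vertex_ident P)\<^sup>*" if xy: "(x, y) \<in> vertex_ident U" "L x = Some v" for x y v
  proof -
    obtain i j q where *: "x = ov i q" "y = ov j q" "twin P i j" "q < length (side U i)"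
      using xy(1) unfolding vertex_ident_def twin_U by blast
    note tt = twin_ts[OF *(3)]
    have q: "q \<le> Suc M" using *(4) length_side_U[of i] tt by simp
    have v: "v = lab i (X i ! q)" using L_ov[of i q] q tt xy(2) * by simp
    have y: "L y = Some (lab j (X i ! q))" using L_ov[of j q] q tt * twin_same(3)[OF *(3)] by simp
    have "(lab i (X i ! q), lab j (X i ! q)) \<in> (vertex_ident P)\<^sup>*"
    proof (cases "X i ! q")
      case (Inl k)
      have i: "i < s" using tt by simp
      have "k < Len i" using Inl Len_ge[of i] by (cases rule: symbol_cases[OF i q]) auto
      then have "(Os i ! k, Os j ! k) \<in> vertex_ident P"
        unfolding vertex_ident_def using *(3) length_Os[of i] tt
        by (intro CollectI exI[of _ i] exI[of _ j] exI[of _ k]) (auto simp: length_oriented_side)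
      then show ?thesis using Inl by (auto simp: lab_def)
    next
      case (Inr u) then show ?thesis by (simp add: lab_def)
    qed
    then show ?thesis using y v by blast
  qed
  show "(x, y) \<in> (vertex_ident U \<union> {(a, b). (\<exists>f\<in>edges U. f \<inter> verts U = {a, b}) \<and> L a = L b})\<^sup>*"
    if xy: "x \<in> verts U" "y \<in> verts U" "L x = Some v" "L y = Some w" "(v, w) \<in> (vertex_ident P)\<^sup>*" for x y v w
  proof -
    obtain i q where i: "i < s" "q \<le> Suc M" "lab i (X i ! q) = v" "(x, ov i q) \<in> CR" using to_pos[OF xy(1,3)] by blast
    obtain j q' where j: "j < s" "q' \<le> Suc M" "lab j (X j ! q') = w" "(y, ov j q') \<in> CR" using to_pos[OF xy(2,4)] by blast
    have "(ov i q, ov j q') \<in> CR" by (rule class_CR[OF xy(5) i(1-3) j(1-3)])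
    then have "(x, y) \<in> CR" using i(4) j(4) CR_trans CR_sym by blast
    then show ?thesis unfolding CR_def .
  qed
  show "\<exists>x\<in>verts U. L x = Some v" if v: "v \<in> verts P" for v
  proof -
    obtain z where z: "z \<in> set (outer P)" "v \<in> set (wd z)" using v wd_un by blast
    obtain a where a: "a < s" "z \<in> set (c a # I a)" using z(1) unfolding set_outer by blast
    show ?thesis
    proof (cases "z = c a")
      case True
      then have "v = c a" using z wd_corner[OF a(1)] by simp
      then show ?thesis using L_corner[OF a(1)] a(1) by (intro bexI[of _ "U_corner s M a"]) (auto simp: verts_U)
    next
      case False
      then have "z \<in> set (I a)" using a by auto
      then obtain k where k: "k \<in> set (if pos a then [1..<Len a - 1] else rev [1..<Len a - 1])" "z = Os a ! k"
        using map_Os_interior[OF a(1)] by (metis (no_types, lifting) imageE set_map)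
      then have k1: "1 \<le> k" "k < Len a - 1" by (auto split: if_splits)
      let ?y = "if v = z then Inl k else Inr v"
      have y: "?y \<in> set (rw a k)" using z(2) k(2) by (auto simp: rw_def Let_def)
      have "a \<in> set (ts a)" using a(1) by (simp add: ts_def)
      then have "(k, a) \<in> set (PL a)" using k1 by (auto simp: PL_def)
      then have "(a, ?y) \<in> set (YP a)" using y by (force simp: YP_def)
      then have "?y \<in> set (Y a)" unfolding Y_def by force
      then obtain b where b: "b < length (Y a)" "Y a ! b = ?y" by (metis in_set_conv_nth)
      note tg = tgt_props[OF a(1) b(1)]
      have q: "tgt a b \<le> Suc M" using tg by simp
      have "L (ov a (tgt a b)) = Some v" using L_ov[OF a(1) q] tg b k(2) by (simp add: lab_def)
      then show ?thesis using ov_verts[OF a(1) q] by blast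
    qed
  qed
  show "\<exists>f\<in>edges U. L ` (f \<inter> verts U) = Some ` (e \<inter> verts P) \<and>
       (\<forall>f'. (f, f') \<in> (edge_ident U)\<^sup>* \<longrightarrow> (\<exists>e'. (e, e') \<in> (edge_ident P)\<^sup>* \<and> L ` (f' \<inter> verts U) = Some ` (e' \<inter> verts P)))"
    if "e \<in> edges P" for e
    using edges_cases[OF that] inner_edge_model[OF that] outer_edge_model[OF that] by blast
qed

end

section \<open>Polygonal embeddings\<close>

lemma cycle_edges_at_vertex:
  assumes "distinct vs" "3 \<le> length vs" "v \<in> set vs"
  shows "\<exists>p\<in>cycle_edges vs. \<exists>q\<in>cycle_edges vs. p \<noteq> q \<and> v \<in> p \<and> v \<in> q"
proof -
  have ne: "vs \<noteq> []" using assms by auto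
  obtain k where k: "k < length vs" "v = vs ! k" using assms(3) by (metis in_set_conv_nth)
  define k' where "k' = (if k = 0 then length vs - 1 else k - 1)"
  let ?n = "Suc k mod length vs"
  have k': "k' < length vs" "Suc k' mod length vs = k" using k assms(2) by (auto simp: k'_def)
  have n: "?n < length vs" "?n \<noteq> k" "?n \<noteq> k'"
    using k assms(2) by (auto simp: k'_def mod_Suc split: if_splits)
  let ?p = "{vs ! k, vs ! ?n}" and ?q = "{vs ! k', vs ! (Suc k' mod length vs)}"
  have "?p \<in> cycle_edges vs" "?q \<in> cycle_edges vs" unfolding cycle_edges_conv_nth[OF ne] using k k' by blast+
  moreover have "vs ! ?n \<noteq> vs ! k'" "vs ! ?n \<noteq> vs ! k"
    using n k(1) k'(1) by (simp_all add: nth_eq_iff_index_eq[OF assms(1)])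
  then have nq: "vs ! ?n \<notin> ?q" unfolding k'(2) by simp
  have "?p \<noteq> ?q"
  proof
    assume eq: "?p = ?q"
    have "vs ! ?n \<in> ?p" by simp
    then have "vs ! ?n \<in> ?q" by (simp only: eq)
    then show False using nq by contradiction
  qed
  moreover have "v \<in> ?p" "v \<in> ?q" using k(2) k'(2) by auto
  ultimately show ?thesis by (intro bexI[of _ ?p] bexI[of _ ?q] conjI)
qed

lemma Union_intervals:
  fixes t :: "nat \<Rightarrow> real"
  assumes "\<And>i. i < n \<Longrightarrow> t i < t (Suc i)" "0 < n"
  shows "(\<Union>i<n. {t i..t (Suc i)}) = {t 0..t n}"
  using assms
proof (induction n)
  case (Suc n)
  show ?case
  proof (cases "n = 0")
    case False
    then have "(\<Union>i<n. {t i..t (Suc i)}) = {t 0..t n}" using Suc by simp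
    moreover have "t 0 \<le> t n"
    proof -
      have "t 0 \<le> t k" if "k \<le> n" for k
        using that
      proof (induction k)
        case (Suc k) then show ?case using Suc.prems \<open>\<And>i. i < Suc n \<Longrightarrow> t i < t (Suc i)\<close>[of k] by simp
      qed simp
      then show ?thesis by simp
    qed
    moreover have "t n \<le> t (Suc n)" using Suc.prems(1)[of n] by simp
    ultimately show ?thesis by (auto simp: lessThan_Suc)
  qed (simp add: lessThan_Suc)
qed simp

theorem theorem2:
  fixes P :: "'a polygonal" and m n :: nat
  assumes "polygonal_embedding P"
    and "has_size P m n"
  shows "p_minor P (U_embedding (signature P) (m + 2 * n))"
proof -
  define V where "V = verts P"
  define E where "E = edges P"
  define vs where "vs = outer P"
  define G where "G = (\<lambda>e. e \<inter> V) ` E"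
  define \<delta> where "\<delta> p = (THE e. e \<in> E \<and> e \<inter> V = p)" for p
  have spg: "simple_plane_graph V E" and cpg: "connected_plane_graph V E" and coc: "clockwise_outer_cycle V E vs"
    and s2: "2 \<le> length (border P)" and sub: "subseq (border P) vs" and hd: "hd (border P) = hd vs"
    and deg: "\<forall>d\<in>set (border P). card {e \<in> E. d \<in> e} = 2"
    and ssig: "length (signature P) = length (border P)" and sig: "is_signature (signature P)"
    and twl: "\<forall>i j. twin P i j \<longrightarrow> length (side P i) = length (side P j)"
    using assms(1) unfolding polygonal_embedding_def V_def E_def vs_def by - (elim conjE, assumption)+
  have finV: "finite V" and finE: "finite E"
    and arcs: "\<forall>e\<in>E. \<exists>g. arc g \<and> path_image g = e \<and> e \<inter> V = {pathstart g, pathfinish g}"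
    and Eint: "\<forall>e\<in>E. \<forall>f\<in>E. e \<noteq> f \<longrightarrow> e \<inter> f \<subseteq> V"
    and simple: "\<forall>e\<in>E. \<forall>f\<in>E. e \<inter> V = f \<inter> V \<longrightarrow> e = f"
    using spg unfolding simple_plane_graph_def by - (elim conjE, assumption)+
  note arcs = bspec[OF arcs] and Eint = Eint[rule_format] and simple = simple[rule_format]
  note deg = bspec[OF deg] and twl = twl[rule_format]
  have conn: "(x, y) \<in> {(a, b). \<exists>e\<in>E. e \<inter> V = {a, b}}\<^sup>*" if "x \<in> V" "y \<in> V" for x y
    using bspec[OF bspec[OF cpg[unfolded connected_plane_graph_def] that(1)] that(2)] .
  have dvs: "distinct vs" and vsV: "set vs \<subseteq> V" and lvs: "3 \<le> length vs"
    using coc unfolding clockwise_outer_cycle_def by - (elim conjE, assumption)+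
  obtain \<gamma> t where \<gamma>: "simple_path \<gamma>" "pathfinish \<gamma> = pathstart \<gamma>" "path_image \<gamma> = frontier (outside (V \<union> \<Union>E))"
    "t 0 = 0" "t (length vs) = 1" "\<forall>i<length vs. t i < t (Suc i) \<and> \<gamma> (t i) = vs ! i \<and> \<gamma> ` {t i..t (Suc i)} \<in> E"
    using coc unfolding clockwise_outer_cycle_def by (elim conjE exE) (rule that)
  note \<gamma> = \<gamma>(1-5) \<gamma>(6)[rule_format]
  have two: "\<exists>a b. a \<noteq> b \<and> e \<inter> V = {a, b}" if "e \<in> E" for e
    using arcs[OF that] arc_distinct_ends by metis
  have \<delta>: "\<delta> (e \<inter> V) = e" if "e \<in> E" for e
    unfolding \<delta>_def by (rule the_equality) (use that simple in auto)
  interpret drawing V G \<delta>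
  proof
    show "finite G" using finE by (simp add: G_def)
    show "\<exists>g. arc g \<and> path_image g = \<delta> p \<and> p = {pathstart g, pathfinish g}" if "p \<in> G" for p
      using that arcs \<delta> by (auto simp: G_def)
    show "\<delta> p \<inter> V = p" if "p \<in> G" for p using that \<delta> by (auto simp: G_def)
    show "\<delta> p \<inter> \<delta> q \<subseteq> V" if pq: "p \<in> G" "q \<in> G" "p \<noteq> q" for p q
    proof -
      obtain e f where "e \<in> E" "f \<in> E" "p = e \<inter> V" "q = f \<inter> V" using pq by (auto simp: G_def)
      then show ?thesis using pq(3) Eint[of e f] \<delta> by auto
    qed
  qed
  have nvs: "vs \<noteq> []" "0 < length vs" using lvs by auto
  define ek where "ek k = \<gamma> ` {t k..t (Suc k)}" for k
  have ekE: "ek k \<in> E" if "k < length vs" for k using \<gamma>(6)[OF that] by (simp add: ek_def)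
  have ekV: "ek k \<inter> V = {vs ! k, vs ! (Suc k mod length vs)}" if k: "k < length vs" for k
  proof -
    have tk: "t k < t (Suc k)" "\<gamma> (t k) = vs ! k" using \<gamma>(6)[OF k] by auto
    have tS: "\<gamma> (t (Suc k)) = vs ! (Suc k mod length vs)"
    proof (cases "Suc k < length vs")
      case True then show ?thesis using \<gamma>(6)[OF True] by simp
    next
      case False
      then have "Suc k = length vs" using k by simp
      moreover have "\<gamma> 1 = \<gamma> 0" using \<gamma>(2) by (simp add: pathstart_def pathfinish_def)
      ultimately show ?thesis using \<gamma>(4,5) \<gamma>(6)[OF nvs(2)] by simp
    qed
    have mem: "vs ! k \<in> ek k" "vs ! (Suc k mod length vs) \<in> ek k"
      unfolding ek_def tk(2)[symmetric] tS[symmetric] by (rule imageI, use tk(1) in simp)+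
    have idx: "Suc k mod length vs < length vs" "Suc k mod length vs \<noteq> k" using k lvs by (auto simp: mod_Suc)
    have "vs ! k \<in> V" "vs ! (Suc k mod length vs) \<in> V"
      using subsetD[OF vsV nth_mem[OF k]] subsetD[OF vsV nth_mem[OF idx(1)]] .
    moreover have "vs ! k \<noteq> vs ! (Suc k mod length vs)"
      using nth_eq_iff_index_eq[OF dvs k idx(1)] idx(2) by simp
    moreover obtain a b where ab: "ek k \<inter> V = {a, b}" using two[OF ekE[OF k]] by blast
    moreover from calculation have "vs ! k \<in> {a, b}" "vs ! (Suc k mod length vs) \<in> {a, b}"
      unfolding ab[symmetric] using mem by simp_all
    ultimately have "{vs ! k, vs ! (Suc k mod length vs)} = {a, b}" by auto
    then show ?thesis using ab by simp
  qed
  have ce: "cycle_edges vs = (\<lambda>k. ek k \<inter> V) ` {..<length vs}"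
  proof -
    have "cycle_edges vs = (\<lambda>k. {vs ! k, vs ! (Suc k mod length vs)}) ` {..<length vs}"
      unfolding cycle_edges_conv_nth[OF nvs(1)] by (simp only: setcompr_eq_image lessThan_def)
    also have "\<dots> = (\<lambda>k. ek k \<inter> V) ` {..<length vs}" by (rule image_cong[OF refl]) (simp add: ekV)
    finally show ?thesis .
  qed
  have ceG: "cycle_edges vs \<subseteq> G" unfolding ce G_def by (rule image_subsetI) (simp add: ekE)
  have cyc: "cycle vs" using dvs lvs ceG by (simp add: cycle_def)
  have cv: "curve vs = path_image \<gamma>"
  proof -
    have "curve vs = (\<Union>k<length vs. ek k)" unfolding curve_def drawn_def ce using \<delta> ekE by auto
    also have "\<dots> = \<gamma> ` (\<Union>k<length vs. {t k..t (Suc k)})" unfolding ek_def by blast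
    also have "(\<Union>k<length vs. {t k..t (Suc k)}) = {0..1}"
      using Union_intervals[of "length vs" t] \<gamma>(4-6) nvs(2) by simp
    finally show ?thesis by (simp add: path_image_def)
  qed
  let ?S = "V \<union> \<Union>E" and ?J = "curve vs"
  have J: "jordan ?J" by (rule jordan_curve[OF cyc])
  have compS: "compact ?S"
  proof -
    have "compact e" if "e \<in> E" for e using arcs[OF that] compact_arc_image by metis
    then have "compact (\<Union>E)" by (intro compact_Union finE)
    then show ?thesis by (intro compact_Un finite_imp_compact[OF finV])
  qed
  have JS: "?J \<subseteq> ?S"
    using \<gamma>(3) cv frontier_outside_subset[OF compact_imp_closed[OF compS]] by simp
  \<comment> \<open>Nothing is drawn beyond the outer cycle: otherwise the connected set
    \<open>outside ?J\<close> would meet the frontier of its proper part \<open>outside ?S\<close>,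
    but this frontier is \<open>?J\<close> itself.\<close>
  have "outside ?J \<subseteq> outside ?S"
  proof (rule ccontr)
    assume "\<not> outside ?J \<subseteq> outside ?S"
    then have "outside ?J - outside ?S \<noteq> {}" by blast
    moreover have "outside ?S \<noteq> {}" using outside_bounded_nonempty[OF compact_imp_bounded[OF compS]] .
    moreover have "outside ?S \<subseteq> outside ?J" by (rule outside_mono[OF JS])
    moreover have "connected (outside ?J)" by (rule side_props(2)[OF J]) (simp add: sides_def)
    ultimately have "outside ?J \<inter> frontier (outside ?S) \<noteq> {}"
      by (intro connected_Int_frontier) blast+
    then show False using \<gamma>(3) cv outside_no_overlap[of ?J] by simp
  qed
  then have Sin: "?S \<subseteq> ?J \<union> inside ?J"
    using outside_no_overlap[of ?S] inside_Un_outside[of ?J] by blast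
  \<comment> \<open>Cycle edges are left out, as they are modelled on the sides of the target and
    not by chords.\<close>
  define F where "F = G - cycle_edges vs"
  have FE: "\<exists>e\<in>E. p = e \<inter> V \<and> e \<inter> V \<notin> cycle_edges vs" if "p \<in> F" for p using that by (auto simp: F_def G_def)
  have inF: "in_side (inside ?J) F"
    unfolding in_side_def
  proof (intro conjI ballI)
    show "F \<subseteq> G" by (auto simp: F_def)
    fix p assume "p \<in> F"
    then obtain e where e: "e \<in> E" "p = e \<inter> V" "e \<inter> V \<notin> cycle_edges vs" using FE by blast
    have "(e - V) \<inter> ?J = {}"
    proof -
      have "e \<inter> ek k \<subseteq> V" if k: "k < length vs" for k
      proof -
        have "e \<noteq> ek k" using e(3) ce k by auto
        then show ?thesis using Eint[OF e(1) ekE[OF k]] by blast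
      qed
      moreover have "?J = (\<Union>k<length vs. ek k)" unfolding curve_def drawn_def ce using \<delta> ekE by auto
      ultimately show ?thesis by blast
    qed
    moreover have "e \<subseteq> ?J \<union> inside ?J" using Sin Union_upper[OF e(1)] by (meson Un_subset_iff order_trans)
    ultimately show "\<delta> p - p \<subseteq> inside ?J" unfolding e(2) \<delta>[OF e(1)] by blast
  qed
  have vsne: "vs ! 0 \<in> set vs" "vs ! 0 \<in> V" using nvs vsV by auto
  have step_F: "{a, b} \<in> F" if "e \<in> E" "e \<inter> V = {a, b}" "a \<notin> set vs" for a b e
  proof -
    have "{a, b} \<notin> cycle_edges vs" using Union_cycle_edges[of vs] lvs that(3) by auto
    moreover have "{a, b} \<in> G" using that by (auto simp: G_def)
    ultimately show ?thesis by (simp add: F_def)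
  qed
  have innerF: "v \<in> \<Union>F" if v: "v \<in> V" "v \<notin> set vs" for v
  proof -
    have "v \<noteq> vs ! 0" using vsne v by auto
    from conn[OF v(1) vsne(2)] show ?thesis
    proof (cases rule: converse_rtranclE)
      case base then show ?thesis using \<open>v \<noteq> vs ! 0\<close> by contradiction
    next
      case (step b)
      then obtain e where "e \<in> E" "e \<inter> V = {v, b}" by blast
      then have "{v, b} \<in> F" by (rule step_F[OF _ _ v(2)])
      then show ?thesis by blast
    qed
  qed
  have FV: "\<Union>F \<subseteq> V" by (auto simp: F_def G_def)
  \<comment> \<open>By connectedness the inner edges, if there are any, reach the cycle. So the host
    can be chosen among vertices that have an inner edge anyway, and no corner has to carry a
    tree.\<close>
  obtain h where h: "h \<in> set vs" "F \<noteq> {} \<Longrightarrow> h \<in> \<Union>F"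
  proof (cases "F = {}")
    case True then show thesis using that vsne by blast
  next
    case False
    have "\<exists>v\<in>set vs. v \<in> \<Union>F"
    proof (rule ccontr)
      assume no: "\<not> (\<exists>v\<in>set vs. v \<in> \<Union>F)"
      obtain p where p: "p \<in> F" using False by blast
      then obtain u where u: "u \<in> p" using two FE by blast
      then have uV: "u \<in> V" "u \<notin> set vs" using p no FV by blast+
      have "(u, vs ! 0) \<in> {(a, b). \<exists>e\<in>E. e \<inter> V = {a, b}}\<^sup>*" using conn uV vsne by blast
      then have "vs ! 0 \<notin> set vs"
      proof induction
        case (step y z)
        then obtain e where "e \<in> E" "e \<inter> V = {y, z}" by blast
        then have "{y, z} \<in> F" by (rule step_F[OF _ _ step.IH])
        then show ?case using no by blast
      qed (use uV in simp)
      then show False using vsne by blast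
    qed
    then show thesis using that by blast
  qed
  have "disk_words vs F" using tree_and_disk_words[of F] cyc inF by (auto simp: sides_def)
  then obtain wd where wd: "word_family h vs F wd" using h(1) by (auto simp: disk_words_def)
  have wd_tree: "\<And>v. v \<in> set vs \<Longrightarrow> tree_word v (wd v)" and wd_own: "\<And>v. v \<in> set vs \<Longrightarrow> set (wd v) \<inter> set vs = {v}"
    and wd_triv: "\<And>v. v \<in> set vs \<Longrightarrow> set (wd v) = {v} \<or> v \<in> \<Union>F \<or> v = h"
    and wd_pair: "\<And>v v'. v \<in> set vs \<Longrightarrow> v' \<in> set vs \<Longrightarrow> v \<noteq> v' \<Longrightarrow> set (wd v) \<inter> set (wd v') = {}"
    and wd_un: "(\<Union>v\<in>set vs. set (wd v)) = \<Union>F \<union> set vs"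
    and wd_cw: "chord_word (concat (map wd vs)) (F \<union> cycle_edges vs) {}"
    using wd unfolding word_family_def by blast+
  have triv: "set (wd v) = {v}" if v: "v \<in> set vs" "v \<notin> \<Union>F" for v
  proof (cases "F = {}")
    case True
    then have "set (wd v) \<subseteq> set vs" using wd_un v(1) by blast
    then show ?thesis using wd_own[OF v(1)] by blast
  next
    case False then show ?thesis using wd_triv[OF v(1)] v(2) h(2) by blast
  qed
  define s where "s = length (border P)"
  note s2 = s2[folded s_def] and ssig = ssig[symmetric, folded s_def]
  define c where "c i = border P ! i" for i
  obtain I where I: "vs = concat (map (\<lambda>i. c i # I i) [0..<s])"
    using subseq_blocks[OF sub _ nvs(1) hd] s2 unfolding c_def s_def by fastforce
  have bord: "border P = map c [0..<s]" unfolding c_def s_def by (simp add: map_nth)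
  have side: "side P i = c i # I i @ [c (Suc i mod s)]" if "i < s" for i
    by (rule side_blocks[OF I[unfolded vs_def] bord dvs[unfolded vs_def] that s2])
  have cvs: "c i \<in> set vs" if "i < s" for i unfolding I using that by (auto intro!: bexI[of _ i])
  \<comment> \<open>A corner already lies on two cycle edges, so an inner edge would raise its
    degree to three.\<close>
  have cF: "c i \<notin> \<Union>F" if i: "i < s" for i
  proof
    assume "c i \<in> \<Union>F"
    then obtain e where e: "e \<in> E" "c i \<in> e" "e \<inter> V \<notin> cycle_edges vs" using FE by blast
    obtain p q where pq: "p \<in> cycle_edges vs" "q \<in> cycle_edges vs" "p \<noteq> q" "c i \<in> p" "c i \<in> q"
      using cycle_edges_at_vertex[OF dvs lvs cvs[OF i]] by blast
    have "p \<in> G" "q \<in> G" using pq(1,2) ceG by auto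
    then obtain f g where fg: "f \<in> E" "p = f \<inter> V" "g \<in> E" "q = g \<inter> V" unfolding G_def by blast
    have d: "e \<noteq> f" "e \<noteq> g" "f \<noteq> g" using e(3) pq fg by auto
    have "{e, f, g} \<subseteq> {e \<in> E. c i \<in> e}" using e fg pq by auto
    then have "card {e, f, g} \<le> card {e \<in> E. c i \<in> e}" using finE by (intro card_mono) auto
    moreover have "c i \<in> set (border P)" unfolding bord using i by auto
    ultimately show False using deg[of "c i"] d by simp
  qed
  have len: "length (side P i) \<le> m + 2" if "i < s" for i
    using assms(2) that unfolding has_size_def s_def by blast
  have card_in: "card (V - set vs) \<le> n" using assms(2) unfolding has_size_def V_def vs_def by blast
  interpret sewn_polygon P c I wd F "m + 2 * n" s
  proof
    show "s = length (signature P)" "2 \<le> s" "is_signature (signature P)" by (fact ssig s2 sig)+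
    show "outer P = concat (map (\<lambda>i. c i # I i) [0..<s])" using I by (simp add: vs_def)
    show "distinct (outer P)" using dvs by (simp add: vs_def)
    show "border P = map c [0..<s]" by (fact bord)
    show "length (I i) = length (I j)" if "twin P i j" for i j
      using twl[OF that] side[of i] side[of j] that ssig by (simp add: twin_def)
    show "finite (verts P)" using finV by (simp add: V_def)
    show "tree_word v (wd v)" "set (wd v) \<inter> set (outer P) = {v}" if "v \<in> set (outer P)" for v
      using wd_tree wd_own that by (auto simp: vs_def)
    show "set (wd v) \<inter> set (wd v') = {}" if "v \<in> set (outer P)" "v' \<in> set (outer P)" "v \<noteq> v'" for v v'
      using wd_pair that by (simp add: vs_def)
    have "\<Union>F \<union> set vs = V" using FV vsV innerF by blast
    then show "(\<Union>v\<in>set (outer P). set (wd v)) = verts P" using wd_un by (simp add: vs_def V_def)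
    show "set (wd (c i)) = {c i}" if "i < s" for i using triv[OF cvs[OF that] cF[OF that]] .
    show "chord_word (concat (map wd (outer P))) F {}"
      using wd_cw unfolding vs_def by (rule chord_word_mono) auto
    show "\<exists>a b. a \<noteq> b \<and> p = {a, b}" if "p \<in> F" for p using FE[OF that] two by metis
    show "c i \<notin> p" if "p \<in> F" "i < s" for p i using cF that by blast
    show "length (I i) + 2 * card (verts P - set (outer P)) \<le> m + 2 * n" if "i < s" for i
      using len[OF that] side[OF that] card_in by (simp add: V_def vs_def)
    show "\<exists>a b. a \<noteq> b \<and> e \<inter> verts P = {a, b}" if "e \<in> edges P" for e
      using two that by (simp add: V_def E_def)
    show "e = e'" if "e \<in> edges P" "e' \<in> edges P" "e \<inter> verts P = e' \<inter> verts P" for e e'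
      using simple that by (simp add: V_def E_def)
    show "e \<inter> verts P \<in> F \<or> e \<inter> verts P \<in> cycle_edges (outer P)" if "e \<in> edges P" for e
      using that by (auto simp: F_def G_def V_def E_def vs_def)
    show "\<exists>e\<in>edges P. e \<inter> verts P = p" if "p \<in> cycle_edges (outer P)" for p
      using ceG that by (auto simp: G_def V_def E_def vs_def)
  qed
  show ?thesis unfolding p_minor_def using sewing_minor_U signature_U by simp
qed

end
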